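(* Let $a>0$ and let $E$ be a Hermite--Biehler function satisfying the following conditions: (I) $E$ is of bounded type in $\mathbb{C}^+$ with mean type $\tau$; (II) $E$ has no real zeros; (III) $E^*(z)=E(-z)$ for all $z\in\mathbb{C}$; (IV) $B\notin\mathcal{H}(E)$, where $B=\frac{i}{2}(E-E^* )$. Let $K$ be the reproducing kernel of $\mathcal{H}(E)$. If $F^+,F^-\in\mathcal{A}(2\tau)$ satisfy $$F^-(x)\le t_a(x)\le F^+(x)\qquad\text{for all real }x,$$ then $$\int_{\mathbb{R}}\bigl(F^+(x)-F^-(x)\bigr)\,\frac{dx}{|E(x)|^2}\ \ge\ \frac{1}{a^2K(0,0)}.$$ Moreover, there exist functions $T_a^+,T_a^-\in\mathcal{A}(2\tau)$ with $T_a^-(x)\le t_a(x)\le T_a^+(x)$ for all real $x$ such that equality holds in the integral inequality for $F^+=T_a^+$ and $F^-=T_a^-$.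
   Context: For $\delta\ge0$, $\mathcal{A}(\delta)$ denotes the class of entire functions $F$ of exponential type $\delta$, meaning: for every $\varepsilon>0$ there is $C_\varepsilon>0$ with $|F(z)|\le C_\varepsilon e^{(\delta+\varepsilon)|z|}$ for all $z\in\mathbb{C}$. For $a>0$, $t_a:\mathbb{R}\to\mathbb{R}$ is defined by $t_a(x)=(x^2+a^2)^{-1}$ if $x\ge0$ and $t_a(x)=0$ if $x<0$. $\mathbb{C}^+$ is the open upper half plane. For an entire function $E$ put $E^*(z)=\overline{E(\overline z)}$. $E$ is a Hermite--Biehler function if $E$ is entire and $|E(z)|>|E^*(z)|$ for all $z$ with $\Im z>0$. A function $F$ analytic in $\mathbb{C}^+$ has bounded type if it is a quotient of two bounded analytic functions in $\mathbb{C}^+$; its mean type is $v(F)=\limsup_{y\to\infty}y^{-1}\log|F(iy)|$ (finite if $F\not\equiv 0$ has bounded type). The de Branges space $\mathcal{H}(E)$ is the space of entire functions $F$ such that $\int_{-\infty}^\infty|F(x)/E(x)|^2dx<\infty$ and both $F/E$ and $F^*/E$ have bounded type and nonpositive mean type in $\mathbb{C}^+$. It is a Hilbert space with scalar product $\langle F,G\rangle_E=\int_{-\infty}^\infty F(x)G^*(x)|E(x)|^{-2}dx$. With $A=\frac12(E+E^* )$ and $B=\frac i2(E-E^* )$, it has the reproducing kernel $$K(w,z)=\frac{B(z)A(\overline w)-A(z)B(\overline w)}{\pi(z-\overline w)}\qquad(z\ne\overline w),$$ extended by continuity to $z=\overline w$. *)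

theory Defs
  imports "HOL-Analysis.Analysis"
begin

abbreviation upper_half_plane :: "complex set" where
  "upper_half_plane \<equiv> {z. Im z > 0}"

definition entire :: "(complex \<Rightarrow> complex) \<Rightarrow> bool" where
  "entire F \<longleftrightarrow> F holomorphic_on UNIV"

definition exp_type_class :: "real \<Rightarrow> (complex \<Rightarrow> complex) set" where
  "exp_type_class \<delta> = {F. entire F \<and>
     (\<forall>\<epsilon>>0. \<exists>C>0. \<forall>z. cmod (F z) \<le> C * exp ((\<delta> + \<epsilon>) * cmod z))}"

definition trunc :: "real \<Rightarrow> real \<Rightarrow> real" where
  "trunc a x = (if x \<ge> 0 then 1 / (x\<^sup>2 + a\<^sup>2) else 0)"

(* An inequality between F(x) and a real number includes the assertion that F(x) is real. *)

definition real_minorant :: "(complex \<Rightarrow> complex) \<Rightarrow> (real \<Rightarrow> real) \<Rightarrow> bool" where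
  "real_minorant F f \<longleftrightarrow> (\<forall>x::real. F (of_real x) \<in> \<real> \<and> Re (F (of_real x)) \<le> f x)"

definition real_majorant :: "(complex \<Rightarrow> complex) \<Rightarrow> (real \<Rightarrow> real) \<Rightarrow> bool" where
  "real_majorant F f \<longleftrightarrow> (\<forall>x::real. F (of_real x) \<in> \<real> \<and> f x \<le> Re (F (of_real x)))"

definition star :: "(complex \<Rightarrow> complex) \<Rightarrow> complex \<Rightarrow> complex" where
  "star F z = cnj (F (cnj z))"

definition hermite_biehler :: "(complex \<Rightarrow> complex) \<Rightarrow> bool" where
  "hermite_biehler E \<longleftrightarrow> entire E \<and> (\<forall>z. Im z > 0 \<longrightarrow> cmod (E z) > cmod (star E z))"

(* The denominator h may have zeros in the half plane, but it must not vanish identically. *)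

definition bounded_type :: "(complex \<Rightarrow> complex) \<Rightarrow> bool" where
  "bounded_type f \<longleftrightarrow> f holomorphic_on upper_half_plane \<and>
     (\<exists>g h. g holomorphic_on upper_half_plane \<and> bounded (g ` upper_half_plane) \<and>
            h holomorphic_on upper_half_plane \<and> bounded (h ` upper_half_plane) \<and>
            (\<exists>z\<in>upper_half_plane. h z \<noteq> 0) \<and>
            (\<forall>z\<in>upper_half_plane. h z \<noteq> 0 \<longrightarrow> f z = g z / h z))"

(* The logarithm of 0 is -\<infinity> here, whereas the library has ln 0 = 0. *)

definition log_abs :: "complex \<Rightarrow> ereal" where
  "log_abs w = (if w = 0 then -\<infinity> else ereal (ln (cmod w)))"

definition mean_type :: "(complex \<Rightarrow> complex) \<Rightarrow> ereal" where
  "mean_type f = Limsup at_top (\<lambda>y::real. ereal (1 / y) * log_abs (f (\<i> * of_real y)))"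

definition de_Branges :: "(complex \<Rightarrow> complex) \<Rightarrow> (complex \<Rightarrow> complex) set" where
  "de_Branges E = {F. entire F \<and>
     integrable lborel (\<lambda>x::real. (cmod (F (of_real x) / E (of_real x)))\<^sup>2) \<and>
     bounded_type (\<lambda>z. F z / E z) \<and> mean_type (\<lambda>z. F z / E z) \<le> 0 \<and>
     bounded_type (\<lambda>z. star F z / E z) \<and> mean_type (\<lambda>z. star F z / E z) \<le> 0}"

definition dB_inner ::
  "(complex \<Rightarrow> complex) \<Rightarrow> (complex \<Rightarrow> complex) \<Rightarrow> (complex \<Rightarrow> complex) \<Rightarrow> complex" where
  "dB_inner E F G = (LINT x|lborel.
     F (of_real x) * star G (of_real x) / of_real ((cmod (E (of_real x)))\<^sup>2))"

(* K w is the function z \<mapsto> K(w,z). The two conditions determine K uniquely. With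
   A = (E + star E) / 2 and B = companion_B E, the closed form of K(w,z) for z \<noteq> cnj w is
   (B z * A (cnj w) - A z * B (cnj w)) / (pi * (z - cnj w)). *)

definition reproducing_kernel ::
  "(complex \<Rightarrow> complex) \<Rightarrow> (complex \<Rightarrow> complex \<Rightarrow> complex) \<Rightarrow> bool" where
  "reproducing_kernel E K \<longleftrightarrow>
     (\<forall>w. K w \<in> de_Branges E \<and> (\<forall>F\<in>de_Branges E. F w = dB_inner E F (K w)))"

definition companion_B :: "(complex \<Rightarrow> complex) \<Rightarrow> complex \<Rightarrow> complex" where
  "companion_B E z = \<i> / 2 * (E z - star E z)"

(* Taken in [0, \<infinity>], so that a divergent integral counts as \<infinity>. The truncation of negative
   values by ennreal is immaterial when Fm \<le> Fp on the real line. *)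

definition gap_integral ::
  "(complex \<Rightarrow> complex) \<Rightarrow> (complex \<Rightarrow> complex) \<Rightarrow> (complex \<Rightarrow> complex) \<Rightarrow> ennreal" where
  "gap_integral E Fp Fm = (\<integral>\<^sup>+ x. ennreal
     ((Re (Fp (of_real x)) - Re (Fm (of_real x))) / (cmod (E (of_real x)))\<^sup>2) \<partial>lborel)"

end

(*
The lower bound. Write E~(z) for the conjugate of E(conj z), and let F = F^+ - F^-, which is nonnegative on the
real line with F(0) >= 1/a^2. For 0 <= r < 1 the function F / (E (E - r E~)) is analytic in the upper half-plane, of nonpositive mean type there and
integrable on the real line, hence has integral zero. Taking real parts,
  int F (1 - r^2) / |E - r E~|^2 dx = int F / |E|^2 dx,
and as r -> 1 the weight on the left concentrates at the zeros of B; the contribution of the zero at 0 is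
F(0) / K(0,0) (Fatou's lemma after rescaling).
Dominated convergence gives equality for F = (B(z) / z)^2, and the same argument identifies K(0,0) with
E(0) B'(0) / pi.

The extremal functions. Put S(z) = B(z) / z and let V(z) = (S(z)^-2 - S(ia)^-2) / (z^2 + a^2). Up to multiples of
S^2, the functions T^+ and T^- are S^2 times the Cauchy integral of V along the imaginary axis on the left
half-plane, continued analytically across the axis. Both inequalities reduce to 0 <= V(iy) <= V(0), that is, to
monotonicity and convexity properties of y -> S(iy)^-2 in the variable y^2, which are evident from the
factorization of the even function S of exponential type with only real zeros.
*)

theory Submission
  imports Defs "HOL-Complex_Analysis.Complex_Analysis" "HOL-Probability.Sinc_Integral" "HOL-Real_Asymp.Real_Asymp"
begin

section \<open>Functions of bounded type\<close>

text \<open>The obstacle is the real axis. Bounded type controls 1/E only by exp(C (1 + |z|)^2 / Im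
  z), and F/E^2 is merely integrable on the line, so neither contour integration nor a
  Phragmen-Lindeloef argument applies directly; the same blow-up stands between the mean type of E
  and its exponential type. The half-plane estimates rest on one device: a function of bounded type
  has a zero-free bounded multiplier exp(-p) with Re p >= 0, and Harnack's inequality for Re p
  replaces factorization theory and boundary values. The constant S(ia)^-2 is subtracted in V to
  cancel the poles at ia and -ia. Then S^2 V is entire, and on the real line it differs from 1/(x^2
  + a^2) by S(ia)^-2 S^2/(x^2 + a^2) only. Crossing the imaginary axis adds S^2 V to S^2 times the
  Cauchy integral, which produces the truncation; V(0)/2 bounds the Cauchy integral on the real line
  and dictates the multiples of S^2. The reproducing property of the explicit candidate E(0) S / pi
  for K(0, .) is never checked: its norm and its membership in H(E), set against the abstract
  kernel, already force K(0,0).\<close>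

lemma open_uhp: "open upper_half_plane"
  by (simp add: open_halfspace_Im_gt)

text \<open>Multiplying \<open>f\<close> by e < 1 makes the bound strict, so that the usual Schwarz
  lemma applies; then e tends to 1.\<close>

lemma Schwarz_Lemma_le:
  assumes holf: "f holomorphic_on ball 0 1" and f0: "f 0 = 0"
    and le: "\<And>z. norm z < 1 \<Longrightarrow> norm (f z) \<le> 1" and z: "norm z < 1"
  shows "norm (f z) \<le> norm z"
proof -
  have *: "e * norm (f z) \<le> norm z" if "0 < e" "e < 1" for e :: real
  proof -
    have "norm (complex_of_real e * f z) \<le> norm z"
    proof (rule Schwarz_Lemma(1)[where f = "\<lambda>z. complex_of_real e * f z"])
      show "norm (complex_of_real e * f w) < 1" if "norm w < 1" for w
        using le[OF that] \<open>0 < e\<close> \<open>e < 1\<close>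
        by (simp add: norm_mult) (smt (verit) mult_left_le norm_ge_zero)
    qed (use holf f0 z in \<open>auto intro!: holomorphic_intros\<close>)
    then show ?thesis using \<open>0 < e\<close> by (simp add: norm_mult)
  qed
  show ?thesis
  proof (rule field_le_epsilon)
    fix d :: real assume "d > 0"
    define e where "e = 1 / (1 + d)"
    have "e * norm (f z) \<le> norm z" using \<open>d > 0\<close> by (intro *) (auto simp: e_def)
    then have "norm (f z) \<le> norm z * (1 + d)" using \<open>d > 0\<close> by (simp add: e_def field_simps)
    also have "\<dots> \<le> norm z + d" using z \<open>d > 0\<close>
      by (simp add: algebra_simps)
    finally show "norm (f z) \<le> norm z + d" .
  qed
qed

lemma cmod_diff_cnj_square:
  "(cmod (z - cnj w))\<^sup>2 - (cmod (z - w))\<^sup>2 = 4 * Im z * Im w"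
  unfolding cmod_power2 by (simp add: power2_eq_square algebra_simps)

lemma cmod_diff_cnj_less:
  assumes "Im z > 0" "Im w > 0"
  shows "cmod (z - w) < cmod (z - cnj w)"
  using mult_pos_pos[OF assms] cmod_diff_cnj_square[of z w]
  by (intro power2_less_imp_less[of "cmod (z - w)"]) auto

text \<open>The Schwarz lemma transported to the half-plane; the right-hand side is the
  pseudo-hyperbolic distance of \<open>z\<close> and \<open>w\<close>.\<close>

lemma Schwarz_upper_half_plane:
  assumes holf: "f holomorphic_on upper_half_plane"
    and le: "\<And>z. Im z > 0 \<Longrightarrow> cmod (f z) \<le> 1"
    and w: "Im w > 0" "f w = 0" and z: "Im z > 0"
  shows "cmod (f z) \<le> cmod (z - w) / cmod (z - cnj w)"
proof -
  \<comment> \<open>Cayley map from the unit disc to the half-plane taking 0 to \<open>w\<close>;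
    its inverse takes \<open>z\<close> to the \<open>\<zeta>\<close> defined further down.\<close>
  define \<phi> where "\<phi> = (\<lambda>\<zeta>. (w - cnj w * \<zeta>) / (1 - \<zeta>))"
  have Im\<phi>: "Im (\<phi> \<zeta>) > 0" if "cmod \<zeta> < 1" for \<zeta>
  proof -
    have "\<zeta> \<noteq> 1" using that by auto
    then have *: "cmod (1 - \<zeta>) > 0" by simp
    have "Im (\<phi> \<zeta>) = Im ((w - cnj w * \<zeta>) * cnj (1 - \<zeta>)) / (cmod (1 - \<zeta>))\<^sup>2"
      unfolding \<phi>_def by (subst complex_div_cnj) (simp only: Im_divide_of_real flip: of_real_power)
    also have "Im ((w - cnj w * \<zeta>) * cnj (1 - \<zeta>)) = Im w * (1 - (cmod \<zeta>)\<^sup>2)"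
      by (simp add: cmod_power2) (simp add: power2_eq_square algebra_simps)
    finally have "Im (\<phi> \<zeta>) = Im w * (1 - (cmod \<zeta>)\<^sup>2) / (cmod (1 - \<zeta>))\<^sup>2" .
    moreover have "(cmod \<zeta>)\<^sup>2 < 1" using that by (simp add: abs_square_less_1)
    ultimately show ?thesis using w * by simp
  qed
  have hol\<phi>: "\<phi> holomorphic_on ball 0 1"
    unfolding \<phi>_def by (intro holomorphic_intros) auto
  have hol: "(f \<circ> \<phi>) holomorphic_on ball 0 1"
    by (rule holomorphic_on_compose_gen[OF hol\<phi> holf]) (use Im\<phi> in auto)
  define \<zeta> where "\<zeta> = (z - w) / (z - cnj w)"
  have n0: "z - cnj w \<noteq> 0" using w z by (auto simp: complex_eq_iff)
  have \<zeta>1: "cmod \<zeta> < 1"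
    using cmod_diff_cnj_less[OF z w(1)] n0 by (simp add: \<zeta>_def norm_divide)
  have e1: "1 - \<zeta> = (w - cnj w) / (z - cnj w)" using n0 by (simp add: \<zeta>_def field_simps)
  have e2: "w - cnj w * \<zeta> = z * (w - cnj w) / (z - cnj w)" using n0 by (simp add: \<zeta>_def field_simps)
  have "w - cnj w \<noteq> 0" using w by (auto simp: complex_eq_iff)
  then have "\<phi> \<zeta> = z" unfolding \<phi>_def e1 e2 using n0 by simp
  moreover have "cmod ((f \<circ> \<phi>) \<zeta>) \<le> cmod \<zeta>"
    by (rule Schwarz_Lemma_le[OF hol _ _ \<zeta>1]) (use le Im\<phi> w in \<open>auto simp: \<phi>_def\<close>)
  ultimately show ?thesis by (simp add: \<zeta>_def norm_divide)
qed

text \<open>Among all multipliers \<open>h\<close> with \<open>\<bar>h\<bar> \<le> 1\<close> and \<open>\<bar>f h\<bar> \<le> 1\<close>, one maximising \<open>\<bar>h w\<bar>\<close> at a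
  suitable point \<open>w\<close> has no zeros, as a zero could be divided out by a Blaschke factor.\<close>

lemma bounded_type_zero_free_denominator:
  assumes "bounded_type f"
  obtains h where "h holomorphic_on upper_half_plane" "\<And>z. Im z > 0 \<Longrightarrow> h z \<noteq> 0"
    "\<And>z. Im z > 0 \<Longrightarrow> cmod (h z) \<le> 1" "\<And>z. Im z > 0 \<Longrightarrow> cmod (f z * h z) \<le> 1"
proof -
  let ?U = upper_half_plane
  obtain g0 h0 w where holf: "f holomorphic_on ?U" and g0: "g0 holomorphic_on ?U" "bounded (g0 ` ?U)"
    and h0: "h0 holomorphic_on ?U" "bounded (h0 ` ?U)" and w: "w \<in> ?U" "h0 w \<noteq> 0"
    and fgh: "\<And>z. z \<in> ?U \<Longrightarrow> h0 z \<noteq> 0 \<Longrightarrow> f z = g0 z / h0 z"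
    using assms unfolding bounded_type_def by blast
  \<comment> \<open>Of the quotient representation only the bound on \<open>f h\<close> is kept: the
    resulting set is a normal family and stable under removal of Blaschke factors.\<close>
  define H where "H = {h. h holomorphic_on ?U \<and> (\<forall>z\<in>?U. cmod (h z) \<le> 1 \<and> cmod (f z * h z) \<le> 1)}"
  obtain M1 where M1: "M1 > 0" "\<And>z. z \<in> ?U \<Longrightarrow> cmod (g0 z) \<le> M1"
    using g0(2) unfolding bounded_pos by auto
  obtain M2 where M2: "M2 > 0" "\<And>z. z \<in> ?U \<Longrightarrow> cmod (h0 z) \<le> M2"
    using h0(2) unfolding bounded_pos by auto
  \<comment> \<open>Dividing by a common bound for \<open>g0\<close> and \<open>h0\<close> puts a
    multiplier with nonzero value at \<open>w\<close> into \<open>H\<close>; hence the supremum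
    \<open>s\<close> is positive.\<close>
  define h1 where "h1 = (\<lambda>z. h0 z / complex_of_real (max M1 M2))"
  have h1H: "h1 \<in> H"
  proof -
    have "cmod (h1 z) \<le> 1" "cmod (f z * h1 z) \<le> 1" if z: "z \<in> ?U" for z
    proof -
      show "cmod (h1 z) \<le> 1" using M1 M2(1) M2(2)[OF z] by (simp add: h1_def norm_divide field_simps)
      show "cmod (f z * h1 z) \<le> 1"
        using M1(1) M1(2)[OF z] M2(1) fgh[OF z]
        by (cases "h0 z = 0") (simp_all add: h1_def norm_divide norm_mult field_simps)
    qed
    then show ?thesis using h0(1) M1(1) unfolding H_def h1_def
      by (auto intro!: holomorphic_intros)
  qed
  have h1w: "cmod (h1 w) > 0" using w M1 by (auto simp: h1_def)
  define s where "s = (SUP h\<in>H. cmod (h w))"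
  have bdd: "bdd_above ((\<lambda>h. cmod (h w)) ` H)" using w by (auto simp: H_def intro!: bdd_aboveI[of _ 1])
  have le_s: "cmod (h w) \<le> s" if "h \<in> H" for h
    unfolding s_def by (rule cSUP_upper[OF that bdd])
  have s0: "s > 0" using le_s[OF h1H] h1w by linarith
  have "\<exists>h\<in>H. s - 1 / real (Suc n) < cmod (h w)" for n
    using less_cSUP_iff[OF _ bdd, of "s - 1 / real (Suc n)"] h1H by (auto simp flip: s_def)
  then obtain hh where hh: "\<And>n. hh n \<in> H" "\<And>n. s - 1 / real (Suc n) < cmod (hh n w)" by metis
  have Mbd: "\<exists>B. \<forall>h \<in> H. \<forall>z \<in> K. norm (h z) \<le> B" if "K \<subseteq> ?U" for K
    using that by (intro exI[of _ 1]) (auto simp: H_def)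
  have Hhol: "h holomorphic_on ?U" if "h \<in> H" for h using that by (simp add: H_def)
  \<comment> \<open>Montel's theorem: a maximizing sequence has a convergent subsequence, whose
    limit attains the supremum.\<close>
  obtain h r where h: "h holomorphic_on ?U" "strict_mono (r :: nat \<Rightarrow> nat)"
    and lim: "\<And>x. x \<in> ?U \<Longrightarrow> (\<lambda>n. hh (r n) x) \<longlonglongrightarrow> h x"
    using Montel[of ?U H hh, OF open_uhp Hhol Mbd] hh(1) by (metis image_subset_iff)
  have hz: "cmod (h z) \<le> 1" "cmod (f z * h z) \<le> 1" if z: "z \<in> ?U" for z
  proof -
    show "cmod (h z) \<le> 1"
      by (rule tendsto_upperbound[OF tendsto_norm[OF lim[OF z]]]) (use hh z in \<open>auto simp: H_def\<close>)
    show "cmod (f z * h z) \<le> 1"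
      by (rule tendsto_upperbound[OF tendsto_norm[OF tendsto_mult[OF tendsto_const[of "f z"] lim[OF z]]]])
        (use hh z in \<open>auto simp: H_def\<close>)
  qed
  have hw: "s \<le> cmod (h w)"
  proof (rule tendsto_le[OF _ tendsto_norm[OF lim[OF w(1)]]])
    have "(\<lambda>n. s - 1 / real (Suc n)) \<longlonglongrightarrow> s - 0"
      by (intro tendsto_intros LIMSEQ_Suc lim_1_over_n)
    then have "(\<lambda>n. s - 1 / real (Suc (r n))) \<longlonglongrightarrow> s"
      using LIMSEQ_subseq_LIMSEQ[OF _ h(2)] by (fastforce simp: o_def)
    then show "(\<lambda>n. s - 1 / real (Suc (r n))) \<longlonglongrightarrow> s" .
    show "\<forall>\<^sub>F n in sequentially. s - 1 / real (Suc (r n)) \<le> cmod (hh (r n) w)"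
      using hh(2) by (auto intro!: always_eventually less_imp_le)
  qed simp
  have nz: "h p \<noteq> 0" if p: "p \<in> ?U" for p
  proof
    assume hp: "h p = 0"
    have cp: "z - cnj p \<noteq> 0" if "z \<in> ?U" for z using p that by (auto simp: complex_eq_iff)
    \<comment> \<open>\<open>h\<close> divided by its Blaschke factor at \<open>p\<close>. By the
      Schwarz lemma, applied to \<open>h\<close> and to \<open>f h\<close>, the quotient stays in
      \<open>H\<close>, yet at \<open>w\<close> it is larger than \<open>h\<close>.\<close>
    define q where "q = (\<lambda>z. (if z = p then deriv h p else (h z - h p) / (z - p)) * (z - cnj p))"
    have holq: "q holomorphic_on ?U"
      unfolding q_def by (intro holomorphic_intros pole_lemma[OF h(1)])
        (use p open_uhp in \<open>simp add: interior_open\<close>)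
    have q_eq: "cmod (q z) = cmod (h z) / (cmod (z - p) / cmod (z - cnj p))" if "z \<noteq> p" for z
      using that hp by (simp add: q_def norm_mult norm_divide)
    have q1: "cmod (q z) \<le> 1" "cmod (f z * q z) \<le> 1" if z: "z \<in> ?U" "z \<noteq> p" for z
    proof -
      have pos: "0 < cmod (z - p) / cmod (z - cnj p)" using z cp by auto
      have "cmod (h z) \<le> cmod (z - p) / cmod (z - cnj p)"
        by (rule Schwarz_upper_half_plane[OF h(1)]) (use hz p z hp in auto)
      then show "cmod (q z) \<le> 1" unfolding q_eq[OF z(2)] using pos by (subst pos_divide_le_eq) auto
      have "cmod (f z * h z) \<le> cmod (z - p) / cmod (z - cnj p)"
        by (rule Schwarz_upper_half_plane[of "\<lambda>z. f z * h z"])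
           (use hz p z hp holf h(1) in \<open>auto intro!: holomorphic_intros\<close>)
      then show "cmod (f z * q z) \<le> 1"
        using pos unfolding norm_mult q_eq[OF z(2)] times_divide_eq_right by (subst pos_divide_le_eq) auto
    qed
    have contq: "isCont q p" "isCont (\<lambda>z. f z * q z) p"
      using holq holf p open_uhp
      by (auto intro!: continuous_intros simp: holomorphic_on_imp_continuous_on
          continuous_on_eq_continuous_at dest!: holomorphic_on_imp_continuous_on)
    have ev: "\<forall>\<^sub>F z in at p. z \<in> ?U \<and> z \<noteq> p"
      using p open_uhp eventually_at_topological by blast
    have q1p: "cmod (q p) \<le> 1" "cmod (f p * q p) \<le> 1"
    proof -
      show "cmod (q p) \<le> 1"
        by (rule tendsto_upperbound[OF tendsto_norm[OF contq(1)[unfolded isCont_def]]])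
          (use ev in \<open>auto elim!: eventually_mono intro: q1\<close>)
      show "cmod (f p * q p) \<le> 1"
        by (rule tendsto_upperbound[OF tendsto_norm[OF contq(2)[unfolded isCont_def]]])
          (use ev q1(2) in \<open>auto elim!: eventually_mono\<close>)
    qed
    have "q \<in> H" unfolding H_def using holq q1 q1p by blast
    then have "cmod (q w) \<le> s" by (rule le_s)
    moreover have wp: "w \<noteq> p" using hw s0 hp by auto
    moreover have "cmod (w - p) / cmod (w - cnj p) < 1"
      using cmod_diff_cnj_less[of w p] w p cp[of w] by simp
    moreover have "0 < cmod (w - p) / cmod (w - cnj p)" using wp cp[of w] w by simp
    ultimately show False using hw s0 unfolding q_eq[OF wp]
      by (smt (verit, best) divide_less_eq_1 less_divide_eq mult_less_cancel_left2 pos_divide_le_eq)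
  qed
  show thesis using that[of h] h(1) nz hz by auto
qed

text \<open>This is the Schwarz lemma for \<open>(p - p w) / (p + cnj (p w))\<close>.\<close>

lemma Harnack_upper_half_plane:
  assumes holp: "p holomorphic_on upper_half_plane"
    and nonneg: "\<And>z. Im z > 0 \<Longrightarrow> Re (p z) \<ge> 0"
    and w: "Im w > 0" and z: "Im z > 0"
  shows "Re (p z) \<le> Re (p w) * (cmod z + cmod w)\<^sup>2 / (Im z * Im w)"
proof -
  \<comment> \<open>The summand \<open>e\<close> keeps the real part strictly positive, so the
    denominator of \<open>m\<close> does not vanish.\<close>
  have *: "Re (p z) + e \<le> (Re (p w) + e) * (cmod z + cmod w)\<^sup>2 / (Im z * Im w)" if e: "e > 0" for e
  proof -
    define q where "q = (\<lambda>\<zeta>. p \<zeta> + of_real e)"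
    define m where "m = (\<lambda>\<zeta>. (q \<zeta> - q w) / (q \<zeta> + cnj (q w)))"
    define t where "t = Re (q z)"
    define t0 where "t0 = Re (q w)"
    have Req: "Re (q \<zeta>) > 0" if "Im \<zeta> > 0" for \<zeta> using nonneg[OF that] e by (simp add: q_def)
    have tt: "t > 0" "t0 > 0" using Req w z by (auto simp: t_def t0_def)
    have sq: "(cmod (q \<zeta> + cnj (q w)))\<^sup>2 - (cmod (q \<zeta> - q w))\<^sup>2 = 4 * Re (q \<zeta>) * t0" for \<zeta>
      unfolding cmod_power2 t0_def by (simp add: power2_eq_square algebra_simps)
    have nz: "q \<zeta> + cnj (q w) \<noteq> 0" if "Im \<zeta> > 0" for \<zeta>
      using Req[OF that] Req[OF w] by (auto simp: complex_eq_iff)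
    have holm: "m holomorphic_on upper_half_plane"
      unfolding m_def q_def using holp nz
      by (intro holomorphic_intros) (auto simp: q_def)
    have m1: "cmod (m \<zeta>) \<le> 1" if "Im \<zeta> > 0" for \<zeta>
    proof -
      have "(cmod (q \<zeta> - q w))\<^sup>2 \<le> (cmod (q \<zeta> + cnj (q w)))\<^sup>2"
        using sq[of \<zeta>] Req[OF that] tt by (smt (verit) mult_pos_pos)
      then have "cmod (q \<zeta> - q w) \<le> cmod (q \<zeta> + cnj (q w))" by (rule power2_le_imp_le) simp
      then show ?thesis using nz[OF that] by (simp add: m_def norm_divide)
    qed
    define d where "d = cmod (z - w)"
    define D where "D = cmod (z - cnj w)"
    have dD: "d < D" "0 \<le> d" using cmod_diff_cnj_less[OF z w] by (auto simp: d_def D_def)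
    have "cmod (m z) \<le> d / D" unfolding d_def D_def
      by (rule Schwarz_upper_half_plane[OF holm m1 w _ z]) (auto simp: m_def)
    then have "cmod (q z - q w) * D \<le> d * cmod (q z + cnj (q w))"
      using nz[OF z] dD by (simp add: m_def norm_divide field_simps)
    then have "(cmod (q z - q w) * D)\<^sup>2 \<le> (d * cmod (q z + cnj (q w)))\<^sup>2"
      by (rule power_mono) (use dD in auto)
    also have "(d * cmod (q z + cnj (q w)))\<^sup>2 = d\<^sup>2 * ((cmod (q z - q w))\<^sup>2 + 4 * t * t0)"
      using sq[of z] by (simp add: power_mult_distrib t_def)
    finally have 1: "(cmod (q z - q w))\<^sup>2 * (D\<^sup>2 - d\<^sup>2) \<le> 4 * d\<^sup>2 * t * t0"
      by (simp add: power_mult_distrib algebra_simps)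
    have "(t - t0)\<^sup>2 \<le> (cmod (q z - q w))\<^sup>2"
      unfolding cmod_power2 t_def t0_def by simp
    moreover have Dd: "D\<^sup>2 - d\<^sup>2 = 4 * Im z * Im w" unfolding D_def d_def by (rule cmod_diff_cnj_square)
    moreover have Dd0: "D\<^sup>2 - d\<^sup>2 > 0" unfolding Dd using z w by simp
    ultimately have "(t - t0)\<^sup>2 * (D\<^sup>2 - d\<^sup>2) \<le> 4 * d\<^sup>2 * t * t0"
      using 1 by (meson mult_right_mono order_trans less_imp_le)
    \<comment> \<open>The roots of this quadratic in t/t0 are the sharp Harnack bounds (D + d)/(D -
      d) and (D - d)/(D + d). If the first factor were positive the second would be too, so the
      first is nonpositive.\<close>
    then have "(t * (D - d) - t0 * (D + d)) * (t * (D + d) - t0 * (D - d)) \<le> 0"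
      by (simp add: power2_eq_square algebra_simps)
    moreover have "t * (D - d) \<le> t0 * (D + d)"
    proof (rule ccontr)
      assume "\<not> ?thesis"
      then have a: "t * (D - d) - t0 * (D + d) > 0" by simp
      have "t * (D + d) - t0 * (D - d) > 0"
      proof -
        have "t * (D - d) \<le> t * (D + d)" "t0 * (D - d) \<le> t0 * (D + d)"
          using tt dD by (auto intro!: mult_left_mono)
        then show ?thesis using a by linarith
      qed
      then show False using a calculation by (smt (verit) mult_pos_pos)
    qed
    ultimately have "t * (D - d) * (D + d) \<le> t0 * (D + d) * (D + d)"
      using dD by (intro mult_right_mono) auto
    then have "t * (4 * Im z * Im w) \<le> t0 * (D + d)\<^sup>2"
      unfolding Dd[symmetric] by (simp add: power2_eq_square algebra_simps)
    also have "\<dots> \<le> t0 * (2 * (cmod z + cmod w))\<^sup>2"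
    proof (intro mult_left_mono power_mono)
      have "D \<le> cmod z + cmod w" unfolding D_def using norm_triangle_ineq4[of z "cnj w"] by simp
      moreover have "d \<le> cmod z + cmod w" unfolding d_def by (rule norm_triangle_ineq4)
      ultimately show "D + d \<le> 2 * (cmod z + cmod w)" by simp
    qed (use tt dD in auto)
    finally have "t \<le> t0 * (cmod z + cmod w)\<^sup>2 / (Im z * Im w)"
      using w z by (simp add: field_simps power2_eq_square)
    then show ?thesis by (simp add: t_def t0_def q_def)
  qed
  have "((\<lambda>e. Re (p z) + e) \<longlongrightarrow> Re (p z) + 0) (at_right 0)" by (intro tendsto_intros)
  moreover have "((\<lambda>e. (Re (p w) + e) * (cmod z + cmod w)\<^sup>2 / (Im z * Im w)) \<longlongrightarrow>
      (Re (p w) + 0) * (cmod z + cmod w)\<^sup>2 / (Im z * Im w)) (at_right 0)"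
    by (intro tendsto_intros) (use w z in auto)
  ultimately show ?thesis
    by (intro tendsto_le[OF _ _ _ , of "at_right 0"]) (use * in \<open>auto simp: eventually_at_right_less intro!: eventually_at_rightI[of 0 1]\<close>)
qed

text \<open>\<open>c\<close> is the coefficient of the linear term in the Herglotz representation of
  Re p, reached as the infimum of Re p / Im z. Harnack's inequality from a nearly minimizing point
  \<open>w\<close> makes the remainder o(|z|^2 / Im z).\<close>

lemma positive_harmonic_slope:
  assumes holp: "p holomorphic_on upper_half_plane"
    and nonneg: "\<And>z. Im z > 0 \<Longrightarrow> Re (p z) \<ge> 0"
  obtains c where "\<And>z. Im z > 0 \<Longrightarrow> c * Im z \<le> Re (p z)"
    "\<And>\<epsilon>. \<epsilon> > 0 \<Longrightarrow> \<exists>R>0. \<forall>z. Im z > 0 \<longrightarrow> R \<le> cmod z \<longrightarrow> Re (p z) \<le> c * Im z + \<epsilon> * (cmod z)\<^sup>2 / Im z"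
proof -
  let ?U = upper_half_plane
  define c where "c = (INF z\<in>?U. Re (p z) / Im z)"
  have bdd: "bdd_below ((\<lambda>z. Re (p z) / Im z) ` ?U)"
    by (rule bdd_belowI[of _ 0]) (use nonneg in auto)
  have ne: "?U \<noteq> {}" by (auto intro!: exI[of _ \<i>])
  have c1: "c * Im z \<le> Re (p z)" if "Im z > 0" for z
  proof -
    have "c \<le> Re (p z) / Im z" unfolding c_def by (rule cINF_lower[OF bdd]) (use that in auto)
    then show ?thesis using that by (simp add: field_simps)
  qed
  have c2: "\<exists>R>0. \<forall>z. Im z > 0 \<longrightarrow> R \<le> cmod z \<longrightarrow> Re (p z) \<le> c * Im z + \<epsilon> * (cmod z)\<^sup>2 / Im z"
    if \<epsilon>: "\<epsilon> > 0" for \<epsilon>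
  proof -
    have "(INF z\<in>?U. Re (p z) / Im z) < c + \<epsilon> / 4" using \<epsilon> by (simp flip: c_def)
    then obtain w where w: "Im w > 0" "Re (p w) / Im w < c + \<epsilon> / 4"
      using cINF_less_iff[OF ne bdd] by auto
    define q where "q = (\<lambda>z. p z + \<i> * of_real c * z)"
    have Req: "Re (q z) = Re (p z) - c * Im z" for z by (simp add: q_def)
    have holq: "q holomorphic_on ?U" unfolding q_def using holp by (intro holomorphic_intros)
    have qw: "Re (q w) \<le> \<epsilon> / 4 * Im w" using w by (simp add: Req field_simps)
    have "Re (p z) \<le> c * Im z + \<epsilon> * (cmod z)\<^sup>2 / Im z" if z: "Im z > 0" "cmod w \<le> cmod z" for z
    proof -
      have "Re (q z) \<le> Re (q w) * (cmod z + cmod w)\<^sup>2 / (Im z * Im w)"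
        by (rule Harnack_upper_half_plane[OF holq _ w(1) z(1)]) (use c1 in \<open>auto simp: Req\<close>)
      \<comment> \<open>For |w| <= |z| the square is at most 4 |z|^2, which consumes the factor
        1/4.\<close>
      also have "\<dots> \<le> (\<epsilon> / 4 * Im w) * (2 * cmod z)\<^sup>2 / (Im z * Im w)"
        using qw z w \<epsilon> by (intro divide_right_mono mult_mono power_mono) auto
      also have "\<dots> = \<epsilon> * (cmod z)\<^sup>2 / Im z" using w by (simp add: power2_eq_square)
      finally show ?thesis by (simp add: Req)
    qed
    moreover have "cmod w > 0" using w by auto
    ultimately show ?thesis by blast
  qed
  show thesis by (rule that[OF c1 c2])
qed

lemma convex_uhp: "convex upper_half_plane"
  by (simp add: convex_halfspace_Im_gt)

text \<open>With this sign |h| <= 1 means Re p >= 0, the situation of Harnack's inequality.\<close>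

lemma zero_free_log:
  assumes "h holomorphic_on upper_half_plane" "\<And>z. Im z > 0 \<Longrightarrow> h z \<noteq> 0"
  obtains p where "p holomorphic_on upper_half_plane" "\<And>z. Im z > 0 \<Longrightarrow> cmod (h z) = exp (- Re (p z))"
proof -
  obtain g where g: "g holomorphic_on upper_half_plane" "\<And>z. z \<in> upper_half_plane \<Longrightarrow> h z = exp (g z)"
    using contractible_imp_holomorphic_log[OF assms(1) convex_imp_contractible[OF convex_uhp]] assms(2)
    by (auto simp del: mem_Collect_eq simp: mem_Collect_eq[of _ "\<lambda>z. Im z > 0"])
  show thesis
    by (rule that[of "\<lambda>z. - g z"]) (use g in \<open>auto intro!: holomorphic_intros\<close>)
qed

section \<open>Phragmen-Lindeloef principles\<close>

lemma le_exp_epsilon_small: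
  fixes x M q :: real
  assumes "d > 0" "\<And>e. 0 < e \<Longrightarrow> e < d \<Longrightarrow> x \<le> M * exp (e * q)"
  shows "x \<le> M"
proof -
  have "((\<lambda>e. M * exp (e * q)) \<longlongrightarrow> M * exp (0 * q)) (at_right 0)" by (intro tendsto_intros)
  moreover have "\<forall>\<^sub>F e in at_right 0. x \<le> M * exp (e * q)"
    by (rule eventually_at_rightI[of 0 d]) (use assms in auto)
  ultimately have "x \<le> M * exp (0 * q)"
    by (intro tendsto_lowerbound[of _ _ "at_right 0"]) auto
  then show ?thesis by simp
qed

lemma le_exp_epsilon:
  fixes x M q :: real
  assumes "\<And>e. e > 0 \<Longrightarrow> x \<le> M * exp (e * q)"
  shows "x \<le> M"
  by (rule le_exp_epsilon_small[of 1]) (use assms in auto)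

lemma Re_one_divide_le:
  assumes "Re u > 0"
  shows "Re (1 / u) \<le> 1 / Re u"
proof -
  have "Re (1 / u) = Re u / ((Re u)\<^sup>2 + (Im u)\<^sup>2)" by (simp add: Re_divide)
  also have "\<dots> \<le> Re u / (Re u)\<^sup>2" using assms by (intro divide_left_mono) (auto intro!: mult_pos_pos add_pos_nonneg)
  finally show ?thesis using assms by (simp add: power2_eq_square)
qed

text \<open>After the substitution \<open>z = t\<^sup>2\<close> the quadrant becomes the sector \<open>0 \<le> Im t \<le> Re t\<close>, on which
  \<open>exp (- e (1 - 2 i) t\<^sup>3)\<close> is an entire function of decay of order 3.\<close>

lemma Phragmen_Lindeloef_quadrant:
  assumes contf: "continuous_on {z. 0 \<le> Re z \<and> 0 \<le> Im z} f"
    and holf: "f holomorphic_on {z. 0 < Re z \<and> 0 < Im z}"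
    and growth: "\<And>z. 0 \<le> Re z \<Longrightarrow> 0 \<le> Im z \<Longrightarrow> cmod (f z) \<le> exp (C * (1 + cmod z))"
    and edge: "\<And>z. 0 \<le> Re z \<Longrightarrow> 0 \<le> Im z \<Longrightarrow> Re z = 0 \<or> Im z = 0 \<Longrightarrow> cmod (f z) \<le> M"
    and M: "M > 0" and z: "0 \<le> Re z" "0 \<le> Im z"
  shows "cmod (f z) \<le> M"
proof (cases "Re z = 0 \<or> Im z = 0")
  case True
  then show ?thesis using edge z by blast
next
  case False
  define t0 where "t0 = csqrt z"
  have t0z: "t0\<^sup>2 = z" by (simp add: t0_def)
  have sq: "Re (t\<^sup>2) = (Re t)\<^sup>2 - (Im t)\<^sup>2" "Im (t\<^sup>2) = 2 * Re t * Im t" for t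
    by (simp_all add: power2_eq_square)
  have t0: "0 < Im t0" "Im t0 < Re t0"
  proof -
    have r: "Re t0 \<ge> 0" unfolding t0_def using Re_csqrt by blast
    have "Re z > 0" "Im z > 0" using z False by auto
    then have *: "2 * Re t0 * Im t0 > 0" "(Re t0)\<^sup>2 - (Im t0)\<^sup>2 > 0" using sq[of t0] unfolding t0z by linarith+
    show "0 < Im t0" using *(1) r by (smt (verit) mult_nonneg_nonpos)
    show "Im t0 < Re t0" using *(2) by (intro power2_less_imp_less[OF _ r]) linarith
  qed
  have quad: "0 \<le> Re (t\<^sup>2)" "0 \<le> Im (t\<^sup>2)" if "0 \<le> Im t" "Im t \<le> Re t" for t
  proof -
    show "0 \<le> Re (t\<^sup>2)" using power_mono[OF that(2,1), of 2] unfolding sq by linarith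
    show "0 \<le> Im (t\<^sup>2)" unfolding sq by (intro mult_nonneg_nonneg) (use that in auto)
  qed
  \<comment> \<open>On the sector the argument of t^3 runs from 0 to 135 degrees, more than a right
    angle. The factor 1 - 2 i turns it back by about 63 degrees, so that the real part stays
    positive throughout.\<close>
  define Q where "Q = (\<lambda>t::complex. (1 - 2 * \<i>) * t ^ 3)"
  have ReQ: "Re (Q t) \<ge> (cmod t) ^ 3 / 8" if t: "0 \<le> Im t" "Im t \<le> Re t" for t
  proof -
    define x y where "x = Re t" and "y = Im t"
    have xy: "0 \<le> y" "y \<le> x" using t by (auto simp: x_def y_def)
    have "Re (Q t) = x ^ 3 + y * (6 * x\<^sup>2 - 3 * x * y - 2 * y\<^sup>2)"
      by (simp add: Q_def x_def y_def power2_eq_square power3_eq_cube algebra_simps)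
    moreover have "3 * x * y \<le> 3 * x\<^sup>2" "2 * y\<^sup>2 \<le> 2 * x\<^sup>2"
      using xy by (auto simp: power2_eq_square intro!: mult_mono)
    moreover have "x\<^sup>2 \<ge> 0" by simp
    ultimately have "Re (Q t) \<ge> x ^ 3" using xy by (smt (verit) mult_nonneg_nonneg)
    moreover have "cmod t \<le> 2 * x" using cmod_le[of t] xy by (simp add: x_def y_def)
    then have "(cmod t) ^ 3 \<le> (2 * x) ^ 3" by (intro power_mono) auto
    ultimately show ?thesis by (simp add: power_mult_distrib)
  qed
  show ?thesis
  proof (rule le_exp_epsilon)
    fix e :: real assume e: "e > 0"
    define g where "g = (\<lambda>t. f (t\<^sup>2) * exp (- of_real e * Q t))"
    have eq: "cmod (g t) = cmod (f (t\<^sup>2)) * exp (- e * Re (Q t))" for t by (simp add: g_def norm_mult)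
    \<comment> \<open>On the arc the growth of f(t^2), of order 2 in t, is beaten by the cubic
      damping once \<open>r\<close> is large.\<close>
    have lim: "filterlim (\<lambda>r::real. C * (1 + r\<^sup>2) - e * (r ^ 3 / 8)) at_bot at_top"
      using e by real_asymp
    have "\<forall>\<^sub>F r in at_top. C * (1 + r\<^sup>2) - e * (r ^ 3 / 8) \<le> ln M"
      using lim by (simp add: filterlim_at_bot)
    then have "\<forall>\<^sub>F r in at_top. C * (1 + r\<^sup>2) - e * (r ^ 3 / 8) \<le> ln M \<and> r > cmod t0"
      by (intro eventually_conj eventually_gt_at_top)
    then obtain r where r: "C * (1 + r\<^sup>2) - e * (r ^ 3 / 8) \<le> ln M" "r > cmod t0"
      using eventually_happens'[OF trivial_limit_at_top_linorder] by blast
    define S where "S = {t. 0 < Im t} \<inter> {t. Im t < Re t} \<inter> ball 0 r"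
    define W where "W = {t. 0 \<le> Im t} \<inter> {t. Im t \<le> Re t} \<inter> cball 0 r"
    have oS: "open S" unfolding S_def
      by (intro open_Int open_halfspace_Im_gt open_ball open_Collect_less continuous_intros)
    have clW: "closed W" unfolding W_def
      by (intro closed_Int closed_halfspace_Im_ge closed_cball closed_Collect_le continuous_intros)
    have SW: "S \<subseteq> W" by (auto simp: S_def W_def)
    have clS: "closure S \<subseteq> W" by (rule closure_minimal[OF SW clW])
    have "cmod (g t0) \<le> M"
    proof (rule maximum_modulus_frontier[where S = S and f = g])
      show "g holomorphic_on interior S"
        unfolding g_def Q_def interior_open[OF oS]
        by (intro holomorphic_intros holomorphic_on_compose_gen[OF _ holf, of "\<lambda>t. t\<^sup>2", unfolded o_def])
          (auto simp: S_def power2_eq_square intro!: mult_strict_mono)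
      have "continuous_on W g"
        unfolding g_def Q_def
        by (intro continuous_intros continuous_on_compose2[OF contf]) (use quad in \<open>auto simp: W_def\<close>)
      then show "continuous_on (closure S) g" using clS continuous_on_subset by blast
      show "bounded S" unfolding S_def by (simp add: bounded_Int)
      show "t0 \<in> S" using t0 r by (auto simp: S_def)
      show "cmod (g t) \<le> M" if t: "t \<in> frontier S" for t
      proof -
        have tW: "t \<in> W" and tS: "t \<notin> S" using t clS oS by (auto simp: frontier_def interior_open)
        have t1: "0 \<le> Im t" "Im t \<le> Re t" using tW by (auto simp: W_def)
        have Q0: "(cmod t) ^ 3 / 8 \<le> Re (Q t)" using ReQ t1 by auto
        show ?thesis
        proof (cases "cmod t = r")
          case True
          have "cmod (g t) \<le> exp (C * (1 + cmod (t\<^sup>2))) * exp (- e * (cmod t ^ 3 / 8))"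
            unfolding eq using Q0 growth quad t1 e by (intro mult_mono) auto
          also have "\<dots> = exp (C * (1 + r\<^sup>2) - e * (r ^ 3 / 8))"
            using True by (simp add: norm_power flip: exp_add)
          also have "\<dots> \<le> exp (ln M)" using r by simp
          finally show ?thesis using M by simp
        next
          case F: False
          then have "Im t = 0 \<or> Im t = Re t" using tW tS by (auto simp: W_def S_def)
          then have "cmod (f (t\<^sup>2)) \<le> M" using t1 by (intro edge) (auto simp: power2_eq_square)
          moreover have "Re (Q t) \<ge> 0" using Q0 by (smt (verit) divide_nonneg_pos norm_ge_zero zero_le_power)
          then have "exp (- e * Re (Q t)) \<le> 1" using e by simp
          ultimately have "cmod (f (t\<^sup>2)) * exp (- e * Re (Q t)) \<le> M * 1" using M by (intro mult_mono) auto
          then show ?thesis by (simp add: eq)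
        qed
      qed
    qed
    then show "cmod (f z) \<le> M * exp (e * Re (Q t0))"
      by (simp add: eq t0z exp_minus field_simps)
  qed
qed

text \<open>The divisor 1 - i e z has modulus at least 1 in the half-plane and at least e r - 1 on
  the circle of radius \<open>r\<close>. For large \<open>r\<close> this brings the crude bound
  \<open>B\<close> down to \<open>M\<close>; then e tends to 0.\<close>

lemma Phragmen_Lindeloef_bounded:
  assumes contf: "continuous_on {z. 0 \<le> Im z} f"
    and holf: "f holomorphic_on upper_half_plane"
    and bound: "\<And>z. 0 \<le> Im z \<Longrightarrow> cmod (f z) \<le> B"
    and edge: "\<And>x::real. cmod (f (of_real x)) \<le> M"
    and M: "M > 0" and z: "0 \<le> Im z"
  shows "cmod (f z) \<le> M"
proof (cases "Im z = 0")
  case True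
  then show ?thesis using edge[of "Re z"] by (metis complex_is_Real_iff of_real_Re)
next
  case False
  have *: "cmod (f z) \<le> M * exp (e * cmod z)" if e: "e > 0" for e
  proof -
    define g where "g = (\<lambda>z. f z / (1 - \<i> * of_real e * z))"
    have B: "B \<ge> 0" using bound[of 0] by (smt (verit) norm_ge_zero zero_complex.simps)
    define r where "r = cmod z + 1 + (B / M + 1) / e"
    have "(B / M + 1) / e > 0" using e B M by (intro divide_pos_pos add_nonneg_pos) auto
    then have r: "r > cmod z" "r > 0" unfolding r_def by (smt (verit) norm_ge_zero)+
    have "e * r = e * cmod z + e + (B / M + 1)" using e M by (simp add: r_def field_simps)
    moreover have "e * cmod z \<ge> 0" "B / M \<ge> 0" using e B M by auto
    ultimately have ger: "e * r - 1 \<ge> B / M" "e * r - 1 > 0" using e by linarith+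
    have den1: "cmod (1 - \<i> * of_real e * w) \<ge> 1" if "0 \<le> Im w" for w
    proof -
      have "Re (1 - \<i> * of_real e * w) = 1 + e * Im w" by simp
      moreover have "e * Im w \<ge> 0" using that e by simp
      ultimately show ?thesis using complex_Re_le_cmod[of "1 - \<i> * of_real e * w"] by linarith
    qed
    have den0: "1 - \<i> * of_real e * w \<noteq> 0" if "0 \<le> Im w" for w
      using den1[OF that] by (metis norm_zero not_one_le_zero)
    define S where "S = {t. 0 < Im t} \<inter> ball 0 r"
    define W where "W = {t. 0 \<le> Im t} \<inter> cball 0 r"
    have oS: "open S" unfolding S_def by (intro open_Int open_halfspace_Im_gt open_ball)
    have clW: "closed W" unfolding W_def by (intro closed_Int closed_halfspace_Im_ge closed_cball)
    have clS: "closure S \<subseteq> W" by (rule closure_minimal[OF _ clW]) (auto simp: S_def W_def)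
    have "cmod (g z) \<le> M"
    proof (rule maximum_modulus_frontier[where S = S and f = g])
      show "g holomorphic_on interior S"
        unfolding g_def interior_open[OF oS] using den0
        by (intro holomorphic_intros holomorphic_on_subset[OF holf]) (auto simp: S_def)
      have "continuous_on W g"
        unfolding g_def using den0
        by (intro continuous_intros continuous_on_subset[OF contf]) (auto simp: W_def)
      then show "continuous_on (closure S) g" using clS continuous_on_subset by blast
      show "bounded S" unfolding S_def by (simp add: bounded_Int)
      show "z \<in> S" using z False r by (auto simp: S_def)
      show "cmod (g t) \<le> M" if t: "t \<in> frontier S" for t
      proof -
        have tW: "t \<in> W" and tS: "t \<notin> S" using t clS oS by (auto simp: frontier_def interior_open)
        then have t1: "0 \<le> Im t" by (auto simp: W_def)
        show ?thesis
        proof (cases "cmod t = r")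
          case True
          have "cmod (1 - \<i> * of_real e * t) \<ge> e * r - 1"
            using norm_triangle_ineq2[of "\<i> * of_real e * t" 1] e True by (simp add: norm_mult norm_minus_commute)
          then have "cmod (g t) \<le> B / (e * r - 1)"
            unfolding g_def norm_divide using bound[OF t1] ger B by (intro frac_le) auto
          also have "\<dots> \<le> M" using ger M by (simp add: field_simps)
          finally show ?thesis .
        next
          case F: False
          then have "Im t = 0" using tW tS by (auto simp: W_def S_def)
          then have "cmod (f t) \<le> M" using edge[of "Re t"] by (metis complex_is_Real_iff of_real_Re)
          then have "cmod (g t) \<le> M / 1" unfolding g_def norm_divide
            using den1[OF t1] M by (intro frac_le) auto
          then show ?thesis by simp
        qed
      qed
    qed
    then have "cmod (f z) \<le> M * cmod (1 - \<i> * of_real e * z)"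
      using den1[OF z] unfolding g_def norm_divide by (simp add: divide_le_eq split: if_splits)
    also have "cmod (1 - \<i> * of_real e * z) \<le> 1 + e * cmod z"
      using norm_triangle_ineq4[of 1 "\<i> * of_real e * z"] e by (simp add: norm_mult)
    also have "1 + e * cmod z \<le> exp (e * cmod z)" by (rule exp_ge_add_one_self)
    finally show ?thesis using M by simp
  qed
  show ?thesis by (rule le_exp_epsilon[OF *])
qed

text \<open>Order 1 is admissible in each quadrant, where the critical order is 2. After damping by
  exp(i e z) the axis is bounded by a crude constant, so both quadrants yield some bound; the
  bounded case then sharpens it to the bound on the real line.\<close>

lemma Phragmen_Lindeloef_half_plane:
  assumes contf: "continuous_on {z. 0 \<le> Im z} f"
    and holf: "f holomorphic_on upper_half_plane"
    and growth: "\<And>z. 0 \<le> Im z \<Longrightarrow> cmod (f z) \<le> exp (C * (1 + cmod z))"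
    and edge: "\<And>x::real. cmod (f (of_real x)) \<le> M"
    and axis: "\<And>e. e > 0 \<Longrightarrow> \<exists>K. \<forall>y\<ge>0. cmod (f (\<i> * of_real y)) \<le> K * exp (e * y)"
    and M: "M > 0" and z: "0 \<le> Im z"
  shows "cmod (f z) \<le> M"
proof -
  have "cmod (f z) \<le> M * exp (e * Im z)" if e: "e > 0" for e
  proof -
    obtain K where K: "\<And>y. y \<ge> 0 \<Longrightarrow> cmod (f (\<i> * of_real y)) \<le> K * exp (e * y)" using axis[OF e] by blast
    define L where "L = max M K"
    have L: "L > 0" using M by (simp add: L_def)
    define g where "g = (\<lambda>z. f z * exp (\<i> * of_real e * z))"
    have gn: "cmod (g w) = cmod (f w) * exp (- e * Im w)" for w by (simp add: g_def norm_mult)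
    have cg: "continuous_on {z. 0 \<le> Im z} g" unfolding g_def by (intro continuous_intros contf)
    have hg: "g holomorphic_on upper_half_plane" unfolding g_def by (intro holomorphic_intros holf)
    have g_le: "cmod (g w) \<le> cmod (f w)" if "0 \<le> Im w" for w
      unfolding gn using that e by (simp add: mult_left_le)
    have g_growth: "cmod (g w) \<le> exp (C * (1 + cmod w))" if "0 \<le> Im w" for w
      using g_le[OF that] growth[OF that] by linarith
    have g_real: "cmod (g w) \<le> M" if "Im w = 0" for w
    proof -
      have "w = of_real (Re w)" using that by (simp add: complex_eq_iff)
      then show ?thesis using edge[of "Re w"] g_le[of w] that by simp
    qed
    have g_imag: "cmod (g w) \<le> L" if "Re w = 0" "0 \<le> Im w" for w
    proof -
      have w: "w = \<i> * of_real (Im w)" using that by (simp add: complex_eq_iff)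
      have "cmod (f w) \<le> K * exp (e * Im w)" using K[OF that(2)] w by simp
      then have "cmod (g w) \<le> K" unfolding gn by (simp add: exp_minus field_simps)
      then show ?thesis by (simp add: L_def)
    qed
    have 1: "cmod (g w) \<le> L" if w: "0 \<le> Re w" "0 \<le> Im w" for w
    proof (rule Phragmen_Lindeloef_quadrant[OF _ _ _ _ L w])
      show "continuous_on {z. 0 \<le> Re z \<and> 0 \<le> Im z} g" by (rule continuous_on_subset[OF cg]) auto
      show "g holomorphic_on {z. 0 < Re z \<and> 0 < Im z}" by (rule holomorphic_on_subset[OF hg]) auto
    qed (use g_growth g_real g_imag in \<open>auto simp: L_def le_max_iff_disj\<close>)
    \<comment> \<open>Multiplication by i carries the first quadrant to the second.\<close>
    have 2: "cmod (g (\<i> * w)) \<le> L" if w: "0 \<le> Re w" "0 \<le> Im w" for w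
    proof (rule Phragmen_Lindeloef_quadrant[where f = "\<lambda>w. g (\<i> * w)", OF _ _ _ _ L w])
      show "continuous_on {z. 0 \<le> Re z \<and> 0 \<le> Im z} (\<lambda>w. g (\<i> * w))"
        by (rule continuous_on_compose2[OF cg]) (auto intro!: continuous_intros)
      show "(\<lambda>w. g (\<i> * w)) holomorphic_on {z. 0 < Re z \<and> 0 < Im z}"
        by (rule holomorphic_on_compose_gen[OF _ hg, unfolded o_def]) (auto intro!: holomorphic_intros)
      show "cmod (g (\<i> * w)) \<le> exp (C * (1 + cmod w))" if "0 \<le> Re w" "0 \<le> Im w" for w
        using g_growth[of "\<i> * w"] that by (simp add: norm_mult)
      show "cmod (g (\<i> * w)) \<le> L" if "0 \<le> Re w" "0 \<le> Im w" "Re w = 0 \<or> Im w = 0" for w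
        using that g_real[of "\<i> * w"] g_imag[of "\<i> * w"] by (auto simp: L_def le_max_iff_disj)
    qed
    have 3: "cmod (g w) \<le> L" if "0 \<le> Im w" for w
    proof (cases "Re w \<ge> 0")
      case False
      then show ?thesis using 2[of "- \<i> * w"] that by simp
    qed (use 1 that in auto)
    have "cmod (g z) \<le> M"
      by (rule Phragmen_Lindeloef_bounded[OF cg hg 3 _ M z]) (auto intro: g_real)
    then show ?thesis unfolding gn by (simp add: exp_minus field_simps)
  qed
  then show ?thesis by (rule le_exp_epsilon)
qed

text \<open>A domain inside a lens with corners \<open>p\<close> and \<open>q\<close> on the real axis: the factor
  \<open>exp (- K / (z - p) - K / (q - z))\<close> compensates a blow-up like \<open>exp (C / \<bar>Im z\<bar>)\<close> near the corners.\<close>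

lemma lens_bound:
  fixes p q \<sigma> C M :: real
  assumes pq: "p < q" and \<sigma>: "0 < \<sigma>" and C: "C > 0" and M: "M > 0" and oS: "open S"
    and S: "\<And>z. z \<in> S \<Longrightarrow> \<bar>Im z\<bar> < \<sigma> * (Re z - p) \<and> \<bar>Im z\<bar> < \<sigma> * (q - Re z)"
    and contf: "continuous_on (closure S) f" and holf: "f holomorphic_on S"
    and bd: "\<And>z. z \<in> frontier S \<Longrightarrow> z \<noteq> of_real p \<Longrightarrow> z \<noteq> of_real q \<Longrightarrow> cmod (f z) \<le> M \<or>
      Im z \<noteq> 0 \<and> (\<bar>Im z\<bar> = \<sigma> * (Re z - p) \<or> \<bar>Im z\<bar> = \<sigma> * (q - Re z)) \<and> cmod (f z) \<le> M * exp (C / \<bar>Im z\<bar>)"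
    and K: "K = C * (1 + \<sigma>\<^sup>2) / \<sigma>" and z: "z \<in> S"
  shows "cmod (f z) \<le> M * exp (K * (Re (1 / (z - of_real p)) + Re (1 / (of_real q - z))))"
proof -
  define u where "u = (\<lambda>z. Re (1 / (z - of_real p)) + Re (1 / (complex_of_real q - z)))"
  define W where "W = {z. \<bar>Im z\<bar> \<le> \<sigma> * (Re z - p)} \<inter> {z. \<bar>Im z\<bar> \<le> \<sigma> * (q - Re z)}"
  have K0: "K > 0" using C \<sigma> by (simp add: K add_pos_nonneg)
  have clW: "closed W" unfolding W_def by (intro closed_Int closed_Collect_le continuous_intros)
  have SW: "closure S \<subseteq> W" by (rule closure_minimal[OF _ clW]) (use S in \<open>fastforce simp: W_def\<close>)
  have Wre: "p \<le> Re w" "Re w \<le> q" if "w \<in> W" for w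
    using that \<sigma> by (auto simp: W_def) (smt (verit) abs_ge_zero mult_pos_neg zero_le_mult_iff)+
  have bS: "bounded S"
  proof -
    have "cmod w \<le> \<bar>p\<bar> + \<bar>q\<bar> + \<sigma> * (q - p)" if "w \<in> S" for w
    proof -
      have w: "w \<in> W" using SW that closure_subset by blast
      have "\<bar>Im w\<bar> \<le> \<sigma> * (q - p)"
        using w Wre[OF w] \<sigma> unfolding W_def by (smt (verit) Int_iff mem_Collect_eq mult_left_mono)
      then show ?thesis using cmod_le[of w] Wre[OF w] by linarith
    qed
    then show ?thesis by (auto intro: boundedI)
  qed
  have Re1: "Re (1 / (w - of_real p)) = (Re w - p) / ((Re w - p)\<^sup>2 + (Im w)\<^sup>2)"
    "Re (1 / (of_real q - w)) = (q - Re w) / ((q - Re w)\<^sup>2 + (Im w)\<^sup>2)" for w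
    by (simp_all add: Re_divide cmod_power2)
  have aux: "1 / (c * N) \<le> s / N\<^sup>2" if "N > 0" "c > 0" "N \<le> c * s" for N c s :: real
  proof -
    have "1 / (c * N) = N / (c * N\<^sup>2)" using that by (simp add: power2_eq_square)
    also have "\<dots> \<le> c * s / (c * N\<^sup>2)" using that by (intro divide_right_mono) auto
    finally show ?thesis using that by simp
  qed
  have Re1_lower: "Re (1 / (w - of_real p)) \<ge> 1 / ((1 + \<sigma>) * cmod (w - of_real p))"
    if "w \<in> W" "w \<noteq> of_real p" for w
  proof -
    have nz: "cmod (w - of_real p) > 0" using that by simp
    have "cmod (w - of_real p) \<le> \<bar>Re w - p\<bar> + \<bar>Im w\<bar>" using cmod_le[of "w - of_real p"] by simp
    also have "\<dots> \<le> (1 + \<sigma>) * (Re w - p)" using that Wre[OF that(1)] by (simp add: W_def algebra_simps)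
    finally have 1: "cmod (w - of_real p) \<le> (1 + \<sigma>) * (Re w - p)" .
    have "Re (1 / (w - of_real p)) = (Re w - p) / (cmod (w - of_real p))\<^sup>2"
      unfolding Re1 by (simp add: cmod_power2)
    then show ?thesis using aux[OF nz _ 1] \<sigma> by simp
  qed
  have Re2_lower: "Re (1 / (of_real q - w)) \<ge> 1 / ((1 + \<sigma>) * cmod (of_real q - w))"
    if "w \<in> W" "w \<noteq> of_real q" for w
  proof -
    have nz: "cmod (of_real q - w) > 0" using that by auto
    have "cmod (of_real q - w) \<le> \<bar>q - Re w\<bar> + \<bar>Im w\<bar>" using cmod_le[of "of_real q - w"] by simp
    also have "\<dots> \<le> (1 + \<sigma>) * (q - Re w)" using that Wre[OF that(1)] by (simp add: W_def algebra_simps)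
    finally have 1: "cmod (of_real q - w) \<le> (1 + \<sigma>) * (q - Re w)" .
    have "Re (1 / (of_real q - w)) = (q - Re w) / (cmod (of_real q - w))\<^sup>2"
      unfolding Re1 by (simp add: cmod_power2)
    then show ?thesis using aux[OF nz _ 1] \<sigma> by simp
  qed
  have Re_nonneg: "Re (1 / (w - of_real p)) \<ge> 0" "Re (1 / (of_real q - w)) \<ge> 0" if "w \<in> W" for w
    unfolding Re1 using Wre[OF that] by auto
  have "compact (f ` closure S)" using bS by (intro compact_continuous_image contf) (simp add: compact_closure)
  then obtain B where B: "B > 0" "\<And>w. w \<in> closure S \<Longrightarrow> cmod (f w) \<le> B"
    using compact_imp_bounded[of "f ` closure S"] by (auto simp: bounded_pos)
  have zW: "z \<in> W" using z SW closure_subset by blast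
  have zp: "z \<noteq> of_real p" "z \<noteq> of_real q" using S[OF z] by auto
  \<comment> \<open>Near a corner \<open>f\<close> is bounded by continuity while the damping factor
    tends to 0: on circles of small radius \<open>d\<close> about the corners the product is at most
    \<open>M\<close>.\<close>
  have "filterlim (\<lambda>d. ln B - K * (1 / ((1 + \<sigma>) * d))) at_bot (at_right 0)"
    using K0 \<sigma> by real_asymp
  then have "\<forall>\<^sub>F d in at_right 0. ln B - K * (1 / ((1 + \<sigma>) * d)) \<le> ln M"
    by (simp add: filterlim_at_bot)
  moreover have "\<forall>\<^sub>F d in at_right 0. d \<in> {0<..<min (cmod (z - of_real p)) (cmod (of_real q - z))}"
    using zp by (intro eventually_at_right_real) auto
  ultimately have "\<forall>\<^sub>F d in at_right 0. ln B - K * (1 / ((1 + \<sigma>) * d)) \<le> ln M \<and>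
      d \<in> {0<..<min (cmod (z - of_real p)) (cmod (of_real q - z))}" by (rule eventually_conj)
  then obtain d where d: "ln B - K * (1 / ((1 + \<sigma>) * d)) \<le> ln M" "0 < d"
     "d < cmod (z - of_real p)" "d < cmod (of_real q - z)"
    using eventually_happens'[OF trivial_limit_at_right_real] by (metis (no_types, lifting) greaterThanLessThan_iff min_less_iff_conj)
  define D where "D = S - cball (of_real p) d - cball (of_real q) d"
  have oD: "open D" unfolding D_def using oS by (intro open_Diff) auto
  have clD: "closure D \<subseteq> closure S - ball (of_real p) d - ball (of_real q) d"
  proof -
    have "D \<subseteq> closure S - ball (of_real p) d - ball (of_real q) d"
      using closure_subset by (auto simp: D_def)
    then show ?thesis by (intro closure_minimal) (auto intro!: closed_Diff)
  qed
  have ne: "w - of_real p \<noteq> 0" "of_real q - w \<noteq> 0" if "w \<in> closure D" for w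
    using clD that d by auto
  define g where "g = (\<lambda>w. f w * exp (- of_real K * (1 / (w - of_real p) + 1 / (of_real q - w))))"
  have gn: "cmod (g w) = cmod (f w) * exp (- K * u w)" for w by (simp add: g_def u_def norm_mult)
  have "cmod (g z) \<le> M"
  proof (rule maximum_modulus_frontier[where S = D and f = g])
    show "g holomorphic_on interior D"
      unfolding g_def interior_open[OF oD] using ne closure_subset[of D]
      by (intro holomorphic_intros holomorphic_on_subset[OF holf]) (auto simp: D_def subset_iff)
    show "continuous_on (closure D) g"
      unfolding g_def using ne clD
      by (intro continuous_intros continuous_on_subset[OF contf]) auto
    show "bounded D" using bS by (rule bounded_subset) (auto simp: D_def)
    show "z \<in> D" using z d by (auto simp: D_def dist_norm norm_minus_commute)
    show "cmod (g w) \<le> M" if w: "w \<in> frontier D" for w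
    proof -
      have wD: "w \<in> closure D" "w \<notin> D" using w oD by (auto simp: frontier_def interior_open)
      then have wS: "w \<in> closure S" and dw: "d \<le> cmod (w - of_real p)" "d \<le> cmod (of_real q - w)"
        using clD by (auto simp: dist_norm norm_minus_commute)
      then have wW: "w \<in> W" using SW by auto
      have w0: "w \<noteq> of_real p" "w \<noteq> of_real q" using dw d by auto
      have u0: "u w \<ge> 0" using Re_nonneg[OF wW] by (simp add: u_def)
      have small: "cmod (g w) \<le> M" if "u w \<ge> 1 / ((1 + \<sigma>) * d)"
      proof -
        have "cmod (g w) \<le> B * exp (- K * (1 / ((1 + \<sigma>) * d)))"
          unfolding gn using mult_left_mono[OF that, of K] B(2)[OF wS] K0 B(1) by (intro mult_mono) auto
        also have "\<dots> = exp (ln B - K * (1 / ((1 + \<sigma>) * d)))" using B by (simp add: exp_diff exp_minus field_simps)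
        also have "\<dots> \<le> exp (ln M)" using d(1) by simp
        finally show ?thesis using M by simp
      qed
      consider "cmod (w - of_real p) = d" | "cmod (of_real q - w) = d" | "w \<in> frontier S"
        using wD wS dw oS by (force simp: D_def frontier_def interior_open dist_norm norm_minus_commute)
      then show ?thesis
      proof cases
        case 1
        then show ?thesis using Re1_lower[OF wW w0(1)] Re_nonneg[OF wW] by (intro small) (auto simp: u_def)
      next
        case 2
        then show ?thesis using Re2_lower[OF wW w0(2)] Re_nonneg[OF wW] by (intro small) (auto simp: u_def)
      next
        case 3
        from bd[OF this w0] show ?thesis
        proof
          assume "cmod (f w) \<le> M"
          moreover have "exp (- K * u w) \<le> 1" using u0 K0 by simp
          ultimately have "cmod (f w) * exp (- K * u w) \<le> M * 1" using M by (intro mult_mono) auto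
          then show ?thesis by (simp add: gn)
        next
          assume *: "Im w \<noteq> 0 \<and> (\<bar>Im w\<bar> = \<sigma> * (Re w - p) \<or> \<bar>Im w\<bar> = \<sigma> * (q - Re w)) \<and> cmod (f w) \<le> M * exp (C / \<bar>Im w\<bar>)"
          \<comment> \<open>On a slanted side the damping exponent is explicit: |y| = \<sigma> s
            gives s / (s^2 + y^2) = 1 / ((1 + \<sigma>^2) s), so this choice of \<open>K\<close>
            cancels C / |y| exactly.\<close>
          have key: "K * (s / (s\<^sup>2 + y\<^sup>2)) = C / \<bar>y\<bar>" if "y \<noteq> 0" "\<bar>y\<bar> = \<sigma> * s" for s y :: real
          proof -
            have s: "s > 0" using that \<sigma> by (metis zero_less_abs_iff zero_less_mult_pos)
            have "y\<^sup>2 = \<sigma>\<^sup>2 * s\<^sup>2" using that by (metis power2_abs power_mult_distrib)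
            then have e: "s\<^sup>2 + y\<^sup>2 = (1 + \<sigma>\<^sup>2) * s\<^sup>2" by (simp add: algebra_simps)
            define T where "T = 1 + \<sigma>\<^sup>2"
            have "T > 0" by (simp add: T_def add_pos_nonneg)
            then show ?thesis using s \<sigma> unfolding K that(2) e T_def[symmetric]
              by (simp add: field_simps power2_eq_square)
          qed
          have "C / \<bar>Im w\<bar> \<le> K * u w"
          proof (cases "\<bar>Im w\<bar> = \<sigma> * (Re w - p)")
            case True
            then have "C / \<bar>Im w\<bar> = K * Re (1 / (w - of_real p))"
              unfolding Re1 using * by (subst key) auto
            also have "\<dots> \<le> K * u w" using Re_nonneg[OF wW] K0 by (simp add: u_def)
            finally show ?thesis .
          next
            case False
            then have "C / \<bar>Im w\<bar> = K * Re (1 / (of_real q - w))"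
              unfolding Re1 using * by (subst key) auto
            also have "\<dots> \<le> K * u w" using Re_nonneg[OF wW] K0 by (simp add: u_def)
            finally show ?thesis .
          qed
          then have "cmod (f w) \<le> M * exp (K * u w)"
            using * M by (smt (verit) exp_le_cancel_iff mult_left_mono)
          then show ?thesis unfolding gn by (simp add: exp_minus field_simps)
        qed
      qed
    qed
  qed
  then have "cmod (f z) \<le> M * exp (K * u z)" unfolding gn by (simp add: exp_minus field_simps)
  then show ?thesis by (simp add: u_def)
qed

section \<open>Mean type and exponential type\<close>

text \<open>|f| is at most 1/|h| = exp(Re p), and Harnack's inequality with base point i bounds Re
  p.\<close>

lemma bounded_type_growth:
  assumes "bounded_type f"
  obtains C where "C > 0" "\<And>z. Im z > 0 \<Longrightarrow> cmod (f z) \<le> exp (C * (1 + cmod z)\<^sup>2 / Im z)"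
proof -
  obtain h where h: "h holomorphic_on upper_half_plane" "\<And>z. Im z > 0 \<Longrightarrow> h z \<noteq> 0"
    "\<And>z. Im z > 0 \<Longrightarrow> cmod (h z) \<le> 1" "\<And>z. Im z > 0 \<Longrightarrow> cmod (f z * h z) \<le> 1"
    using bounded_type_zero_free_denominator[OF assms] by blast
  obtain p where p: "p holomorphic_on upper_half_plane" "\<And>z. Im z > 0 \<Longrightarrow> cmod (h z) = exp (- Re (p z))"
    using zero_free_log[OF h(1,2)] by blast
  have p0: "Re (p z) \<ge> 0" if "Im z > 0" for z using h(3)[OF that] p(2)[OF that] by simp
  show thesis
  proof (rule that[of "Re (p \<i>) + 1"])
    show "Re (p \<i>) + 1 > 0" using p0[of \<i>] by simp
    fix z assume z: "Im z > 0"
    have "Re (p z) \<le> Re (p \<i>) * (cmod z + cmod \<i>)\<^sup>2 / (Im z * Im \<i>)"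
      by (rule Harnack_upper_half_plane[OF p(1) p0 _ z]) auto
    also have "\<dots> \<le> (Re (p \<i>) + 1) * (1 + cmod z)\<^sup>2 / Im z"
      using z by (auto intro!: divide_right_mono mult_right_mono simp: add.commute)
    finally have "exp (Re (p z)) \<le> exp ((Re (p \<i>) + 1) * (1 + cmod z)\<^sup>2 / Im z)" by simp
    moreover have "cmod (f z) \<le> exp (Re (p z))"
      using h(4)[OF z] p(2)[OF z] by (simp add: norm_mult exp_minus field_simps)
    ultimately show "cmod (f z) \<le> exp ((Re (p \<i>) + 1) * (1 + cmod z)\<^sup>2 / Im z)" by linarith
  qed
qed

text \<open>With the zero-free multiplier \<open>h\<close>, 1/f = h / (f h) is again a quotient of
  bounded functions.\<close>

lemma bounded_type_inverse:
  assumes "bounded_type f" "\<And>z. Im z > 0 \<Longrightarrow> f z \<noteq> 0"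
  shows "bounded_type (\<lambda>z. inverse (f z))"
proof -
  obtain h where h: "h holomorphic_on upper_half_plane" "\<And>z. Im z > 0 \<Longrightarrow> h z \<noteq> 0"
    "\<And>z. Im z > 0 \<Longrightarrow> cmod (h z) \<le> 1" "\<And>z. Im z > 0 \<Longrightarrow> cmod (f z * h z) \<le> 1"
    using bounded_type_zero_free_denominator[OF assms(1)] by blast
  have f: "f holomorphic_on upper_half_plane" using assms(1) by (simp add: bounded_type_def)
  have "\<exists>z\<in>upper_half_plane. f z * h z \<noteq> 0" using assms(2) h(2) by (intro bexI[of _ \<i>]) auto
  moreover have "(\<lambda>z. f z * h z) holomorphic_on upper_half_plane" "(\<lambda>z. inverse (f z)) holomorphic_on upper_half_plane"
    using f h assms(2) by (auto intro!: holomorphic_intros)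
  moreover have "bounded (h ` upper_half_plane)" "bounded ((\<lambda>z. f z * h z) ` upper_half_plane)"
    using h by (auto intro!: boundedI[of _ 1])
  moreover have "\<forall>z\<in>upper_half_plane. f z * h z \<noteq> 0 \<longrightarrow> inverse (f z) = h z / (f z * h z)"
    by (auto simp: field_simps)
  ultimately show ?thesis unfolding bounded_type_def using h(1) by blast
qed

text \<open>In f = (f h)/h both factors are zero-free and bounded by 1, so ln |f| is a difference of
  two positive harmonic functions. The difference of their slopes is the rate of growth, and
  comparison on the imaginary axis identifies it with the mean type.\<close>

lemma zero_free_mean_type_asymp:
  assumes bt: "bounded_type f" and nz: "\<And>z. Im z > 0 \<Longrightarrow> f z \<noteq> 0" and mt: "mean_type f = ereal \<tau>"
    and \<epsilon>: "\<epsilon> > 0"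
  obtains R where "R > 0" "\<And>z. Im z > 0 \<Longrightarrow> R \<le> cmod z \<Longrightarrow>
      exp (\<tau> * Im z - \<epsilon> * (cmod z)\<^sup>2 / Im z) \<le> cmod (f z) \<and>
      cmod (f z) \<le> exp (\<tau> * Im z + \<epsilon> * (cmod z)\<^sup>2 / Im z)"
proof -
  obtain h where h: "h holomorphic_on upper_half_plane" "\<And>z. Im z > 0 \<Longrightarrow> h z \<noteq> 0"
    "\<And>z. Im z > 0 \<Longrightarrow> cmod (h z) \<le> 1" "\<And>z. Im z > 0 \<Longrightarrow> cmod (f z * h z) \<le> 1"
    using bounded_type_zero_free_denominator[OF bt] by blast
  have f: "f holomorphic_on upper_half_plane" using bt by (simp add: bounded_type_def)
  have g: "(\<lambda>z. f z * h z) holomorphic_on upper_half_plane" by (intro holomorphic_intros f h)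
  obtain p where p: "p holomorphic_on upper_half_plane" "\<And>z. Im z > 0 \<Longrightarrow> cmod (h z) = exp (- Re (p z))"
    using zero_free_log[OF h(1,2)] by blast
  obtain q where q: "q holomorphic_on upper_half_plane" "\<And>z. Im z > 0 \<Longrightarrow> cmod (f z * h z) = exp (- Re (q z))"
    using zero_free_log[OF g] nz h(2) by (metis mult_eq_0_iff)
  have p0: "Re (p z) \<ge> 0" if "Im z > 0" for z using h(3)[OF that] p(2)[OF that] by simp
  have q0: "Re (q z) \<ge> 0" if "Im z > 0" for z using h(4)[OF that] q(2)[OF that] by simp
  obtain c where c: "\<And>z. Im z > 0 \<Longrightarrow> c * Im z \<le> Re (p z)"
    "\<And>\<epsilon>. \<epsilon> > 0 \<Longrightarrow> \<exists>R>0. \<forall>z. Im z > 0 \<longrightarrow> R \<le> cmod z \<longrightarrow> Re (p z) \<le> c * Im z + \<epsilon> * (cmod z)\<^sup>2 / Im z"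
    using positive_harmonic_slope[OF p(1) p0] by blast
  obtain d where d: "\<And>z. Im z > 0 \<Longrightarrow> d * Im z \<le> Re (q z)"
    "\<And>\<epsilon>. \<epsilon> > 0 \<Longrightarrow> \<exists>R>0. \<forall>z. Im z > 0 \<longrightarrow> R \<le> cmod z \<longrightarrow> Re (q z) \<le> d * Im z + \<epsilon> * (cmod z)\<^sup>2 / Im z"
    using positive_harmonic_slope[OF q(1) q0] by blast
  have fn: "cmod (f z) = exp (Re (p z) - Re (q z))" if "Im z > 0" for z
  proof -
    have "cmod (f z) * exp (- Re (p z)) = exp (- Re (q z))"
      using p(2)[OF that] q(2)[OF that] by (simp add: norm_mult)
    then show ?thesis by (simp add: exp_diff exp_minus field_simps)
  qed
  have main: "\<exists>R>0. \<forall>z. Im z > 0 \<longrightarrow> R \<le> cmod z \<longrightarrow>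
      exp ((c - d) * Im z - \<epsilon> * (cmod z)\<^sup>2 / Im z) \<le> cmod (f z) \<and>
      cmod (f z) \<le> exp ((c - d) * Im z + \<epsilon> * (cmod z)\<^sup>2 / Im z)" if \<epsilon>: "\<epsilon> > 0" for \<epsilon>
  proof -
    obtain R1 R2 where R: "R1 > 0" "R2 > 0"
      "\<And>z. Im z > 0 \<Longrightarrow> R1 \<le> cmod z \<Longrightarrow> Re (p z) \<le> c * Im z + \<epsilon> * (cmod z)\<^sup>2 / Im z"
      "\<And>z. Im z > 0 \<Longrightarrow> R2 \<le> cmod z \<Longrightarrow> Re (q z) \<le> d * Im z + \<epsilon> * (cmod z)\<^sup>2 / Im z"
      using c(2)[OF \<epsilon>] d(2)[OF \<epsilon>] by blast
    show ?thesis
    proof (intro exI[of _ "max R1 R2"] conjI allI impI)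
      fix z assume z: "Im z > 0" "max R1 R2 \<le> cmod z"
      have "(c - d) * Im z - \<epsilon> * (cmod z)\<^sup>2 / Im z \<le> Re (p z) - Re (q z)"
        using c(1)[OF z(1)] R(4)[OF z(1)] z by (simp add: left_diff_distrib)
      then show "exp ((c - d) * Im z - \<epsilon> * (cmod z)\<^sup>2 / Im z) \<le> cmod (f z)" by (simp add: fn z)
      have "Re (p z) - Re (q z) \<le> (c - d) * Im z + \<epsilon> * (cmod z)\<^sup>2 / Im z"
        using d(1)[OF z(1)] R(3)[OF z(1)] z by (simp add: left_diff_distrib)
      then show "cmod (f z) \<le> exp ((c - d) * Im z + \<epsilon> * (cmod z)\<^sup>2 / Im z)" by (simp add: fn z)
    qed (use R in auto)
  qed
  \<comment> \<open>On the axis |z|^2 / Im z = y, so the remainder is o(y) and the upper limit in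
    the mean type is a limit.\<close>
  have "((\<lambda>y. ln (cmod (f (\<i> * of_real y))) / y) \<longlongrightarrow> c - d) at_top"
  proof (rule tendstoI)
    fix e :: real assume e: "e > 0"
    obtain R where R: "R > 0" "\<And>z. Im z > 0 \<Longrightarrow> R \<le> cmod z \<Longrightarrow>
      exp ((c - d) * Im z - e / 2 * (cmod z)\<^sup>2 / Im z) \<le> cmod (f z) \<and>
      cmod (f z) \<le> exp ((c - d) * Im z + e / 2 * (cmod z)\<^sup>2 / Im z)" using main[of "e / 2"] e by auto
    have "dist (ln (cmod (f (\<i> * of_real y))) / y) (c - d) < e" if y: "y \<ge> R" for y
    proof -
      have y0: "y > 0" using y R by simp
      define L where "L = ln (cmod (f (\<i> * of_real y)))"
      have "cmod (f (\<i> * of_real y)) > 0" using nz[of "\<i> * of_real y"] y0 by simp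
      then have e1: "cmod (f (\<i> * of_real y)) = exp L" by (simp add: L_def)
      have "(c - d) * y - e / 2 * y \<le> L" "L \<le> (c - d) * y + e / 2 * y"
        using R(2)[of "\<i> * of_real y"] y y0 unfolding e1 by (auto simp: norm_mult power2_eq_square)
      then have "\<bar>L - (c - d) * y\<bar> \<le> e / 2 * y" by linarith
      then have "\<bar>L / y - (c - d)\<bar> \<le> e / 2" using y0 by (simp add: field_simps abs_if split: if_splits)
      then show ?thesis using e by (simp add: dist_real_def L_def)
    qed
    then show "\<forall>\<^sub>F y in at_top. dist (ln (cmod (f (\<i> * of_real y))) / y) (c - d) < e"
      unfolding eventually_at_top_linorder by blast
  qed
  then have "((\<lambda>y. ereal (ln (cmod (f (\<i> * of_real y))) / y)) \<longlongrightarrow> ereal (c - d)) at_top"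
    by simp
  moreover have "\<forall>\<^sub>F y in at_top. ereal (ln (cmod (f (\<i> * of_real y))) / y) = ereal (1 / y) * log_abs (f (\<i> * of_real y))"
    using eventually_gt_at_top[of 0] by eventually_elim (use nz in \<open>auto simp: log_abs_def\<close>)
  ultimately have "((\<lambda>y. ereal (1 / y) * log_abs (f (\<i> * of_real y))) \<longlongrightarrow> ereal (c - d)) at_top"
    by (rule Lim_transform_eventually)
  then have "mean_type f = ereal (c - d)"
    unfolding mean_type_def by (intro lim_imp_Limsup) auto
  then have "c - d = \<tau>" using mt by simp
  then show thesis using main[OF \<epsilon>] that by blast
qed

lemma mean_type_le_imp_axis_bound:
  assumes mt: "mean_type f \<le> ereal \<sigma>" and \<epsilon>: "\<epsilon> > 0"
  obtains Y where "Y > 0" "\<And>y. y \<ge> Y \<Longrightarrow> cmod (f (\<i> * of_real y)) \<le> exp ((\<sigma> + \<epsilon>) * y)"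
proof -
  have "mean_type f < ereal (\<sigma> + \<epsilon>)" using mt \<epsilon> by (metis ereal_less_eq(3) less_add_same_cancel1 linorder_not_le order_trans)
  then have "\<forall>\<^sub>F y in at_top. ereal (1 / y) * log_abs (f (\<i> * of_real y)) < ereal (\<sigma> + \<epsilon>)"
    unfolding mean_type_def by (rule Limsup_lessD)
  then obtain Y where Y: "\<And>y. y \<ge> Y \<Longrightarrow> ereal (1 / y) * log_abs (f (\<i> * of_real y)) < ereal (\<sigma> + \<epsilon>)"
    unfolding eventually_at_top_linorder by blast
  have "cmod (f (\<i> * of_real y)) \<le> exp ((\<sigma> + \<epsilon>) * y)" if y: "y \<ge> max Y 1" for y
  proof (cases "f (\<i> * of_real y) = 0")
    case False
    then have "ln (cmod (f (\<i> * of_real y))) / y < \<sigma> + \<epsilon>"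
      using Y[of y] y by (simp add: log_abs_def)
    then have "ln (cmod (f (\<i> * of_real y))) \<le> (\<sigma> + \<epsilon>) * y" using y by (simp add: field_simps)
    then have "exp (ln (cmod (f (\<i> * of_real y)))) \<le> exp ((\<sigma> + \<epsilon>) * y)" by simp
    then show ?thesis using False by simp
  qed simp
  then show thesis by (intro that[of "max Y 1"]) auto
qed

text \<open>\<open>f\<close> may have zeros, hence no logarithm. Instead g = f h is bounded and
  grows on the axis at most at the rate \<sigma> minus the slope of \<open>h\<close>;
  Phragmen-Lindeloef extends this to the half-plane, and dividing by \<open>h\<close> restores the
  slope.\<close>

lemma mean_type_le_imp_bound:
  assumes bt: "bounded_type f" and mt: "mean_type f \<le> ereal \<sigma>" and \<epsilon>: "\<epsilon> > 0"
  obtains R where "R > 0" "\<And>z. Im z > 0 \<Longrightarrow> R \<le> cmod z \<Longrightarrow>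
      cmod (f z) \<le> exp (\<sigma> * Im z + \<epsilon> * (cmod z)\<^sup>2 / Im z)"
proof -
  obtain h where h: "h holomorphic_on upper_half_plane" "\<And>z. Im z > 0 \<Longrightarrow> h z \<noteq> 0"
    "\<And>z. Im z > 0 \<Longrightarrow> cmod (h z) \<le> 1" "\<And>z. Im z > 0 \<Longrightarrow> cmod (f z * h z) \<le> 1"
    using bounded_type_zero_free_denominator[OF bt] by blast
  have f: "f holomorphic_on upper_half_plane" using bt by (simp add: bounded_type_def)
  define g where "g = (\<lambda>z. f z * h z)"
  have holg: "g holomorphic_on upper_half_plane" unfolding g_def by (intro holomorphic_intros f h)
  obtain p where p: "p holomorphic_on upper_half_plane" "\<And>z. Im z > 0 \<Longrightarrow> cmod (h z) = exp (- Re (p z))"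
    using zero_free_log[OF h(1,2)] by blast
  have p0: "Re (p z) \<ge> 0" if "Im z > 0" for z using h(3)[OF that] p(2)[OF that] by simp
  obtain c where c: "\<And>z. Im z > 0 \<Longrightarrow> c * Im z \<le> Re (p z)"
    "\<And>\<epsilon>. \<epsilon> > 0 \<Longrightarrow> \<exists>R>0. \<forall>z. Im z > 0 \<longrightarrow> R \<le> cmod z \<longrightarrow> Re (p z) \<le> c * Im z + \<epsilon> * (cmod z)\<^sup>2 / Im z"
    using positive_harmonic_slope[OF p(1) p0] by blast
  define r where "r = \<sigma> - c"
  have shift: "cmod (g (z + \<i> * of_real \<eta>)) \<le> exp (r * Im z)" if \<eta>: "\<eta> > 0" and z: "Im z \<ge> 0" for \<eta> z
  proof -
    define F where "F = (\<lambda>z. g (z + \<i> * of_real \<eta>) * exp (\<i> * of_real r * z))"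
    have Fn: "cmod (F z) = cmod (g (z + \<i> * of_real \<eta>)) * exp (- r * Im z)" for z by (simp add: F_def norm_mult)
    have g1: "cmod (g (z + \<i> * of_real \<eta>)) \<le> 1" if "Im z \<ge> 0" for z using h(4)[of "z + \<i> * of_real \<eta>"] that \<eta> by (simp add: g_def)
    have Fle: "cmod (F z) \<le> exp (- r * Im z)" if "Im z \<ge> 0" for z
      unfolding Fn using g1[OF that] by simp
    have holF: "F holomorphic_on {z. Im z > - \<eta>}" unfolding F_def
      by (intro holomorphic_intros holomorphic_on_compose_gen[OF _ holg, unfolded o_def]) auto
    have "cmod (F z) \<le> 1"
    proof (rule Phragmen_Lindeloef_half_plane[where f = F and C = "\<bar>r\<bar>"])
      show "continuous_on {z. 0 \<le> Im z} F"
        by (rule holomorphic_on_imp_continuous_on, rule holomorphic_on_subset[OF holF]) (use \<eta> in auto)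
      show "F holomorphic_on upper_half_plane" by (rule holomorphic_on_subset[OF holF]) (use \<eta> in auto)
      show "cmod (F z) \<le> exp (\<bar>r\<bar> * (1 + cmod z))" if z: "0 \<le> Im z" for z
      proof -
        have "- r * Im z \<le> \<bar>r\<bar> * (1 + cmod z)"
          using abs_Im_le_cmod[of z] z by (intro mult_mono) auto
        then show ?thesis using Fle[OF z] by (smt (verit) exp_le_cancel_iff)
      qed
      show "cmod (F (of_real x)) \<le> 1" for x using Fle[of "of_real x"] by simp
      show "\<exists>K. \<forall>y\<ge>0. cmod (F (\<i> * of_real y)) \<le> K * exp (e * y)" if e: "e > 0" for e
      proof -
        obtain Y where Y: "Y > 0" "\<And>y. y \<ge> Y \<Longrightarrow> cmod (f (\<i> * of_real y)) \<le> exp ((\<sigma> + e) * y)"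
          using mean_type_le_imp_axis_bound[OF mt e] by blast
        define K where "K = exp (\<bar>r\<bar> * Y) + exp ((r + e) * \<eta>)"
        have "cmod (F (\<i> * of_real y)) \<le> K * exp (e * y)" if y: "y \<ge> 0" for y
        proof (cases "y + \<eta> \<ge> Y")
          case True
          have i: "\<i> * of_real y + \<i> * of_real \<eta> = \<i> * of_real (y + \<eta>)" by (simp add: algebra_simps)
          have "cmod (h (\<i> * of_real (y + \<eta>))) \<le> exp (- c * (y + \<eta>))"
            using p(2)[of "\<i> * of_real (y + \<eta>)"] c(1)[of "\<i> * of_real (y + \<eta>)"] y \<eta> by simp
          then have "cmod (F (\<i> * of_real y)) \<le> exp ((\<sigma> + e) * (y + \<eta>)) * exp (- c * (y + \<eta>)) * exp (- r * y)"
            unfolding Fn i g_def norm_mult using Y(2)[OF True] by (intro mult_mono) auto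
          also have "\<dots> = exp ((r + e) * \<eta>) * exp (e * y)"
            by (simp add: r_def algebra_simps flip: exp_add)
          also have "\<dots> \<le> K * exp (e * y)" by (simp add: K_def)
          finally show ?thesis .
        next
          case False
          have "cmod (F (\<i> * of_real y)) \<le> exp (- r * y)" using Fle[of "\<i> * of_real y"] y by simp
          also have "- r * y \<le> \<bar>r\<bar> * Y" using y False \<eta> by (intro mult_mono) auto
          finally have "cmod (F (\<i> * of_real y)) \<le> K * 1" by (simp add: K_def add_increasing2)
          also have "\<dots> \<le> K * exp (e * y)" using y e by (intro mult_left_mono) (auto simp: K_def add_nonneg_nonneg)
          finally show ?thesis .
        qed
        then show ?thesis by blast
      qed
    qed (use z in auto)
    then show ?thesis unfolding Fn by (simp add: exp_minus field_simps)
  qed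
  have gr: "cmod (g z) \<le> exp (r * Im z)" if z: "Im z > 0" for z
  proof (rule le_exp_epsilon_small[OF z])
    fix e assume "0 < e" "e < Im z"
    then have "cmod (g (z - \<i> * of_real e + \<i> * of_real e)) \<le> exp (r * Im (z - \<i> * of_real e))"
      by (intro shift) auto
    then show "cmod (g z) \<le> exp (r * Im z) * exp (e * - r)" by (simp add: algebra_simps flip: exp_add)
  qed
  obtain R where R: "R > 0" "\<And>z. Im z > 0 \<Longrightarrow> R \<le> cmod z \<Longrightarrow> Re (p z) \<le> c * Im z + \<epsilon> * (cmod z)\<^sup>2 / Im z"
    using c(2)[OF \<epsilon>] by blast
  show thesis
  proof (rule that[OF R(1)])
    fix z assume z: "Im z > 0" "R \<le> cmod z"
    have "cmod (f z) = cmod (g z) * exp (Re (p z))"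
      using p(2)[OF z(1)] by (simp add: g_def norm_mult exp_minus field_simps)
    also have "\<dots> \<le> exp (r * Im z) * exp (c * Im z + \<epsilon> * (cmod z)\<^sup>2 / Im z)"
      using gr[OF z(1)] R(2)[OF z] by (intro mult_mono) auto
    also have "\<dots> = exp (\<sigma> * Im z + \<epsilon> * (cmod z)\<^sup>2 / Im z)" by (simp add: r_def algebra_simps flip: exp_add)
    finally show "cmod (f z) \<le> exp (\<sigma> * Im z + \<epsilon> * (cmod z)\<^sup>2 / Im z)" .
  qed
qed

lemma exp_type_classI:
  assumes ent: "entire F" and \<delta>: "\<delta> \<ge> 0"
    and bd: "\<And>\<epsilon>. \<epsilon> > 0 \<Longrightarrow> \<exists>R. \<forall>z. R \<le> cmod z \<longrightarrow> cmod (F z) \<le> exp ((\<delta> + \<epsilon>) * cmod z)"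
  shows "F \<in> exp_type_class \<delta>"
proof -
  have "\<exists>C>0. \<forall>z. cmod (F z) \<le> C * exp ((\<delta> + \<epsilon>) * cmod z)" if \<epsilon>: "\<epsilon> > 0" for \<epsilon>
  proof -
    obtain R where R: "\<And>z. R \<le> cmod z \<Longrightarrow> cmod (F z) \<le> exp ((\<delta> + \<epsilon>) * cmod z)" using bd[OF \<epsilon>] by blast
    have "continuous_on (cball 0 R) F"
      using ent holomorphic_on_imp_continuous_on continuous_on_subset unfolding entire_def by blast
    then have "bounded (F ` cball 0 R)" by (intro compact_imp_bounded compact_continuous_image) auto
    then obtain B where B: "B > 0" "\<And>z. cmod z \<le> R \<Longrightarrow> cmod (F z) \<le> B" by (auto simp: bounded_pos)
    have "cmod (F z) \<le> (B + 1) * exp ((\<delta> + \<epsilon>) * cmod z)" for z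
    proof -
      have e1: "exp ((\<delta> + \<epsilon>) * cmod z) \<ge> 1" using \<delta> \<epsilon> by simp
      consider "cmod z \<le> R" | "R \<le> cmod z" by linarith
      then show ?thesis
      proof cases
        case 1
        have "B * 1 \<le> (B + 1) * exp ((\<delta> + \<epsilon>) * cmod z)" using B e1 by (intro mult_mono) auto
        then show ?thesis using B(2)[OF 1] by simp
      next
        case 2
        have "1 * exp ((\<delta> + \<epsilon>) * cmod z) \<le> (B + 1) * exp ((\<delta> + \<epsilon>) * cmod z)" using B by (intro mult_right_mono) auto
        then show ?thesis using R[OF 2] by linarith
      qed
    qed
    then show ?thesis using B by (intro exI[of _ "B + 1"]) auto
  qed
  then show ?thesis using ent by (simp add: exp_type_class_def)
qed

section \<open>Exponential type of the Hermite-Biehler function\<close>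

locale symmetric_hermite_biehler =
  fixes E :: "complex \<Rightarrow> complex" and \<tau> :: real
  assumes HB: "hermite_biehler E"
    and btE: "bounded_type E" and mtE: "mean_type E = ereal \<tau>"
    and E_real_nz: "\<And>x::real. E (of_real x) \<noteq> 0"
    and star_E: "\<And>z. star E z = E (- z)"
begin

lemma holE: "E holomorphic_on S"
  using HB holomorphic_on_subset unfolding hermite_biehler_def entire_def by blast

lemma contE: "continuous_on S E"
  by (rule holomorphic_on_imp_continuous_on[OF holE])

lemma E_uminus_less: "Im z > 0 \<Longrightarrow> cmod (E (- z)) < cmod (E z)"
  using HB unfolding hermite_biehler_def star_E by simp

lemma E_nz: "Im z \<ge> 0 \<Longrightarrow> E z \<noteq> 0"
proof -
  assume z: "Im z \<ge> 0"
  show "E z \<noteq> 0"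
  proof (cases "Im z = 0")
    case True
    then have "z = of_real (Re z)" by (simp add: complex_eq_iff)
    then show ?thesis using E_real_nz[of "Re z"] by simp
  next
    case False
    then show ?thesis using E_uminus_less[of z] z by auto
  qed
qed

lemma cmod_E_uminus_cnj: "cmod (E (- cnj z)) = cmod (E z)"
  using star_E[of "cnj z"] by (metis complex_cnj_cnj complex_mod_cnj star_def)

text \<open>In the lower half-plane |E(z)| < |E(-z)|, so the bound there is inherited from the upper
  one.\<close>

lemma E_off_axis:
  assumes "\<delta> > 0"
  obtains R where "R > 0" "\<And>z. Im z \<noteq> 0 \<Longrightarrow> R \<le> cmod z \<Longrightarrow>
      cmod (E z) \<le> exp (\<tau> * \<bar>Im z\<bar> + \<delta> * (cmod z)\<^sup>2 / \<bar>Im z\<bar>)"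
proof -
  obtain R where R: "R > 0" "\<And>z. Im z > 0 \<Longrightarrow> R \<le> cmod z \<Longrightarrow>
      exp (\<tau> * Im z - \<delta> * (cmod z)\<^sup>2 / Im z) \<le> cmod (E z) \<and>
      cmod (E z) \<le> exp (\<tau> * Im z + \<delta> * (cmod z)\<^sup>2 / Im z)"
    using zero_free_mean_type_asymp[OF btE _ mtE assms] E_nz by (metis less_imp_le)
  show thesis
  proof (rule that[OF R(1)])
    fix z assume z: "Im z \<noteq> 0" "R \<le> cmod z"
    show "cmod (E z) \<le> exp (\<tau> * \<bar>Im z\<bar> + \<delta> * (cmod z)\<^sup>2 / \<bar>Im z\<bar>)"
    proof (cases "Im z > 0")
      case True
      then show ?thesis using R(2)[of z] z by simp
    next
      case False
      then have "Im (- z) > 0" using z by simp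
      then show ?thesis using R(2)[of "- z"] E_uminus_less[of "- z"] z by simp
    qed
  qed
qed

text \<open>Near the real axis the exponential type is controlled by the values of \<open>E\<close> on the boundary of
  a thin lens around the point in question, whose size is proportional to \<open>\<bar>z\<bar>\<close>.\<close>

lemma E_growth:
  assumes \<epsilon>: "\<epsilon> > 0"
  shows "\<exists>R. \<forall>z. R \<le> cmod z \<longrightarrow> cmod (E z) \<le> exp ((max \<tau> 0 + \<epsilon>) * cmod z)"
proof -
  define T where "T = \<bar>\<tau>\<bar>"
  \<comment> \<open>Slope of the lenses. The lens estimate ends with the exponent \<sigma> (T/2 +
    32) x, and this choice makes it at most \<epsilon> x / 2.\<close>
  define \<sigma> where "\<sigma> = min (1/2) (\<epsilon> / (T + 64))"
  have T: "T \<ge> 0" by (simp add: T_def)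
  have \<sigma>: "0 < \<sigma>" "\<sigma> \<le> 1/2" unfolding \<sigma>_def using \<epsilon> T by (simp, intro min.cobounded1)
  have "\<sigma> \<le> \<epsilon> / (T + 64)" by (simp add: \<sigma>_def)
  then have \<sigma>\<epsilon>: "\<sigma> * (T / 2 + 32) \<le> \<epsilon> / 2" using T by (simp add: field_simps)
  obtain R1 where R1: "R1 > 0" "\<And>z. Im z \<noteq> 0 \<Longrightarrow> R1 \<le> cmod z \<Longrightarrow>
      cmod (E z) \<le> exp (\<tau> * \<bar>Im z\<bar> + \<sigma>\<^sup>2 * (cmod z)\<^sup>2 / \<bar>Im z\<bar>)"
    using E_off_axis[of "\<sigma>\<^sup>2"] \<sigma> by (metis zero_less_power)
  \<comment> \<open>Outside the sector treated by lenses |z| <= (1 + 2/\<sigma>) |Im z|, so this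
    \<delta> turns the remainder into \<epsilon> |z|.\<close>
  define \<delta> where "\<delta> = \<epsilon> / (1 + 2 / \<sigma>)"
  have \<delta>: "\<delta> > 0" using \<epsilon> \<sigma> by (simp add: \<delta>_def add_pos_pos)
  obtain R2 where R2: "R2 > 0" "\<And>z. Im z \<noteq> 0 \<Longrightarrow> R2 \<le> cmod z \<Longrightarrow>
      cmod (E z) \<le> exp (\<tau> * \<bar>Im z\<bar> + \<delta> * (cmod z)\<^sup>2 / \<bar>Im z\<bar>)"
    using E_off_axis[OF \<delta>] by blast
  have near: "cmod (E z) \<le> exp (\<epsilon> * cmod z)"
    if z: "\<bar>Im z\<bar> < \<sigma> * Re z / 2" "4 * R1 \<le> cmod z" for z
  proof -
    define x where "x = Re z"
    have x0: "x > 0" using z \<sigma> unfolding x_def by (smt (verit) half_gt_zero_iff zero_less_mult_pos)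
    have "\<sigma> * x / 2 \<le> x / 4" using \<sigma> x0 by simp
    then have "\<bar>Im z\<bar> \<le> x" using z x0 unfolding x_def by linarith
    then have xR: "x / 2 \<ge> R1" using cmod_le[of z] z x0 by (simp add: x_def)
    \<comment> \<open>The corners scale with Re z: on the lens |w| <= 2 x, so the blow-up at height
      |Im w| has the constant 4 \<sigma>^2 x^2.\<close>
    define p where "p = x / 2"
    define q where "q = 3 * x / 2"
    define S where "S = {w. \<bar>Im w\<bar> < \<sigma> * (Re w - p)} \<inter> {w. \<bar>Im w\<bar> < \<sigma> * (q - Re w)}"
    define W where "W = {w. \<bar>Im w\<bar> \<le> \<sigma> * (Re w - p)} \<inter> {w. \<bar>Im w\<bar> \<le> \<sigma> * (q - Re w)}"
    have oS: "open S" unfolding S_def by (intro open_Int open_Collect_less continuous_intros)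
    have clW: "closed W" unfolding W_def by (intro closed_Int closed_Collect_le continuous_intros)
    have SW: "closure S \<subseteq> W" by (rule closure_minimal[OF _ clW]) (auto simp: S_def W_def)
    define C where "C = 4 * \<sigma>\<^sup>2 * x\<^sup>2"
    have C: "C > 0" using \<sigma> x0 by (simp add: C_def)
    define M where "M = exp (T * \<sigma> * x / 2)"
    define K where "K = C * (1 + \<sigma>\<^sup>2) / \<sigma>"
    have zS: "z \<in> S" using z by (simp add: S_def p_def q_def x_def)
    have "cmod (E z) \<le> M * exp (K * (Re (1 / (z - of_real p)) + Re (1 / (of_real q - z))))"
    proof (rule lens_bound[OF _ \<sigma>(1) C _ oS _ contE holE _ K_def zS])
      fix w assume w: "w \<in> frontier S" "w \<noteq> of_real p" "w \<noteq> of_real q"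
      have wW: "w \<in> W" "w \<notin> S" using w SW oS by (auto simp: frontier_def interior_open)
      then have eq: "\<bar>Im w\<bar> = \<sigma> * (Re w - p) \<or> \<bar>Im w\<bar> = \<sigma> * (q - Re w)"
        by (auto simp: W_def S_def)
      have im0: "Im w \<noteq> 0"
      proof
        assume "Im w = 0"
        then have "Re w = p \<or> Re w = q" using eq \<sigma> by auto
        then show False using w \<open>Im w = 0\<close> by (auto simp: complex_eq_iff)
      qed
      have Wi: "\<bar>Im w\<bar> \<le> \<sigma> * (Re w - p)" "\<bar>Im w\<bar> \<le> \<sigma> * (q - Re w)" using wW by (auto simp: W_def)
      have Rew: "p \<le> Re w" "Re w \<le> q"
        using Wi \<sigma> by (smt (verit) abs_ge_zero mult_pos_neg zero_le_mult_iff)+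
      have "\<bar>Im w\<bar> + \<bar>Im w\<bar> \<le> \<sigma> * (Re w - p) + \<sigma> * (q - Re w)" using Wi by linarith
      also have "\<dots> = \<sigma> * x" by (simp add: p_def q_def field_simps)
      finally have imx: "\<bar>Im w\<bar> \<le> \<sigma> * x / 2" by simp
      have "\<sigma> * x / 2 \<le> x / 2" using \<sigma> x0 by simp
      then have w2x: "cmod w \<le> 2 * x" using cmod_le[of w] imx Rew x0 unfolding p_def q_def by linarith
      have "R1 \<le> cmod w" using Rew xR complex_Re_le_cmod[of w] by (simp add: p_def)
      then have "cmod (E w) \<le> exp (\<tau> * \<bar>Im w\<bar> + \<sigma>\<^sup>2 * (cmod w)\<^sup>2 / \<bar>Im w\<bar>)" by (rule R1(2)[OF im0])
      also have "\<dots> \<le> exp (T * (\<sigma> * x / 2) + \<sigma>\<^sup>2 * (2 * x)\<^sup>2 / \<bar>Im w\<bar>)"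
        unfolding exp_le_cancel_iff using imx w2x x0 T \<sigma>
        by (intro add_mono mult_mono divide_right_mono power_mono) (auto simp: T_def)
      also have "\<dots> = M * exp (C / \<bar>Im w\<bar>)" by (simp add: M_def C_def power_mult_distrib mult_ac flip: exp_add)
      finally show "cmod (E w) \<le> M \<or> Im w \<noteq> 0 \<and> (\<bar>Im w\<bar> = \<sigma> * (Re w - p) \<or> \<bar>Im w\<bar> = \<sigma> * (q - Re w)) \<and>
        cmod (E w) \<le> M * exp (C / \<bar>Im w\<bar>)" using im0 eq by blast
    qed (use x0 in \<open>auto simp: p_def q_def S_def M_def\<close>)
    also have "\<dots> \<le> M * exp (K * (2 / x + 2 / x))"
    proof -
      have "Re (1 / (z - of_real p)) \<le> 2 / x" "Re (1 / (of_real q - z)) \<le> 2 / x"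
        using Re_one_divide_le[of "z - of_real p"] Re_one_divide_le[of "of_real q - z"] x0 by (auto simp: p_def q_def x_def[symmetric])
      moreover have "K \<ge> 0" using C \<sigma> by (simp add: K_def)
      ultimately have "K * (Re (1 / (z - of_real p)) + Re (1 / (of_real q - z))) \<le> K * (2 / x + 2 / x)"
        by (intro mult_left_mono add_mono)
      then show ?thesis by (intro mult_left_mono) (auto simp: M_def)
    qed
    also have "K * (2 / x + 2 / x) = 16 * \<sigma> * (1 + \<sigma>\<^sup>2) * x"
      using x0 \<sigma> by (simp add: K_def C_def field_simps power2_eq_square)
    also have "\<dots> \<le> 16 * \<sigma> * 2 * x"
      using \<sigma> x0 by (intro mult_right_mono mult_left_mono) (auto simp: abs_square_le_1)
    finally have "cmod (E z) \<le> M * exp (16 * \<sigma> * 2 * x)" by (simp add: M_def)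
    also have "\<dots> = exp (\<sigma> * (T / 2 + 32) * x)" by (simp add: M_def algebra_simps flip: exp_add)
    also have "\<dots> \<le> exp (\<epsilon> * cmod z)"
      using \<sigma>\<epsilon> \<epsilon> x0 complex_Re_le_cmod[of z] unfolding exp_le_cancel_iff by (intro mult_mono) (auto simp: x_def)
    finally show ?thesis .
  qed
  have far: "cmod (E z) \<le> exp ((max \<tau> 0 + \<epsilon>) * cmod z)"
    if z: "\<bar>Im z\<bar> \<ge> \<sigma> * \<bar>Re z\<bar> / 2" "R2 \<le> cmod z" for z
  proof -
    have c: "cmod z \<le> (1 + 2 / \<sigma>) * \<bar>Im z\<bar>"
    proof -
      have "\<bar>Re z\<bar> \<le> 2 / \<sigma> * \<bar>Im z\<bar>" using z \<sigma> by (simp add: field_simps)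
      then show ?thesis using cmod_le[of z] by (simp add: algebra_simps)
    qed
    have im0: "Im z \<noteq> 0" using c z R2 by auto
    have "cmod (E z) \<le> exp (\<tau> * \<bar>Im z\<bar> + \<delta> * (cmod z)\<^sup>2 / \<bar>Im z\<bar>)" by (rule R2(2)[OF im0 z(2)])
    also have "\<dots> \<le> exp (max \<tau> 0 * cmod z + \<epsilon> * cmod z)"
      unfolding exp_le_cancel_iff
    proof (rule add_mono)
      show "\<tau> * \<bar>Im z\<bar> \<le> max \<tau> 0 * cmod z" using abs_Im_le_cmod[of z] by (intro mult_mono) auto
      have "\<delta> * (cmod z)\<^sup>2 / \<bar>Im z\<bar> = \<delta> * cmod z * (cmod z / \<bar>Im z\<bar>)" by (simp add: power2_eq_square)
      also have "\<dots> \<le> \<delta> * cmod z * (1 + 2 / \<sigma>)"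
        using c im0 \<delta> by (intro mult_left_mono) (auto simp: field_simps)
      also have "\<dots> = \<epsilon> * cmod z"
      proof -
        have "1 + 2 / \<sigma> > 0" using \<sigma> by (simp add: add_pos_pos)
        then show ?thesis unfolding \<delta>_def by simp
      qed
      finally show "\<delta> * (cmod z)\<^sup>2 / \<bar>Im z\<bar> \<le> \<epsilon> * cmod z" .
    qed
    finally show ?thesis by (simp add: algebra_simps)
  qed
  show ?thesis
  proof (intro exI[of _ "max (4 * R1) R2"] allI impI)
    fix z assume z: "max (4 * R1) R2 \<le> cmod z"
    show "cmod (E z) \<le> exp ((max \<tau> 0 + \<epsilon>) * cmod z)"
    proof (cases "\<bar>Im z\<bar> \<ge> \<sigma> * \<bar>Re z\<bar> / 2")
      case True
      then show ?thesis using far z by simp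
    next
      case False
      have "cmod (E z) \<le> exp (\<epsilon> * cmod z)"
      proof (cases "Re z \<ge> 0")
        case True
        then show ?thesis using near[of z] False z by simp
      next
        case F: False
        then show ?thesis using near[of "- cnj z"] False z by (simp add: cmod_E_uminus_cnj)
      qed
      also have "\<dots> \<le> exp ((max \<tau> 0 + \<epsilon>) * cmod z)" by (simp add: mult_right_mono)
      finally show ?thesis .
    qed
  qed
qed

lemma E_exp_type_max: "E \<in> exp_type_class (max \<tau> 0)"
  by (rule exp_type_classI[OF _ _ E_growth]) (use holE in \<open>auto simp: entire_def\<close>)

text \<open>For negative \<tau> the function \<open>E\<close> decays exponentially along the
  imaginary axis in both directions and has type 0. Phragmen-Lindeloef in the right and left
  half-planes bounds it, Liouville makes it constant, and the decay contradicts E(0) \<noteq>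
  0.\<close>

lemma tau_nonneg: "\<tau> \<ge> 0"
proof (rule ccontr)
  assume "\<not> \<tau> \<ge> 0"
  then have neg: "\<tau> < 0" by simp
  obtain R where R: "R > 0" "\<And>z. Im z \<noteq> 0 \<Longrightarrow> R \<le> cmod z \<Longrightarrow>
      cmod (E z) \<le> exp (\<tau> * \<bar>Im z\<bar> + (- \<tau> / 2) * (cmod z)\<^sup>2 / \<bar>Im z\<bar>)"
    using E_off_axis[of "- \<tau> / 2"] neg by auto
  have decay: "cmod (E (\<i> * of_real y)) \<le> exp (\<tau> / 2 * \<bar>y\<bar>)" if "R \<le> \<bar>y\<bar>" for y
  proof -
    have y: "\<bar>y\<bar> > 0" using that R(1) by linarith
    then have "\<tau> * \<bar>y\<bar> + (- \<tau> / 2) * \<bar>y\<bar>\<^sup>2 / \<bar>y\<bar> = \<tau> / 2 * \<bar>y\<bar>"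
      by (simp only: power2_eq_square) (simp add: field_simps)
    moreover have "cmod (E (\<i> * of_real y)) \<le> exp (\<tau> * \<bar>y\<bar> + (- \<tau> / 2) * \<bar>y\<bar>\<^sup>2 / \<bar>y\<bar>)"
      using R(2)[of "\<i> * of_real y"] that y by (simp add: norm_mult)
    ultimately show ?thesis by metis
  qed
  have "bounded ((\<lambda>y. E (\<i> * of_real y)) ` cball 0 R)"
    by (intro compact_imp_bounded compact_continuous_image continuous_on_compose2[OF contE[of UNIV]] continuous_intros) auto
  then obtain B where B: "B > 0" "\<And>y. \<bar>y\<bar> \<le> R \<Longrightarrow> cmod (E (\<i> * of_real y)) \<le> B"
    unfolding bounded_pos by (auto simp: dist_real_def)
  define M where "M = B + 1"
  have axis: "cmod (E (\<i> * of_real y)) \<le> M" for y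
  proof (cases "\<bar>y\<bar> \<le> R")
    case True
    then show ?thesis using B(2)[OF True] by (simp add: M_def)
  next
    case False
    then have "cmod (E (\<i> * of_real y)) \<le> exp (\<tau> / 2 * \<bar>y\<bar>)" by (intro decay) auto
    also have "\<dots> \<le> exp 0" unfolding exp_le_cancel_iff using neg by (simp add: mult_nonpos_nonneg)
    finally show ?thesis using B by (simp add: M_def)
  qed
  have type0: "\<exists>C>0. \<forall>z. cmod (E z) \<le> C * exp (e * cmod z)" if "e > 0" for e
    using E_exp_type_max that neg by (auto simp: exp_type_class_def max_def split: if_splits)
  have right: "cmod (E (- \<i> * w)) \<le> M" if w: "0 \<le> Im w" for w
  proof -
    obtain C where C: "C > 0" "\<And>z. cmod (E z) \<le> C * exp (1 * cmod z)" using type0[of 1] by auto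
    show ?thesis
    proof (rule Phragmen_Lindeloef_half_plane[where f = "\<lambda>w. E (- \<i> * w)" and C = "max 1 (ln C)"])
      show "continuous_on {z. 0 \<le> Im z} (\<lambda>w. E (- \<i> * w))"
        by (intro continuous_on_compose2[OF contE[of UNIV]] continuous_intros) auto
      show "(\<lambda>w. E (- \<i> * w)) holomorphic_on upper_half_plane"
        by (intro holomorphic_on_compose_gen[OF _ holE[of UNIV], unfolded o_def] holomorphic_intros) auto
      show "cmod (E (- \<i> * z)) \<le> exp (max 1 (ln C) * (1 + cmod z))" for z
      proof -
        have "cmod (E (- \<i> * z)) \<le> C * exp (cmod z)" using C(2)[of "- \<i> * z"] by (simp add: norm_mult)
        also have "\<dots> = exp (ln C + cmod z)" using C(1) by (simp add: exp_add)
        also have "\<dots> \<le> exp (max 1 (ln C) * (1 + cmod z))"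
        proof -
          have "1 * cmod z \<le> max 1 (ln C) * cmod z" by (intro mult_right_mono) auto
          then show ?thesis by (simp add: algebra_simps)
        qed
        finally show ?thesis .
      qed
      show "cmod (E (- \<i> * of_real x)) \<le> M" for x using axis[of "- x"] by simp
      show "\<exists>K. \<forall>y\<ge>0. cmod (E (- \<i> * (\<i> * of_real y))) \<le> K * exp (e * y)" if e: "e > 0" for e
      proof -
        obtain C where C: "C > 0" "\<And>z. cmod (E z) \<le> C * exp (e * cmod z)" using type0[OF e] by auto
        have "cmod (E (- \<i> * (\<i> * of_real y))) \<le> C * exp (e * y)" if "y \<ge> 0" for y
          using C(2)[of "of_real y"] that by (simp flip: mult.assoc)
        then show ?thesis by blast
      qed
    qed (use w B in \<open>auto simp: M_def\<close>)
  qed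
  have all: "cmod (E z) \<le> M" for z
  proof -
    have r: "cmod (E z) \<le> M" if "Re z \<ge> 0" for z
      using right[of "\<i> * z"] that by (simp flip: mult.assoc)
    show ?thesis using r[of z] r[of "- cnj z"] by (cases "Re z \<ge> 0") (auto simp: cmod_E_uminus_cnj)
  qed
  then have "bounded (range E)" by (auto intro: boundedI)
  then obtain c where c: "\<And>z. E z = c" using Liouville_theorem[OF holE[of UNIV]] by (metis constant_on_def UNIV_I)
  have "((\<lambda>y. exp (\<tau> / 2 * \<bar>y\<bar>)) \<longlongrightarrow> 0) at_top" using neg by real_asymp
  then have "\<forall>\<^sub>F y in at_top. exp (\<tau> / 2 * \<bar>y\<bar>) < cmod c"
    using E_nz[of 0] c by (intro order_tendstoD) auto
  then have "\<forall>\<^sub>F y in at_top. exp (\<tau> / 2 * \<bar>y\<bar>) < cmod c \<and> y \<ge> R"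
    by (intro eventually_conj eventually_ge_at_top)
  then obtain y where "exp (\<tau> / 2 * \<bar>y\<bar>) < cmod c" "y \<ge> R"
    using eventually_happens'[OF trivial_limit_at_top_linorder] by blast
  moreover have "R \<le> \<bar>y\<bar>" using \<open>y \<ge> R\<close> by linarith
  ultimately show False using decay[of y] c by auto
qed

lemma E_exp_type: "E \<in> exp_type_class \<tau>"
  using E_exp_type_max tau_nonneg by simp

end

section \<open>Integrals over the real line\<close>

text \<open>If \<open>f\<close> is bounded and integrable on the real line and holomorphic above it, integrate
  \<open>f z / (1 - i z / n)\<^sup>2\<close> along a half-circle of radius \<open>n\<^sup>3\<close>.\<close>

lemma bounded_half_plane_integral_zero:
  fixes f :: "complex \<Rightarrow> complex"
  assumes contf: "continuous_on {z. 0 \<le> Im z} f"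
    and holf: "f holomorphic_on upper_half_plane"
    and bound: "\<And>z. 0 \<le> Im z \<Longrightarrow> cmod (f z) \<le> M"
    and int: "integrable lborel (\<lambda>x::real. f (of_real x))"
  shows "(LINT x|lborel. f (of_real x)) = 0"
proof -
  have M: "M \<ge> 0" using bound[of 0] by (smt (verit) norm_ge_zero zero_complex.simps)
  \<comment> \<open>The divisor tends to 1 as n grows and gives quadratic decay. At radius n^3 its
    modulus is about n^4, which outweighs the arc length pi n^3.\<close>
  define h where "h = (\<lambda>(n::nat) z. f z / (1 - \<i> * z / of_nat n)\<^sup>2)"
  have den1: "cmod (1 - \<i> * w / of_nat n) \<ge> 1" if "0 \<le> Im w" for w and n :: nat
  proof -
    have "Re (1 - \<i> * w / of_nat n) = 1 + Im w / n" by (simp add: Re_divide_of_nat)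
    moreover have "Im w / n \<ge> 0" using that by simp
    ultimately show ?thesis using complex_Re_le_cmod[of "1 - \<i> * w / of_nat n"] by linarith
  qed
  have den0: "1 - \<i> * w / of_nat n \<noteq> 0" if "0 \<le> Im w" for w and n :: nat
    using den1[OF that, of n] by (metis norm_zero not_one_le_zero)
  have conth: "continuous_on {z. 0 \<le> Im z} (h n)" for n
    unfolding h_def divide_inverse using den0[unfolded divide_inverse] by (intro continuous_intros contf) auto
  have holh: "h n holomorphic_on upper_half_plane" for n
    unfolding h_def divide_inverse using den0[unfolded divide_inverse] by (intro holomorphic_intros holf) auto
  define J where "J = (\<lambda>n. LINT x|lborel. indicator {- (real n ^ 3)..real n ^ 3} x *\<^sub>R h n (of_real x))"
  have "J \<longlonglongrightarrow> (LINT x|lborel. f (of_real x))"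
    unfolding J_def
  proof (rule integral_dominated_convergence[where w = "\<lambda>x. cmod (f (of_real x))"])
    show fm: "(\<lambda>x::real. f (of_real x)) \<in> borel_measurable lborel" using int by (rule borel_measurable_integrable)
    show "(\<lambda>x. indicator {- (real n ^ 3)..real n ^ 3} x *\<^sub>R h n (of_real x)) \<in> borel_measurable lborel" for n
    proof -
      have "continuous_on UNIV (\<lambda>x::real. h n (of_real x))"
        by (rule continuous_on_compose2[OF conth]) (auto intro!: continuous_intros)
      then have "(\<lambda>x::real. h n (of_real x)) \<in> borel_measurable borel" by (rule borel_measurable_continuous_onI)
      then show ?thesis by measurable
    qed
    show "integrable lborel (\<lambda>x. cmod (f (of_real x)))" using int by (rule integrable_norm)
    show "AE x in lborel. (\<lambda>n. indicator {- (real n ^ 3)..real n ^ 3} x *\<^sub>R h n (of_real x)) \<longlonglongrightarrow> f (of_real x)"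
    proof (rule AE_I2)
      fix x :: real
      have "(\<lambda>n. inverse (of_nat n :: complex)) \<longlonglongrightarrow> 0" by (rule lim_inverse_n)
      then have "(\<lambda>n. f (of_real x) / (1 - \<i> * of_real x * inverse (of_nat n))\<^sup>2) \<longlonglongrightarrow> f (of_real x) / (1 - \<i> * of_real x * 0)\<^sup>2"
        by (intro tendsto_intros) auto
      then have 1: "(\<lambda>n. h n (of_real x)) \<longlonglongrightarrow> f (of_real x)" by (simp add: h_def divide_inverse)
      have "filterlim (\<lambda>n. real n ^ 3) at_top sequentially" by real_asymp
      then have "\<forall>\<^sub>F n in sequentially. real n ^ 3 \<ge> \<bar>x\<bar>" by (simp add: filterlim_at_top)
      then have "\<forall>\<^sub>F n in sequentially. h n (of_real x) = indicator {- (real n ^ 3)..real n ^ 3} x *\<^sub>R h n (of_real x)"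
        by eventually_elim (auto simp: indicator_def)
      then show "(\<lambda>n. indicator {- (real n ^ 3)..real n ^ 3} x *\<^sub>R h n (of_real x)) \<longlonglongrightarrow> f (of_real x)"
        by (rule Lim_transform_eventually[OF 1])
    qed
    show "AE x in lborel. norm (indicator {- (real n ^ 3)..real n ^ 3} x *\<^sub>R h n (of_real x)) \<le> cmod (f (of_real x))" for n
    proof (rule AE_I2)
      fix x :: real
      have "1 \<le> (cmod (1 - \<i> * of_real x / of_nat n))\<^sup>2" using den1[of "of_real x" n] by (simp add: one_le_power)
      then have "cmod (h n (of_real x)) \<le> cmod (f (of_real x)) / 1"
        unfolding h_def norm_divide norm_power by (intro divide_left_mono) auto
      then show "norm (indicator {- (real n ^ 3)..real n ^ 3} x *\<^sub>R h n (of_real x)) \<le> cmod (f (of_real x))"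
        by (auto simp: indicator_def)
    qed
  qed
  moreover have "J \<longlonglongrightarrow> 0"
  proof (rule Lim_null_comparison)
    have "(\<lambda>n. M / (real n ^ 2 - 1)\<^sup>2 * real n ^ 3 * pi) \<longlonglongrightarrow> 0" by real_asymp
    then show "(\<lambda>n. M / (real n ^ 2 - 1)\<^sup>2 * real n ^ 3 * pi) \<longlonglongrightarrow> 0" .
    show "\<forall>\<^sub>F n in sequentially. norm (J n) \<le> M / (real n ^ 2 - 1)\<^sup>2 * real n ^ 3 * pi"
      using eventually_gt_at_top[of 1]
    proof eventually_elim
      fix n :: nat assume n: "n > 1"
      define r where "r = real n ^ 3"
      have r: "r > 0" using n by (simp add: r_def)
      let ?l = "linepath (of_real (- r)) (of_real r)" and ?c = "part_circlepath 0 r 0 pi"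
      have pl: "path_image ?l \<subseteq> {z. 0 \<le> Im z}"
        by (auto simp: path_image_def linepath_def)
      have pc: "path_image ?c \<subseteq> {z. 0 \<le> Im z \<and> cmod z = r}"
        using r by (auto simp: path_image_part_circlepath Im_exp norm_mult intro!: mult_nonneg_nonneg sin_ge_zero)
      have fin: "pathfinish ?c = of_real (- r)" "pathstart ?c = of_real r"
        by (auto simp: pathfinish_part_circlepath)
      have "(h n has_contour_integral 0) (?l +++ ?c)"
      proof (rule Cauchy_theorem_convex[OF conth, where K = "{}"])
        show "convex {z. 0 \<le> Im z}" by (rule convex_halfspace_Im_ge)
        show "h n field_differentiable at x" if "x \<in> interior {z. 0 \<le> Im z} - {}" for x
        proof -
          have "interior {z. 0 \<le> Im z} = upper_half_plane"
            using interior_halfspace_ge[of \<i> 0] by (simp add: inner_complex_def)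
          then show ?thesis using that holh[of n] open_uhp by (auto intro: holomorphic_on_imp_differentiable_at)
        qed
        show "path_image (?l +++ ?c) \<subseteq> {z. 0 \<le> Im z}"
          using pl pc by (subst path_image_join) (auto simp: fin)
      qed (auto simp: fin)
      then have ci: "(h n has_contour_integral 0) (?l +++ ?c)" .
      have il: "h n contour_integrable_on ?l"
        by (rule contour_integrable_continuous_linepath, rule continuous_on_subset[OF conth[of n]])
          (use pl in \<open>simp add: path_image_linepath\<close>)
      have ic: "h n contour_integrable_on ?c"
        by (rule contour_integrable_continuous_part_circlepath, rule continuous_on_subset[OF conth[of n]])
          (use pc in auto)
      have "contour_integral ?l (h n) + contour_integral ?c (h n) = 0"
        using contour_integral_join[OF il ic] contour_integral_unique[OF ci] by (simp add: fin)
      then have eq: "norm (contour_integral ?l (h n)) = norm (contour_integral ?c (h n))"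
        by (metis add_eq_0_iff norm_minus_cancel)
      have bc: "norm (h n z) \<le> M / (real n ^ 2 - 1)\<^sup>2" if z: "z \<in> path_image ?c" for z
      proof -
        have z': "0 \<le> Im z" "cmod z = r" using pc z by auto
        have "cmod (\<i> * z / of_nat n) = real n ^ 2"
          using z' n by (simp add: norm_divide norm_mult r_def power2_eq_square power3_eq_cube)
        then have "real n ^ 2 - 1 \<le> cmod (1 - \<i> * z / of_nat n)"
          using norm_triangle_ineq2[of "\<i> * z / of_nat n" 1] by (simp add: norm_minus_commute)
        moreover have n2: "real n ^ 2 > 1" using n by (simp add: one_less_power)
        ultimately have "(real n ^ 2 - 1)\<^sup>2 \<le> (cmod (1 - \<i> * z / of_nat n))\<^sup>2" by (intro power_mono) auto
        then show ?thesis
          unfolding h_def norm_divide norm_power using bound[OF z'(1)] n2 M by (intro frac_le) auto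
      qed
      have "norm (contour_integral ?c (h n)) \<le> M / (real n ^ 2 - 1)\<^sup>2 * r * \<bar>pi - 0\<bar>"
        by (rule contour_integral_bound_part_circlepath[OF ic _ _ bc]) (use r M in auto)
      moreover have "contour_integral ?l (h n) = J n"
      proof -
        have "contour_integral ?l (h n) = integral {- r..r} (\<lambda>x. h n (of_real x))"
          using contour_integral_linepath_Reals_eq[of "of_real (-r)" "of_real r" "h n"] r by simp
        also have "\<dots> = (LINT x:{- r..r}|lborel. h n (of_real x))"
        proof (rule set_borel_integral_eq_integral(2)[symmetric])
          show "set_integrable lborel {- r..r} (\<lambda>x. h n (of_real x))"
            by (rule borel_integrable_atLeastAtMost') (auto intro!: continuous_on_compose2[OF conth[of n]] continuous_intros)
        qed
        finally show ?thesis by (simp add: J_def set_lebesgue_integral_def r_def)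
      qed
      ultimately show "norm (J n) \<le> M / (real n ^ 2 - 1)\<^sup>2 * real n ^ 3 * pi"
        using eq by (simp add: r_def)
    qed
  qed
  ultimately show ?thesis by (rule LIMSEQ_unique)
qed

text \<open>Converts the blow-up at the real axis into growth of order 1. High points satisfy the
  bound already; a low point is enclosed in a half-lens of size comparable with |z| whose flat side
  lies on the real axis, where the edge bound applies.\<close>

lemma half_plane_exp_growth:
  assumes contf: "continuous_on {z. 0 \<le> Im z} f"
    and holf: "f holomorphic_on upper_half_plane"
    and C: "C > 0" and growth: "\<And>z. Im z > 0 \<Longrightarrow> cmod (f z) \<le> exp (C * (2 + cmod z)\<^sup>2 / Im z)"
    and edge: "\<And>x::real. cmod (f (of_real x)) \<le> M" and M: "M \<ge> 1"
  obtains C' where "\<And>z. 0 \<le> Im z \<Longrightarrow> cmod (f z) \<le> exp (C' * (1 + cmod z))"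
proof -
  have "bounded (f ` ({z. 0 \<le> Im z} \<inter> cball 0 3))"
    by (intro compact_imp_bounded compact_continuous_image continuous_on_subset[OF contf] closed_Int_compact closed_halfspace_Im_ge) auto
  then obtain B where B: "B > 0" "\<And>z. 0 \<le> Im z \<Longrightarrow> cmod z \<le> 3 \<Longrightarrow> cmod (f z) \<le> B" by (auto simp: bounded_pos)
  define b where "b = ln (max B 1)"
  have b: "b \<ge> 0" "B \<le> exp b" using B by (auto simp: b_def)
  define m where "m = ln M"
  have m: "m \<ge> 0" "M = exp m" using M by (auto simp: m_def)
  \<comment> \<open>The 72 comes from the half-lens, whose exponent is 2 D * 4 / X with D = C (3
    X)^2. The summands \<open>b\<close> and \<open>m\<close> serve the bounded points and the
    edge.\<close>
  define C' where "C' = 72 * C + b + m"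
  have le: "exp s \<le> exp (C' * (1 + cmod z))" if "s \<le> 72 * C * (1 + cmod z) + b + m" for s z
  proof -
    have "b + m \<le> (b + m) * (1 + cmod z)" using b m by (simp add: algebra_simps)
    then show ?thesis unfolding exp_le_cancel_iff using that by (simp add: C'_def algebra_simps)
  qed
  show thesis
  proof (rule that[of C'])
    fix z assume z: "0 \<le> Im z"
    define x where "x = Re z"
    define y where "y = Im z"
    have czy: "cmod z \<le> \<bar>x\<bar> + y" using cmod_le[of z] z by (simp add: x_def y_def)
    consider "y \<ge> \<bar>x\<bar> / 2" "y \<ge> 1" | "cmod z \<le> 3" | "\<bar>x\<bar> \<ge> 2" "y < \<bar>x\<bar> / 2"
      using czy by linarith
    then show "cmod (f z) \<le> exp (C' * (1 + cmod z))"
    proof cases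
      case 1
      have "(2 + cmod z)\<^sup>2 / y = (2 + cmod z) * ((2 + cmod z) / y)" by (simp add: power2_eq_square)
      also have "\<dots> \<le> (2 + cmod z) * 5"
      proof (rule mult_left_mono)
        have "2 + cmod z \<le> 5 * y" using czy 1 by linarith
        then show "(2 + cmod z) / y \<le> 5" using 1 by (simp add: field_simps)
      qed auto
      also have "\<dots> \<le> 10 * (1 + cmod z)" by simp
      finally have "C * ((2 + cmod z)\<^sup>2 / y) \<le> C * (10 * (1 + cmod z))" using C by (intro mult_left_mono) auto
      moreover have "C * (10 * (1 + cmod z)) \<le> C * (72 * (1 + cmod z))" using C by (intro mult_left_mono mult_right_mono) auto
      ultimately have "C * (2 + cmod z)\<^sup>2 / y \<le> 72 * C * (1 + cmod z) + b + m" using b m by (simp add: algebra_simps)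
      then show ?thesis using growth[of z] le 1 unfolding y_def by (meson order_trans less_le_trans zero_less_one)
    next
      case 2
      have "C * (1 + cmod z) \<ge> 0" using C by simp
      then have "exp b \<le> exp (C' * (1 + cmod z))" using m by (intro le) auto
      then show ?thesis using B(2)[OF z 2] b by linarith
    next
      case 3
      show ?thesis
      proof (cases "y = 0")
        case True
        then have "cmod (f z) \<le> M" using edge[of "Re z"] unfolding y_def by (metis complex_is_Real_iff of_real_Re)
        moreover have "C * (1 + cmod z) \<ge> 0" using C by simp
        then have "exp m \<le> exp (C' * (1 + cmod z))" using b by (intro le) auto
        ultimately show ?thesis using m by linarith
      next
        case False
        then have y0: "y > 0" using z by (simp add: y_def)
        define X where "X = \<bar>x\<bar>"
        define p where "p = x - X / 2"
        define q where "q = x + X / 2"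
        have X: "X \<ge> 2" using 3 by (simp add: X_def)
        define S where "S = {w. \<bar>Im w\<bar> < 1 * (Re w - p)} \<inter> {w. \<bar>Im w\<bar> < 1 * (q - Re w)} \<inter> {w. 0 < Im w}"
        define W where "W = {w. \<bar>Im w\<bar> \<le> 1 * (Re w - p)} \<inter> {w. \<bar>Im w\<bar> \<le> 1 * (q - Re w)} \<inter> {w. 0 \<le> Im w}"
        have oS: "open S" unfolding S_def by (intro open_Int open_Collect_less continuous_intros)
        have clW: "closed W" unfolding W_def by (intro closed_Int closed_Collect_le continuous_intros)
        have SW: "closure S \<subseteq> W" by (rule closure_minimal[OF _ clW]) (auto simp: S_def W_def)
        define D where "D = C * (3 * X)\<^sup>2"
        have D: "D > 0" using C X by (simp add: D_def)
        have zS: "z \<in> S" using 3 y0 by (auto simp: S_def p_def q_def X_def x_def[symmetric] y_def[symmetric])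
        have "cmod (f z) \<le> M * exp (2 * D * (Re (1 / (z - of_real p)) + Re (1 / (of_real q - z))))"
        proof (rule lens_bound[where \<sigma> = 1, OF _ _ D _ oS _ _ _ _ _ zS])
          show "continuous_on (closure S) f" by (rule continuous_on_subset[OF contf]) (use SW in \<open>auto simp: W_def\<close>)
          show "f holomorphic_on S" by (rule holomorphic_on_subset[OF holf]) (auto simp: S_def)
          fix w assume w: "w \<in> frontier S" "w \<noteq> of_real p" "w \<noteq> of_real q"
          have wW: "w \<in> W" "w \<notin> S" using w SW oS by (auto simp: frontier_def interior_open)
          show "cmod (f w) \<le> M \<or> Im w \<noteq> 0 \<and> (\<bar>Im w\<bar> = 1 * (Re w - p) \<or> \<bar>Im w\<bar> = 1 * (q - Re w)) \<and>
            cmod (f w) \<le> M * exp (D / \<bar>Im w\<bar>)"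
          proof (cases "Im w = 0")
            case True
            then show ?thesis using edge[of "Re w"] by (metis complex_is_Real_iff of_real_Re)
          next
            case F: False
            then have im: "Im w > 0" using wW by (auto simp: W_def)
            have "\<bar>Re w\<bar> + Im w \<le> 2 * X" using wW by (auto simp: W_def p_def q_def X_def)
            then have "2 + cmod w \<le> 3 * X" using cmod_le[of w] im X by linarith
            then have "C * (2 + cmod w)\<^sup>2 / Im w \<le> D / Im w"
              unfolding D_def using C im by (intro divide_right_mono mult_left_mono power_mono) auto
            then have "cmod (f w) \<le> 1 * exp (D / \<bar>Im w\<bar>)" using growth[OF im] im by (smt (verit) exp_le_cancel_iff)
            also have "\<dots> \<le> M * exp (D / \<bar>Im w\<bar>)" using M by (intro mult_right_mono) auto
            finally show ?thesis using wW F im by (auto simp: W_def S_def)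
          qed
        qed (use X M in \<open>auto simp: p_def q_def S_def\<close>)
        also have "\<dots> \<le> M * exp (2 * D * (2 / X + 2 / X))"
        proof -
          have "Re (1 / (z - of_real p)) \<le> 2 / X" "Re (1 / (of_real q - z)) \<le> 2 / X"
            using Re_one_divide_le[of "z - of_real p"] Re_one_divide_le[of "of_real q - z"] X by (auto simp: p_def q_def x_def[symmetric])
          then have "2 * D * (Re (1 / (z - of_real p)) + Re (1 / (of_real q - z))) \<le> 2 * D * (2 / X + 2 / X)"
            using D by (intro mult_left_mono add_mono) auto
          then show ?thesis using M by (intro mult_left_mono) auto
        qed
        also have "2 * D * (2 / X + 2 / X) = 72 * C * X" using X by (simp add: D_def field_simps power2_eq_square)
        also have "M * exp (72 * C * X) = exp (72 * C * X + m)" by (simp add: m exp_add)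
        also have "\<dots> \<le> exp (C' * (1 + cmod z))"
        proof (rule le)
          have "X \<le> 1 + cmod z" using abs_Re_le_cmod[of z] by (simp add: X_def x_def)
          then have "72 * C * X \<le> 72 * C * (1 + cmod z)" using C by (intro mult_left_mono) auto
          then show "72 * C * X + m \<le> 72 * C * (1 + cmod z) + b + m" using b by linarith
        qed
        finally show ?thesis .
      qed
    qed
  qed
qed

text \<open>The averages \<open>\<integral>\<phi> (z + t) dt, 0 \<le> t \<le> 1,\<close> have the same integral over the real line as \<open>\<phi>\<close>, and they are
  bounded there, so that the Phragmen-Lindeloef principle applies to them.\<close>

lemma half_plane_integral_zero:
  fixes \<phi> :: "complex \<Rightarrow> complex"
  assumes cont\<phi>: "continuous_on {z. 0 \<le> Im z} \<phi>"
    and hol\<phi>: "\<phi> holomorphic_on upper_half_plane"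
    and int: "integrable lborel (\<lambda>x::real. \<phi> (of_real x))"
    and C: "C > 0" and growth: "\<And>z. Im z > 0 \<Longrightarrow> cmod (\<phi> z) \<le> exp (C * (1 + cmod z)\<^sup>2 / Im z)"
    and axis: "\<And>e. e > 0 \<Longrightarrow> \<exists>Y. \<forall>y\<ge>Y. \<forall>t\<in>{0..1}. cmod (\<phi> (of_real t + \<i> * of_real y)) \<le> exp (e * y)"
  shows "(LINT x|lborel. \<phi> (of_real x)) = 0"
proof -
  define f where "f = (\<lambda>z. integral {0..1} (\<lambda>t::real. \<phi> (z + of_real t)))"
  define I where "I = (LINT x|lborel. cmod (\<phi> (of_real x)))"
  have cont_t: "continuous_on {0..1} (\<lambda>t::real. \<phi> (z + of_real t))" if "0 \<le> Im z" for z
    by (rule continuous_on_compose2[OF cont\<phi>]) (use that in \<open>auto intro!: continuous_intros\<close>)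
  have contf: "continuous_on {z. 0 \<le> Im z} f"
  proof -
    have "continuous_on ({z. 0 \<le> Im z} \<times> cbox 0 1) (\<lambda>(z, t::real). \<phi> (z + of_real t))"
      unfolding case_prod_unfold
      by (rule continuous_on_compose2[OF cont\<phi>]) (auto intro!: continuous_intros)
    from integral_continuous_on_param[OF this] show ?thesis unfolding f_def by simp
  qed
  have holf: "f holomorphic_on upper_half_plane"
    unfolding f_def box_real(2)[symmetric]
  proof (rule leibniz_rule_holomorphic[where fx = "\<lambda>z t. deriv \<phi> (z + of_real t)"])
    show "((\<lambda>z. \<phi> (z + of_real t)) has_field_derivative deriv \<phi> (z + of_real t)) (at z within upper_half_plane)"
      if "z \<in> upper_half_plane" "t \<in> cbox 0 1" for z and t :: real
    proof -
      have "(\<phi> has_field_derivative deriv \<phi> (z + of_real t)) (at (z + of_real t))"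
        by (rule holomorphic_derivI[OF hol\<phi> open_uhp]) (use that in auto)
      then have "((\<lambda>z. \<phi> (z + of_real t)) has_field_derivative deriv \<phi> (z + of_real t)) (at z)"
        by (simp add: DERIV_shift)
      then show ?thesis by (rule has_field_derivative_at_within)
    qed
    show "(\<lambda>t. \<phi> (z + of_real t)) integrable_on cbox 0 1" if "z \<in> upper_half_plane" for z
      unfolding box_real(2) using that by (intro integrable_continuous_real cont_t) auto
    have "continuous_on upper_half_plane (deriv \<phi>)"
      by (intro holomorphic_on_imp_continuous_on holomorphic_deriv hol\<phi> open_uhp)
    then show "continuous_on (upper_half_plane \<times> cbox 0 1) (\<lambda>(z, t::real). deriv \<phi> (z + of_real t))"
      unfolding case_prod_unfold
      by (rule continuous_on_compose2) (auto intro!: continuous_intros)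
    show "convex upper_half_plane" by (rule convex_uhp)
  qed
  have f_le: "cmod (f z) \<le> B" if "0 \<le> Im z" "\<And>t::real. t \<in> {0..1} \<Longrightarrow> cmod (\<phi> (z + of_real t)) \<le> B" for z B
    using integral_bound[of 0 1 "\<lambda>t. \<phi> (z + of_real t)" B, OF _ cont_t] that by (simp add: f_def)
  have shift_int: "integrable lborel (\<lambda>x::real. \<phi> (of_real x + of_real t))"
    "(LINT x|lborel. \<phi> (of_real x + of_real t)) = (LINT x|lborel. \<phi> (of_real x))"
    "integrable lborel (\<lambda>x::real. cmod (\<phi> (of_real x + of_real t)))"
    "(LINT x|lborel. cmod (\<phi> (of_real x + of_real t))) = I" for t :: real
  proof -
    show 1: "integrable lborel (\<lambda>x::real. \<phi> (of_real x + of_real t))"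
      using lborel_integrable_real_affine[OF int, of 1 t] by (simp add: add.commute)
    then show "integrable lborel (\<lambda>x::real. cmod (\<phi> (of_real x + of_real t)))" by (rule integrable_norm)
    show "(LINT x|lborel. \<phi> (of_real x + of_real t)) = (LINT x|lborel. \<phi> (of_real x))"
      using lborel_integral_real_affine[of 1 "\<lambda>x. \<phi> (of_real x)" t] by (simp add: add.commute)
    show "(LINT x|lborel. cmod (\<phi> (of_real x + of_real t))) = I"
      using lborel_integral_real_affine[of 1 "\<lambda>x. cmod (\<phi> (of_real x))" t] by (simp add: add.commute I_def)
  qed
  have contR: "continuous_on UNIV (\<lambda>x::real. \<phi> (of_real x))"
    by (rule continuous_on_compose2[OF cont\<phi>]) (auto intro!: continuous_intros)
  have f_real: "f (of_real x) = (LINT t|lborel. indicator {0..1} t *\<^sub>R \<phi> (of_real x + of_real t))" for x :: real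
  proof -
    have "set_integrable lborel {0..1} (\<lambda>t. \<phi> (of_real x + of_real t))"
      by (rule borel_integrable_atLeastAtMost', rule cont_t) auto
    from set_borel_integral_eq_integral(2)[OF this] show ?thesis
      by (simp add: f_def set_lebesgue_integral_def)
  qed
  define G where "G = (\<lambda>t x::real. indicator {0..1::real} t *\<^sub>R \<phi> (of_real x + of_real t))"
  have intG: "integrable (lborel \<Otimes>\<^sub>M lborel) (case_prod G)"
  proof (rule lborel_pair.Fubini_integrable)
    have "continuous_on UNIV (\<lambda>(t::real, x::real). \<phi> (of_real x + of_real t))"
      unfolding case_prod_unfold by (rule continuous_on_compose2[OF cont\<phi>]) (auto intro!: continuous_intros)
    then have m: "(\<lambda>(t::real, x::real). \<phi> (of_real x + of_real t)) \<in> borel_measurable (lborel \<Otimes>\<^sub>M lborel)"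
      unfolding lborel_prod by (simp add: borel_measurable_continuous_onI)
    have "(\<lambda>p. indicator {0..1::real} (fst p) *\<^sub>R (case p of (t, x) \<Rightarrow> \<phi> (of_real x + of_real t))) \<in> borel_measurable (lborel \<Otimes>\<^sub>M lborel)"
      by (intro borel_measurable_scaleR m) measurable
    then show "case_prod G \<in> borel_measurable (lborel \<Otimes>\<^sub>M lborel)"
      by (simp add: G_def case_prod_unfold)
    have "(\<lambda>t. LINT x|lborel. norm (case_prod G (t, x))) = (\<lambda>t. indicator {0..1} t *\<^sub>R I)"
      using shift_int(4) by (auto simp: G_def indicator_def fun_eq_iff)
    then show "integrable lborel (\<lambda>t. LINT x|lborel. norm (case_prod G (t, x)))"
      by (simp add: integrable_mult_left)
    show "AE t in lborel. integrable lborel (\<lambda>x. case_prod G (t, x))"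
      using shift_int(1) by (auto simp: G_def indicator_def)
  qed
  have fG: "f (of_real x) = (LINT t|lborel. G t x)" for x :: real by (simp add: f_real G_def)
  have intf: "integrable lborel (\<lambda>x::real. f (of_real x))"
    using lborel_pair.integrable_snd[OF intG] by (simp add: fG)
  have "(LINT x|lborel. f (of_real x)) = (LINT t|lborel. LINT x|lborel. G t x)"
    unfolding fG by (rule lborel_pair.Fubini_integral[OF intG])
  also have "\<dots> = (LINT t|lborel. indicator {0..1::real} t *\<^sub>R (LINT x|lborel. \<phi> (of_real x)))"
    unfolding G_def by (simp only: integral_scaleR_right shift_int(2))
  also have "\<dots> = (LINT x|lborel. \<phi> (of_real x))" by simp
  finally have eq: "(LINT x|lborel. f (of_real x)) = (LINT x|lborel. \<phi> (of_real x))" .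
  define M where "M = I + 1"
  have I0: "I \<ge> 0" unfolding I_def by simp
  have edge: "cmod (f (of_real x)) \<le> M" for x :: real
  proof -
    have comm: "integrable lborel (\<lambda>t::real. cmod (\<phi> (of_real x + of_real t)))"
      "(LINT t|lborel. cmod (\<phi> (of_real x + of_real t))) = I"
      using shift_int(3,4)[of x] by (simp_all add: add.commute)
    have "cmod (f (of_real x)) \<le> (LINT t|lborel. norm (indicator {0..1} t *\<^sub>R \<phi> (of_real x + of_real t)))"
      unfolding f_real by (rule integral_norm_bound)
    also have "\<dots> \<le> (LINT t|lborel. cmod (\<phi> (of_real x + of_real t)))"
      by (rule integral_mono'[OF comm(1)]) (auto simp: indicator_def)
    finally show ?thesis using comm(2) by (simp add: M_def)
  qed
  have growth_f: "cmod (f z) \<le> exp (C * (2 + cmod z)\<^sup>2 / Im z)" if z: "Im z > 0" for z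
  proof (rule f_le)
    fix t :: real assume t: "t \<in> {0..1}"
    have "cmod (z + of_real t) \<le> cmod z + 1" using norm_triangle_ineq[of z "of_real t"] t by simp
    then have "C * (1 + cmod (z + of_real t))\<^sup>2 / Im z \<le> C * (2 + cmod z)\<^sup>2 / Im z"
      using C z by (intro divide_right_mono mult_left_mono power_mono) auto
    then show "cmod (\<phi> (z + of_real t)) \<le> exp (C * (2 + cmod z)\<^sup>2 / Im z)"
      using growth[of "z + of_real t"] z by (smt (verit) exp_le_cancel_iff Im_complex_of_real plus_complex.simps(2))
  qed (use z in auto)
  obtain C' where C': "\<And>z. 0 \<le> Im z \<Longrightarrow> cmod (f z) \<le> exp (C' * (1 + cmod z))"
    using half_plane_exp_growth[OF contf holf C growth_f edge] I0 by (auto simp: M_def)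
  \<comment> \<open>An average based at i y involves the horizontal segment from i y to 1 + i y,
    which is why the growth hypothesis concerns a strip.\<close>
  have axis_f: "\<exists>K. \<forall>y\<ge>0. cmod (f (\<i> * of_real y)) \<le> K * exp (e * y)" if e: "e > 0" for e
  proof -
    obtain Y where Y: "\<And>y t. y \<ge> Y \<Longrightarrow> t \<in> {0..1} \<Longrightarrow> cmod (\<phi> (of_real t + \<i> * of_real y)) \<le> exp (e * y)"
      using axis[OF e] by blast
    have "bounded ((\<lambda>y::real. f (\<i> * of_real y)) ` {0..Y})"
      by (intro compact_imp_bounded compact_continuous_image continuous_on_compose2[OF contf] continuous_intros) auto
    then obtain B where B: "B > 0" "\<And>y. 0 \<le> y \<Longrightarrow> y \<le> Y \<Longrightarrow> cmod (f (\<i> * of_real y)) \<le> B" by (auto simp: bounded_pos)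
    have "cmod (f (\<i> * of_real y)) \<le> (B + 1) * exp (e * y)" if y: "y \<ge> 0" for y
    proof (cases "y \<le> Y")
      case True
      have "B * 1 \<le> (B + 1) * exp (e * y)" using B e y by (intro mult_mono) auto
      then show ?thesis using B(2)[OF y True] by linarith
    next
      case False
      have "cmod (f (\<i> * of_real y)) \<le> exp (e * y)"
        using Y[of y] False y by (intro f_le) (auto simp: add.commute)
      also have "\<dots> \<le> (B + 1) * exp (e * y)" using B by simp
      finally show ?thesis .
    qed
    then show ?thesis by blast
  qed
  have "cmod (f z) \<le> M" if "0 \<le> Im z" for z
    by (rule Phragmen_Lindeloef_half_plane[OF contf holf C' edge axis_f _ that]) (use I0 in \<open>auto simp: M_def\<close>)
  from bounded_half_plane_integral_zero[OF contf holf this intf] show ?thesis by (simp add: eq)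
qed

section \<open>The reproducing kernel at the origin\<close>

lemma holomorphic_star: "f holomorphic_on UNIV \<Longrightarrow> star f holomorphic_on UNIV"
  using holomorphic_on_compose_cnj_cnj[of f UNIV] holomorphic_on_subset[of f UNIV "range cnj"]
  by (simp add: star_def[abs_def] o_def)

lemma integrable_inverse_quadratic:
  assumes "p > 0" "q > 0"
  shows "integrable lborel (\<lambda>w::real. 1 / (p\<^sup>2 + q\<^sup>2 * w\<^sup>2))"
    and "(LINT w|lborel. 1 / (p\<^sup>2 + q\<^sup>2 * w\<^sup>2)) = pi / (p * q)"
proof -
  have 1: "integrable lborel (\<lambda>w::real. inverse (1 + w\<^sup>2))"
    using integrable_inverse_1_plus_square by (simp add: set_integrable_def einterval_def)
  have 2: "(LINT w|lborel. inverse (1 + w\<^sup>2)) = pi"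
    using LBINT_inverse_1_plus_square
    by (simp add: interval_lebesgue_integral_def set_lebesgue_integral_def einterval_def)
  have c: "q / p \<noteq> 0" using assms by simp
  have eq: "1 / (p\<^sup>2 + q\<^sup>2 * w\<^sup>2) = (1 / p\<^sup>2) * inverse (1 + (0 + q / p * w)\<^sup>2)" for w
    using assms by (simp add: field_simps power2_eq_square)
  show "integrable lborel (\<lambda>w::real. 1 / (p\<^sup>2 + q\<^sup>2 * w\<^sup>2))"
    unfolding eq by (intro integrable_mult_right lborel_integrable_real_affine[OF 1 c])
  define L where "L = (LINT w|lborel. inverse (1 + (0 + q / p * w)\<^sup>2))"
  have "pi = \<bar>q / p\<bar> *\<^sub>R L"
    using lborel_integral_real_affine[OF c, of "\<lambda>w. inverse (1 + w\<^sup>2)" 0] by (simp only: 2 L_def)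
  then have "L = pi * p / q" using assms by (simp add: field_simps)
  moreover have "(LINT w|lborel. 1 / (p\<^sup>2 + q\<^sup>2 * w\<^sup>2)) = 1 / p\<^sup>2 * L"
    unfolding eq L_def by (rule integral_mult_right_zero)
  moreover have "1 / p\<^sup>2 * (pi * p / q) = pi / (p * q)" using assms by (simp add: power2_eq_square)
  ultimately show "(LINT w|lborel. 1 / (p\<^sup>2 + q\<^sup>2 * w\<^sup>2)) = pi / (p * q)" by metis
qed

section \<open>Symmetries of E and B, and the orthogonality relation\<close>

context symmetric_hermite_biehler
begin

abbreviation B :: "complex \<Rightarrow> complex" where "B \<equiv> companion_B E"

lemma B_eq: "B z = \<i> / 2 * (E z - E (- z))"
  by (simp add: companion_B_def star_E)

lemma holB: "B holomorphic_on A"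
proof -
  have "(\<lambda>z. \<i> / 2 * (E z - E (- z))) holomorphic_on A"
    by (intro holomorphic_intros holE holomorphic_on_compose_gen[OF _ holE[of UNIV], unfolded o_def]) auto
  then show ?thesis by (simp add: B_eq[abs_def])
qed

lemma cnj_E: "cnj (E z) = E (- cnj z)"
  using star_E[of "cnj z"] by (simp add: star_def)

lemma E_minus_real: "E (- of_real x) = cnj (E (of_real x))"
  by (simp add: cnj_E)

lemma B_uminus: "B (- z) = - B z"
  by (simp add: B_eq algebra_simps)

lemma B_cnj: "B (cnj z) = cnj (B z)"
  by (simp add: B_eq cnj_E algebra_simps)

lemma B_0: "B 0 = 0"
  by (simp add: B_eq)

lemma B_nz: "Im z \<noteq> 0 \<Longrightarrow> B z \<noteq> 0"
  using E_uminus_less[of z] E_uminus_less[of "- z"] by (cases "Im z > 0") (auto simp: B_eq)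

lemma Im_E_real: "Im (E (of_real x)) = - Re (B (of_real x))"
  by (simp add: B_eq E_minus_real)

definition S :: "complex \<Rightarrow> complex" where
  "S z = (if z = 0 then deriv B 0 else B z / z)"

lemma B_S: "B z = z * S z"
  by (simp add: S_def B_0)

lemma holS: "S holomorphic_on A"
proof -
  have "(\<lambda>z. if z = 0 then deriv B 0 else (B z - B 0) / (z - 0)) holomorphic_on UNIV"
    by (rule pole_lemma[OF holB]) auto
  then have "S holomorphic_on UNIV" by (rule holomorphic_transform) (simp add: S_def B_0)
  then show ?thesis using holomorphic_on_subset by blast
qed

lemma contS: "continuous_on A S"
  by (rule holomorphic_on_imp_continuous_on[OF holS])

lemma S_uminus: "S (- z) = S z"
  by (simp add: S_def B_uminus)

lemma S_cnj: "S (cnj z) = cnj (S z)"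
proof (cases "z = 0")
  case True
  have *: "S (cnj w) = cnj (S w)" if "w \<noteq> 0" for w using that by (simp add: S_def B_cnj)
  have S0: "(S \<longlongrightarrow> S 0) (at 0)"
    using contS[of UNIV] by (simp add: continuous_on_eq_continuous_at isCont_def)
  have "((\<lambda>w. S (cnj w)) \<longlongrightarrow> S 0) (at 0)"
    using isCont_tendsto_compose[of 0 S cnj "at 0"] contS[of UNIV] tendsto_cnj[OF tendsto_ident_at[of 0 UNIV]]
    by (simp add: continuous_on_eq_continuous_at)
  moreover have "((\<lambda>w. S (cnj w)) \<longlongrightarrow> cnj (S 0)) (at 0)"
    using tendsto_cnj[OF S0] by (rule Lim_transform_eventually) (auto simp: * eventually_at_filter)
  ultimately have "S 0 = cnj (S 0)" by (rule LIM_unique)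
  then show ?thesis using True by simp
qed (simp add: S_def B_cnj)

lemma S_real: "S (of_real x) = of_real (Re (S (of_real x)))"
  using S_cnj[of "of_real x"] by (simp add: complex_eq_iff)

lemma S_imag: "S (\<i> * of_real y) = of_real (Re (S (\<i> * of_real y)))"
  using S_cnj[of "\<i> * of_real y"] S_uminus[of "\<i> * of_real y"] by (simp add: complex_eq_iff)

lemma Im_E_real_S: "Im (E (of_real x)) = - x * Re (S (of_real x))"
  by (simp add: Im_E_real B_S)

lemma cmod_E_real: "(cmod (E (of_real x)))\<^sup>2 = (Re (E (of_real x)))\<^sup>2 + x\<^sup>2 * (Re (S (of_real x)))\<^sup>2"
  by (simp add: cmod_power2 Im_E_real_S power_mult_distrib)

definition e0 :: real where "e0 = Re (E 0)"
definition b1 :: real where "b1 = Re (S 0)"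

lemma E_0: "E 0 = of_real e0" "e0 \<noteq> 0"
proof -
  show "E 0 = of_real e0" using cnj_E[of 0] by (simp add: complex_eq_iff e0_def)
  then show "e0 \<noteq> 0" using E_real_nz[of 0] by auto
qed

lemma S_0: "S 0 = of_real b1"
  using S_real[of 0] by (simp add: b1_def)

text \<open>The Harnack inequality for \<open>i A / B\<close>, which has positive real part, shows that the zero of \<open>B\<close>
  at the origin is simple.\<close>

lemma e0_b1_pos: "e0 * b1 > 0"
proof -
  \<comment> \<open>This is i A / B with A = (E + E~) / 2; its real part is positive because |E~| <
    |E|.\<close>
  define q where "q = (\<lambda>z. (E z + E (- z)) / (E z - E (- z)))"
  have dnz: "E z - E (- z) \<noteq> 0" if "Im z > 0" for z using E_uminus_less[OF that] by auto
  have holq: "q holomorphic_on upper_half_plane"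
    unfolding q_def using dnz
    by (intro holomorphic_intros holE holomorphic_on_compose_gen[OF _ holE[of UNIV], unfolded o_def]) auto
  have Req: "Re (q z) > 0" if "Im z > 0" for z
  proof -
    have "Re ((u + v) / (u - v)) = ((cmod u)\<^sup>2 - (cmod v)\<^sup>2) / (cmod (u - v))\<^sup>2" for u v :: complex
      unfolding Re_divide cmod_power2 by (simp add: power2_eq_square algebra_simps)
    moreover have "(cmod (E (- z)))\<^sup>2 < (cmod (E z))\<^sup>2"
      using E_uminus_less[OF that] by (intro power_strict_mono) auto
    ultimately show ?thesis using dnz[OF that] by (simp add: q_def)
  qed
  have real: "E (\<i> * of_real y) = of_real (Re (E (\<i> * of_real y)))" for y
    using cnj_E[of "\<i> * of_real y"] by (simp add: complex_eq_iff)
  define N where "N = (\<lambda>y. Re (E (\<i> * of_real y)) + Re (E (- (\<i> * of_real y))))"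
  define D where "D = (\<lambda>y. 2 * Re (S (\<i> * of_real y)))"
  have ED: "E (\<i> * of_real y) - E (- (\<i> * of_real y)) = of_real (y * D y)" for y
  proof -
    have "E z - E (- z) = - 2 * \<i> * B z" for z by (simp add: B_eq algebra_simps)
    then have "E (\<i> * of_real y) - E (- (\<i> * of_real y)) = 2 * of_real y * S (\<i> * of_real y)"
      by (simp add: B_S)
    then show ?thesis by (subst (asm) S_imag) (simp add: D_def)
  qed
  have EN: "E (\<i> * of_real y) + E (- (\<i> * of_real y)) = of_real (N y)" for y
    using real[of y] real[of "- y"] by (simp add: N_def)
  have qND: "Re (q (\<i> * of_real y)) = N y / (y * D y)" for y
    unfolding q_def EN ED by (simp flip: of_real_divide)
  define c where "c = Re (q \<i>)"
  \<comment> \<open>Harnack's inequality allows a blow-up of order 1/y only, whereas a multiple zero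
    of \<open>B\<close> at the origin would produce a higher order.\<close>
  have harnack: "N y / (y * D y) \<le> c * (y + 1)\<^sup>2 / y" "N y / (y * D y) > 0" if "y > 0" for y
  proof -
    have "Re (q (\<i> * of_real y)) \<le> Re (q \<i>) * (cmod (\<i> * of_real y) + cmod \<i>)\<^sup>2 / (Im (\<i> * of_real y) * Im \<i>)"
      by (rule Harnack_upper_half_plane[OF holq]) (use Req that in \<open>auto intro: less_imp_le\<close>)
    then show "N y / (y * D y) \<le> c * (y + 1)\<^sup>2 / y" using that unfolding qND by (simp add: c_def norm_mult)
    show "N y / (y * D y) > 0" using Req[of "\<i> * of_real y"] that unfolding qND by simp
  qed
  have ev: "N y * D y \<ge> 0" "\<bar>N y\<bar> \<le> c * (y + 1)\<^sup>2 * \<bar>D y\<bar>" if "y > 0" for y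
  proof -
    have D0: "D y \<noteq> 0" using harnack(2)[OF that] by auto
    have q: "N y / D y = y * (N y / (y * D y))" using that by simp
    have "y * (N y / (y * D y)) > 0" using harnack(2)[OF that] that by (rule mult_pos_pos[rotated])
    then have pos: "N y / D y > 0" by (simp only: q)
    have "y * (N y / (y * D y)) \<le> y * (c * (y + 1)\<^sup>2 / y)" using harnack(1)[OF that] that by (intro mult_left_mono) auto
    then have "N y / D y \<le> c * (y + 1)\<^sup>2" using that by (simp only: q) simp
    have "N y * D y = N y / D y * (D y)\<^sup>2" using D0 by (simp add: power2_eq_square)
    then show "N y * D y \<ge> 0" using pos by (simp only: mult_nonneg_nonneg less_imp_le zero_le_power2)
    note \<open>N y / D y \<le> c * (y + 1)\<^sup>2\<close>
    then have "\<bar>N y\<bar> / \<bar>D y\<bar> \<le> c * (y + 1)\<^sup>2" using pos by (simp flip: abs_divide)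
    then show "\<bar>N y\<bar> \<le> c * (y + 1)\<^sup>2 * \<bar>D y\<bar>" using D0 by (simp add: pos_divide_le_eq)
  qed
  have tE: "isCont E z" "isCont S z" for z
    using contE[of UNIV] contS[of UNIV] by (simp_all add: continuous_on_eq_continuous_at)
  have limN: "(N \<longlongrightarrow> 2 * e0) (at_right 0)"
  proof -
    have "(N \<longlongrightarrow> Re (E (\<i> * of_real 0)) + Re (E (- (\<i> * of_real 0)))) (at_right 0)"
      unfolding N_def by (intro tendsto_intros isCont_tendsto_compose[OF tE(1)])
    then show ?thesis by (simp add: e0_def)
  qed
  have limD: "(D \<longlongrightarrow> 2 * b1) (at_right 0)"
  proof -
    have "(D \<longlongrightarrow> 2 * Re (S (\<i> * of_real 0))) (at_right 0)"
      unfolding D_def by (intro tendsto_intros isCont_tendsto_compose[OF tE(2)])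
    then show ?thesis by (simp add: b1_def)
  qed
  have evr: "\<forall>\<^sub>F y::real in at_right 0. y > 0" by (simp add: eventually_at_right_less)
  have "0 \<le> (2 * e0) * (2 * b1)"
    by (rule tendsto_lowerbound[OF tendsto_mult[OF limN limD]]) (use evr ev(1) in \<open>auto elim: eventually_mono\<close>)
  \<comment> \<open>In the limit y -> 0 a vanishing \<open>b1\<close> would force E(0) = 0.\<close>
  moreover have "\<bar>2 * e0\<bar> \<le> c * (0 + 1)\<^sup>2 * \<bar>2 * b1\<bar>"
  proof (rule tendsto_le[OF _ _ tendsto_rabs[OF limN]])
    show "((\<lambda>y. c * (y + 1)\<^sup>2 * \<bar>D y\<bar>) \<longlongrightarrow> c * (0 + 1)\<^sup>2 * \<bar>2 * b1\<bar>) (at_right 0)"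
      by (intro tendsto_intros limD)
    show "\<forall>\<^sub>F y in at_right 0. \<bar>N y\<bar> \<le> c * (y + 1)\<^sup>2 * \<bar>D y\<bar>"
      using evr ev(2) by (auto elim: eventually_mono)
  qed auto
  ultimately show ?thesis using E_0(2) by (cases "b1 = 0") (auto simp: less_le mult.commute)
qed

text \<open>The growth conditions on \<open>F / E\<^sup>2\<close> under which it is orthogonal to the bounded analytic functions.\<close>

definition tame :: "(complex \<Rightarrow> complex) \<Rightarrow> bool" where
  "tame F \<longleftrightarrow> F holomorphic_on UNIV \<and>
     (\<exists>C>0. \<forall>z. Im z > 0 \<longrightarrow> cmod (F z / (E z)\<^sup>2) \<le> exp (C * (1 + cmod z)\<^sup>2 / Im z)) \<and>
     (\<forall>e>0. \<exists>Y. \<forall>y\<ge>Y. \<forall>t\<in>{0..1}. cmod (F (of_real t + \<i> * of_real y) / (E (of_real t + \<i> * of_real y))\<^sup>2) \<le> exp (e * y))"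

text \<open>On the closed half-plane |E~| <= |E|, so E - r E~ has modulus at least (1 - r) |E|: the
  quotient is analytic and inherits all bounds of F/E^2 up to the factor 1/(1 - r).\<close>

lemma tame_integral_zero:
  assumes F: "tame F" and int: "integrable lborel (\<lambda>x. F (of_real x) / of_real ((cmod (E (of_real x)))\<^sup>2))"
    and r: "0 \<le> r" "r < 1"
  defines "\<phi> \<equiv> \<lambda>z. F z / (E z * (E z - of_real r * E (- z)))"
  shows "integrable lborel (\<lambda>x::real. \<phi> (of_real x))" "(LINT x|lborel. \<phi> (of_real x)) = 0"
proof -
  have holF: "F holomorphic_on A" for A using F holomorphic_on_subset unfolding tame_def by blast
  have low: "cmod (E z - of_real r * E (- z)) \<ge> (1 - r) * cmod (E z)" if "0 \<le> Im z" for z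
  proof -
    have "cmod (E (- z)) \<le> cmod (E z)"
    proof (cases "Im z = 0")
      case True
      then have "z = of_real (Re z)" by (simp add: complex_eq_iff)
      then show ?thesis using E_minus_real[of "Re z"] by (metis complex_mod_cnj order_refl)
    next
      case False
      then show ?thesis using E_uminus_less[of z] that by simp
    qed
    then have "cmod (of_real r * E (- z)) \<le> r * cmod (E z)" using r by (simp add: norm_mult mult_left_mono)
    then show ?thesis using norm_triangle_ineq2[of "E z" "of_real r * E (- z)"] by (simp add: algebra_simps)
  qed
  have nz: "E z * (E z - of_real r * E (- z)) \<noteq> 0" if "0 \<le> Im z" for z
    using low[OF that] E_nz[OF that] r by (auto simp: mult_le_0_iff)
  have le: "cmod (\<phi> z) \<le> cmod (F z / (E z)\<^sup>2) / (1 - r)" if "0 \<le> Im z" for z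
  proof -
    have "cmod (\<phi> z) \<le> cmod (F z) / (cmod (E z) * ((1 - r) * cmod (E z)))"
      unfolding \<phi>_def norm_divide norm_mult
      using low[OF that] E_nz[OF that] r nz[OF that]
      by (intro divide_left_mono mult_left_mono mult_pos_pos) auto
    then show ?thesis by (simp add: norm_divide norm_mult power2_eq_square mult_ac)
  qed
  have contE': "continuous_on A (\<lambda>z. E (- z))" for A by (intro continuous_on_compose2[OF contE[of UNIV]] continuous_intros) auto
  have cont: "continuous_on {z. 0 \<le> Im z} \<phi>"
    unfolding \<phi>_def using nz by (intro continuous_intros contE contE' holomorphic_on_imp_continuous_on holF) auto
  have hol: "\<phi> holomorphic_on upper_half_plane"
    unfolding \<phi>_def using nz
    by (intro holomorphic_intros holE holF holomorphic_on_compose_gen[OF _ holE[of UNIV], unfolded o_def]) auto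
  show int\<phi>: "integrable lborel (\<lambda>x::real. \<phi> (of_real x))"
  proof (rule Bochner_Integration.integrable_bound)
    show "integrable lborel (\<lambda>x. cmod (F (of_real x) / of_real ((cmod (E (of_real x)))\<^sup>2)) / (1 - r))"
      by (intro integrable_divide integrable_norm int)
    have "continuous_on UNIV (\<lambda>x::real. \<phi> (of_real x))"
      by (rule continuous_on_compose2[OF cont]) (auto intro!: continuous_intros)
    then show "(\<lambda>x::real. \<phi> (of_real x)) \<in> borel_measurable lborel" by (simp add: borel_measurable_continuous_onI)
    show "AE x in lborel. norm (\<phi> (of_real x)) \<le> norm (cmod (F (of_real x) / of_real ((cmod (E (of_real x)))\<^sup>2)) / (1 - r))"
      using le r by (auto simp: norm_divide norm_power)
  qed
  obtain C where C: "C > 0" "\<And>z. Im z > 0 \<Longrightarrow> cmod (F z / (E z)\<^sup>2) \<le> exp (C * (1 + cmod z)\<^sup>2 / Im z)"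
    using F unfolding tame_def by blast
  define L where "L = - ln (1 - r)"
  have L: "L \<ge> 0" "1 / (1 - r) = exp L" using r by (auto simp: L_def exp_minus inverse_eq_divide)
  have le': "cmod (\<phi> z) \<le> cmod (F z / (E z)\<^sup>2) * exp L" if "0 \<le> Im z" for z
    using le[OF that] L(2) by (metis divide_inverse inverse_eq_divide)
  show "(LINT x|lborel. \<phi> (of_real x)) = 0"
  proof (rule half_plane_integral_zero[where \<phi> = \<phi>, OF cont hol int\<phi>])
    show "C + L > 0" using C L by simp
    show "cmod (\<phi> z) \<le> exp ((C + L) * (1 + cmod z)\<^sup>2 / Im z)" if z: "Im z > 0" for z
    proof -
      \<comment> \<open>The constant factor exp L can be absorbed into the exponent because (1 +
        |z|)^2 / Im z >= 1.\<close>
      have "Im z * 1 \<le> (1 + cmod z) * (1 + cmod z)" using abs_Im_le_cmod[of z] z by (intro mult_mono) auto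
      then have X: "(1 + cmod z)\<^sup>2 / Im z \<ge> 1" using z by (simp add: power2_eq_square)
      have "cmod (\<phi> z) \<le> exp (C * (1 + cmod z)\<^sup>2 / Im z) * exp L"
        using le'[of z] C(2)[OF z] z by (smt (verit) exp_gt_zero mult_right_mono)
      also have "\<dots> = exp (C * ((1 + cmod z)\<^sup>2 / Im z) + L * 1)" by (simp add: exp_add)
      also have "\<dots> \<le> exp (C * ((1 + cmod z)\<^sup>2 / Im z) + L * ((1 + cmod z)\<^sup>2 / Im z))"
        unfolding exp_le_cancel_iff using X L by (intro add_left_mono mult_left_mono) auto
      finally show ?thesis by (simp add: algebra_simps add_divide_distrib)
    qed
    show "\<exists>Y. \<forall>y\<ge>Y. \<forall>t\<in>{0..1}. cmod (\<phi> (of_real t + \<i> * of_real y)) \<le> exp (e * y)" if e: "e > 0" for e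
    proof -
      obtain Y where Y: "\<And>y t. y \<ge> Y \<Longrightarrow> t \<in> {0..1} \<Longrightarrow>
          cmod (F (of_real t + \<i> * of_real y) / (E (of_real t + \<i> * of_real y))\<^sup>2) \<le> exp (e / 2 * y)"
        using F e unfolding tame_def by (meson half_gt_zero)
      have "cmod (\<phi> (of_real t + \<i> * of_real y)) \<le> exp (e * y)" if y: "y \<ge> max (max Y 0) (2 * L / e)" and t: "t \<in> {0..1}" for y t
      proof -
        have "cmod (\<phi> (of_real t + \<i> * of_real y)) \<le> exp (e / 2 * y) * exp L"
          using Y[of y t] y t
          by (intro order_trans[OF le'] mult_right_mono) auto
        also have "\<dots> = exp (e / 2 * y + L)" by (simp add: exp_add)
        also have "\<dots> \<le> exp (e * y)" using y e by (simp add: field_simps)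
        finally show ?thesis .
      qed
      then show ?thesis by blast
    qed
  qed
qed

text \<open>Since \<open>F / (E (E - r E*))\<close> has integral zero, replacing \<open>\<bar>E\<bar>\<^sup>2\<close> by \<open>\<bar>E - r E*\<bar>\<^sup>2 / (1 - r\<^sup>2)\<close> does not change
  the integral of \<open>F / \<bar>E\<bar>\<^sup>2\<close>. Here \<open>s = (1 - r) / (1 + r)\<close>, and the variable is rescaled by \<open>s\<close>.\<close>

lemma rescaled_integral:
  assumes F: "tame F" and real: "\<And>x. F (of_real x) = of_real (f x)"
    and int: "integrable lborel (\<lambda>x. f x / (cmod (E (of_real x)))\<^sup>2)"
    and s: "0 < s" "s \<le> 1"
  shows "integrable lborel (\<lambda>w. f (s * w) / ((Re (E (of_real (s * w))))\<^sup>2 + w\<^sup>2 * (Re (S (of_real (s * w))))\<^sup>2))"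
    "(LINT w|lborel. f (s * w) / ((Re (E (of_real (s * w))))\<^sup>2 + w\<^sup>2 * (Re (S (of_real (s * w))))\<^sup>2)) =
     (LINT x|lborel. f x / (cmod (E (of_real x)))\<^sup>2)"
proof -
  define r where "r = (1 - s) / (1 + s)"
  have r: "0 \<le> r" "r < 1" using s by (auto simp: r_def)
  have s_r: "s = (1 - r) / (1 + r)" using s by (simp add: r_def field_simps)
  define \<phi> where "\<phi> = (\<lambda>z. F z / (E z * (E z - of_real r * E (- z))))"
  have "integrable lborel (\<lambda>x. complex_of_real (f x / (cmod (E (of_real x)))\<^sup>2))" using int by (rule integrable_of_real)
  then have int': "integrable lborel (\<lambda>x. F (of_real x) / of_real ((cmod (E (of_real x)))\<^sup>2))"
    by (simp add: real)
  have \<phi>: "integrable lborel (\<lambda>x::real. \<phi> (of_real x))" "(LINT x|lborel. \<phi> (of_real x)) = 0"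
    using tame_integral_zero[OF F int' r] unfolding \<phi>_def by auto
  \<comment> \<open>This is F (1 - r^2) / |E - r E~|^2, since on the real line E - r E~ = (1 - r) Re
    E + i (1 + r) Im E.\<close>
  define h where "h = (\<lambda>x. f x * s / (s\<^sup>2 * (Re (E (of_real x)))\<^sup>2 + (Im (E (of_real x)))\<^sup>2))"
  \<comment> \<open>The Poisson kernel identity (1 - r^2) / |1 - r u|^2 = 1 + 2 Re (r u / (1 - r u))
    for the unimodular u = E~/E, divided by |E|^2.\<close>
  have h_eq: "h x = f x / (cmod (E (of_real x)))\<^sup>2 + 2 * r * Re (\<phi> (of_real x))" for x
  proof -
    define a where "a = Re (E (of_real x))"
    define b where "b = Im (E (of_real x))"
    define c where "c = f x"
    have nz: "a\<^sup>2 + b\<^sup>2 \<noteq> 0" using E_real_nz[of x] by (auto simp: a_def b_def complex_eq_iff add_nonneg_eq_0_iff)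
    have nz2: "(1 - r)\<^sup>2 * a\<^sup>2 + (1 + r)\<^sup>2 * b\<^sup>2 \<noteq> 0"
      using nz r by (auto simp: add_nonneg_eq_0_iff)
    have u: "E (of_real x) = Complex a b" by (simp add: a_def b_def)
    have d: "E (of_real x) * (E (of_real x) - of_real r * E (- of_real x)) =
        Complex ((1 - r) * a\<^sup>2 - (1 + r) * b\<^sup>2) (2 * a * b)"
      unfolding E_minus_real u by (simp add: complex_eq_iff power2_eq_square algebra_simps)
    have dn: "((1 - r) * a\<^sup>2 - (1 + r) * b\<^sup>2)\<^sup>2 + (2 * a * b)\<^sup>2 = (a\<^sup>2 + b\<^sup>2) * ((1 - r)\<^sup>2 * a\<^sup>2 + (1 + r)\<^sup>2 * b\<^sup>2)"
      by (simp add: power2_eq_square algebra_simps)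
    have "Re (\<phi> (of_real x)) = c * ((1 - r) * a\<^sup>2 - (1 + r) * b\<^sup>2) / ((a\<^sup>2 + b\<^sup>2) * ((1 - r)\<^sup>2 * a\<^sup>2 + (1 + r)\<^sup>2 * b\<^sup>2))"
      unfolding \<phi>_def d real by (simp add: Re_divide dn c_def)
    then have "f x / (cmod (E (of_real x)))\<^sup>2 + 2 * r * Re (\<phi> (of_real x)) =
      c / (a\<^sup>2 + b\<^sup>2) + 2 * r * (c * ((1 - r) * a\<^sup>2 - (1 + r) * b\<^sup>2) / ((a\<^sup>2 + b\<^sup>2) * ((1 - r)\<^sup>2 * a\<^sup>2 + (1 + r)\<^sup>2 * b\<^sup>2)))"
      by (simp add: cmod_power2 a_def b_def c_def)
    also have "\<dots> = (c * ((1 - r)\<^sup>2 * a\<^sup>2 + (1 + r)\<^sup>2 * b\<^sup>2) + 2 * r * c * ((1 - r) * a\<^sup>2 - (1 + r) * b\<^sup>2)) /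
        ((a\<^sup>2 + b\<^sup>2) * ((1 - r)\<^sup>2 * a\<^sup>2 + (1 + r)\<^sup>2 * b\<^sup>2))"
      using nz nz2 by (simp add: add_divide_distrib)
    also have "c * ((1 - r)\<^sup>2 * a\<^sup>2 + (1 + r)\<^sup>2 * b\<^sup>2) + 2 * r * c * ((1 - r) * a\<^sup>2 - (1 + r) * b\<^sup>2) =
        (a\<^sup>2 + b\<^sup>2) * (c * (1 - r\<^sup>2))"
      by (simp add: power2_eq_square algebra_simps)
    also have "(a\<^sup>2 + b\<^sup>2) * (c * (1 - r\<^sup>2)) / ((a\<^sup>2 + b\<^sup>2) * ((1 - r)\<^sup>2 * a\<^sup>2 + (1 + r)\<^sup>2 * b\<^sup>2)) =
        c * (1 - r\<^sup>2) / ((1 - r)\<^sup>2 * a\<^sup>2 + (1 + r)\<^sup>2 * b\<^sup>2)" using nz by simp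
    also have "\<dots> = h x"
    proof -
      have r1: "(1 + r)\<^sup>2 \<noteq> 0" using r by simp
      have "h x = c * s / (s\<^sup>2 * a\<^sup>2 + b\<^sup>2)" by (simp add: h_def a_def b_def c_def)
      also have "\<dots> = ((1 + r)\<^sup>2 * (c * s)) / ((1 + r)\<^sup>2 * (s\<^sup>2 * a\<^sup>2 + b\<^sup>2))" using r1 by simp
      also have "(1 + r)\<^sup>2 * (c * s) = c * (1 - r\<^sup>2)" using r unfolding s_r by (simp add: field_simps power2_eq_square)
      also have "(1 + r)\<^sup>2 * (s\<^sup>2 * a\<^sup>2 + b\<^sup>2) = (1 - r)\<^sup>2 * a\<^sup>2 + (1 + r)\<^sup>2 * b\<^sup>2"
        using r1 unfolding s_r by (simp add: power_divide distrib_left)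
      finally show ?thesis by simp
    qed
    finally show ?thesis by simp
  qed
  have intRe: "integrable lborel (\<lambda>x. Re (\<phi> (of_real x)))" using \<phi>(1) by (rule integrable_Re)
  have inth: "integrable lborel h"
    unfolding h_eq[abs_def] by (intro Bochner_Integration.integrable_add integrable_mult_right int intRe)
  have "(LINT x|lborel. h x) = (LINT x|lborel. f x / (cmod (E (of_real x)))\<^sup>2) + 2 * r * (LINT x|lborel. Re (\<phi> (of_real x)))"
    unfolding h_eq using int intRe by simp
  also have "(LINT x|lborel. Re (\<phi> (of_real x))) = 0" using \<phi> by (simp add: integral_Re)
  finally have Ih: "(LINT x|lborel. h x) = (LINT x|lborel. f x / (cmod (E (of_real x)))\<^sup>2)" by simp
  \<comment> \<open>Since Im E(x) = -x S(x), at x = s w both squares in the denominator carry the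
    factor s^2, which cancels.\<close>
  have g_eq: "f (s * w) / ((Re (E (of_real (s * w))))\<^sup>2 + w\<^sup>2 * (Re (S (of_real (s * w))))\<^sup>2) = s * h (0 + s * w)" for w
  proof -
    define a where "a = (Re (E (of_real (s * w))))\<^sup>2"
    define b where "b = w\<^sup>2 * (Re (S (of_real (s * w))))\<^sup>2"
    have "(Im (E (of_real (s * w))))\<^sup>2 = s\<^sup>2 * b" by (simp add: Im_E_real_S b_def power_mult_distrib del: of_real_mult)
    then have "s * h (0 + s * w) = s\<^sup>2 * f (s * w) / (s\<^sup>2 * (a + b))"
      by (simp add: h_def a_def power2_eq_square algebra_simps del: of_real_mult)
    also have "\<dots> = f (s * w) / (a + b)" using s by simp
    finally show ?thesis by (simp add: a_def b_def)
  qed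
  show "integrable lborel (\<lambda>w. f (s * w) / ((Re (E (of_real (s * w))))\<^sup>2 + w\<^sup>2 * (Re (S (of_real (s * w))))\<^sup>2))"
    unfolding g_eq using s by (intro integrable_mult_right lborel_integrable_real_affine[OF inth]) auto
  have "(LINT x|lborel. h x) = \<bar>s\<bar> *\<^sub>R (LINT w|lborel. h (0 + s * w))"
    by (rule lborel_integral_real_affine) (use s in auto)
  then show "(LINT w|lborel. f (s * w) / ((Re (E (of_real (s * w))))\<^sup>2 + w\<^sup>2 * (Re (S (of_real (s * w))))\<^sup>2)) =
     (LINT x|lborel. f x / (cmod (E (of_real x)))\<^sup>2)"
    unfolding g_eq Ih[symmetric] using s by simp
qed

end

lemma strip_cmod_square_le:
  fixes t y :: real
  assumes "t \<in> {0..1}" "y \<ge> 1"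
  shows "(cmod (of_real t + \<i> * of_real y))\<^sup>2 / y \<le> 2 * y"
proof -
  have "(cmod (of_real t + \<i> * of_real y))\<^sup>2 = t\<^sup>2 + y\<^sup>2" by (simp add: cmod_power2)
  also have "\<dots> \<le> 1\<^sup>2 + y * y" using assms by (intro add_mono power_mono) (auto simp: power2_eq_square)
  also have "\<dots> \<le> 2 * y * y" using mult_mono[of 1 y 1 y] assms by simp
  finally show ?thesis using assms by (simp add: field_simps)
qed

section \<open>Algebra of the exponential type classes\<close>

lemma exp_type_class_entire: "F \<in> exp_type_class \<delta> \<Longrightarrow> F holomorphic_on A"
  using holomorphic_on_subset by (auto simp: exp_type_class_def entire_def)

lemma exp_type_class_mult:
  assumes "F \<in> exp_type_class \<delta>" "G \<in> exp_type_class \<delta>'"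
  shows "(\<lambda>z. F z * G z) \<in> exp_type_class (\<delta> + \<delta>')"
proof -
  have "\<exists>C>0. \<forall>z. cmod (F z * G z) \<le> C * exp ((\<delta> + \<delta>' + \<epsilon>) * cmod z)" if \<epsilon>: "\<epsilon> > 0" for \<epsilon>
  proof -
    have "\<epsilon> / 2 > 0" using \<epsilon> by simp
    then obtain C D where C: "C > 0" "\<And>z. cmod (F z) \<le> C * exp ((\<delta> + \<epsilon> / 2) * cmod z)"
      and D: "D > 0" "\<And>z. cmod (G z) \<le> D * exp ((\<delta>' + \<epsilon> / 2) * cmod z)"
      using assms unfolding exp_type_class_def by blast
    have "cmod (F z * G z) \<le> C * D * exp ((\<delta> + \<delta>' + \<epsilon>) * cmod z)" for z
    proof -
      have "cmod (F z * G z) \<le> (C * exp ((\<delta> + \<epsilon> / 2) * cmod z)) * (D * exp ((\<delta>' + \<epsilon> / 2) * cmod z))"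
        unfolding norm_mult by (intro mult_mono C D) (use C in auto)
      also have "\<dots> = C * D * (exp ((\<delta> + \<epsilon> / 2) * cmod z) * exp ((\<delta>' + \<epsilon> / 2) * cmod z))" by simp
      also have "\<dots> = C * D * exp ((\<delta> + \<delta>' + \<epsilon>) * cmod z)"
        unfolding exp_add[symmetric] by (simp add: algebra_simps)
      finally show ?thesis .
    qed
    then show ?thesis using C D by (meson mult_pos_pos)
  qed
  then show ?thesis using assms exp_type_class_entire[of F \<delta> UNIV] exp_type_class_entire[of G \<delta>' UNIV]
    by (auto simp: exp_type_class_def entire_def intro!: holomorphic_intros)
qed

lemma exp_type_class_add:
  assumes "F \<in> exp_type_class \<delta>" "G \<in> exp_type_class \<delta>"
  shows "(\<lambda>z. F z + G z) \<in> exp_type_class \<delta>"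
proof -
  have "\<exists>C>0. \<forall>z. cmod (F z + G z) \<le> C * exp ((\<delta> + \<epsilon>) * cmod z)" if \<epsilon>: "\<epsilon> > 0" for \<epsilon>
  proof -
    obtain C D where C: "C > 0" "\<And>z. cmod (F z) \<le> C * exp ((\<delta> + \<epsilon>) * cmod z)"
      and D: "D > 0" "\<And>z. cmod (G z) \<le> D * exp ((\<delta> + \<epsilon>) * cmod z)"
      using assms \<epsilon> unfolding exp_type_class_def by blast
    have "cmod (F z + G z) \<le> (C + D) * exp ((\<delta> + \<epsilon>) * cmod z)" for z
      using norm_triangle_ineq[of "F z" "G z"] C(2)[of z] D(2)[of z] unfolding distrib_right by linarith
    then show ?thesis using C D by (meson add_pos_pos)
  qed
  then show ?thesis using assms exp_type_class_entire[of F \<delta> UNIV] exp_type_class_entire[of G \<delta> UNIV]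
    by (auto simp: exp_type_class_def entire_def intro!: holomorphic_intros)
qed

lemma exp_type_class_const:
  assumes "\<delta> \<ge> 0"
  shows "(\<lambda>z. c) \<in> exp_type_class \<delta>"
proof -
  have "\<exists>C>0. \<forall>z. cmod c \<le> C * exp ((\<delta> + \<epsilon>) * cmod z)" if "\<epsilon> > 0" for \<epsilon>
  proof -
    have "cmod c \<le> (cmod c + 1) * exp ((\<delta> + \<epsilon>) * cmod z)" for z
    proof -
      have "(cmod c + 1) * 1 \<le> (cmod c + 1) * exp ((\<delta> + \<epsilon>) * cmod z)"
        using that assms by (intro mult_left_mono) auto
      then show ?thesis by simp
    qed
    then show ?thesis by (metis add_nonneg_pos norm_ge_zero zero_less_one)
  qed
  then show ?thesis by (auto simp: exp_type_class_def entire_def)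
qed

lemma exp_type_class_cmult:
  assumes "F \<in> exp_type_class \<delta>"
  shows "(\<lambda>z. c * F z) \<in> exp_type_class \<delta>"
  using exp_type_class_mult[OF exp_type_class_const[of 0 c] assms] by simp

lemma exp_type_class_diff:
  assumes "F \<in> exp_type_class \<delta>" "G \<in> exp_type_class \<delta>"
  shows "(\<lambda>z. F z - G z) \<in> exp_type_class \<delta>"
  using exp_type_class_add[OF assms(1) exp_type_class_cmult[OF assms(2), of "-1"]] by simp

text \<open>For quotients by polynomials: these are dominated away from the zeros of the divisor,
  and the remaining disc is compact.\<close>

lemma exp_type_class_dominated:
  assumes F: "F \<in> exp_type_class \<delta>" and \<delta>: "\<delta> \<ge> 0" and holG: "G holomorphic_on UNIV"
    and le: "\<And>z. R \<le> cmod z \<Longrightarrow> cmod (G z) \<le> cmod (F z)"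
  shows "G \<in> exp_type_class \<delta>"
proof -
  have "bounded (G ` cball 0 R)"
    by (intro compact_imp_bounded compact_continuous_image continuous_on_subset[OF holomorphic_on_imp_continuous_on[OF holG]]) auto
  then obtain b where b: "b > 0" "\<And>z. cmod z \<le> R \<Longrightarrow> cmod (G z) \<le> b" by (auto simp: bounded_pos)
  have "\<exists>C>0. \<forall>z. cmod (G z) \<le> C * exp ((\<delta> + \<epsilon>) * cmod z)" if \<epsilon>: "\<epsilon> > 0" for \<epsilon>
  proof -
    obtain C where C: "C > 0" "\<And>z. cmod (F z) \<le> C * exp ((\<delta> + \<epsilon>) * cmod z)"
      using F \<epsilon> unfolding exp_type_class_def by blast
    have "cmod (G z) \<le> (C + b) * exp ((\<delta> + \<epsilon>) * cmod z)" for z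
    proof (cases "R \<le> cmod z")
      case True
      have "b * exp ((\<delta> + \<epsilon>) * cmod z) \<ge> 0" using b by simp
      then show ?thesis using le[OF True] C(2)[of z] unfolding distrib_right by linarith
    next
      case False
      have "b * 1 \<le> b * exp ((\<delta> + \<epsilon>) * cmod z)" using b \<delta> \<epsilon> by (intro mult_left_mono) auto
      moreover have "C * exp ((\<delta> + \<epsilon>) * cmod z) \<ge> 0" using C by simp
      ultimately show ?thesis using b(2)[of z] False unfolding distrib_right by linarith
    qed
    then show ?thesis using C b by (meson add_pos_pos)
  qed
  then show ?thesis using holG by (auto simp: exp_type_class_def entire_def)
qed

section \<open>Functions satisfying the growth conditions relative to E^2\<close>

context symmetric_hermite_biehler
begin

lemma B_exp_type: "B \<in> exp_type_class \<tau>"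
proof -
  have "(\<lambda>z. E (- z)) \<in> exp_type_class \<tau>"
  proof -
    have "(\<lambda>z. E (- z)) holomorphic_on UNIV"
      by (intro holomorphic_on_compose_gen[OF _ holE[of UNIV], unfolded o_def] holomorphic_intros) auto
    moreover have "\<exists>C>0. \<forall>z. cmod (E (- z)) \<le> C * exp ((\<tau> + e) * cmod z)" if "e > 0" for e
    proof -
      have "\<exists>C>0. \<forall>z. cmod (E z) \<le> C * exp ((\<tau> + e) * cmod z)"
        using E_exp_type that by (simp add: exp_type_class_def)
      then obtain C where C: "C > 0" "\<forall>z. cmod (E z) \<le> C * exp ((\<tau> + e) * cmod z)" by blast
      have "cmod (E (- z)) \<le> C * exp ((\<tau> + e) * cmod z)" for z using C(2)[rule_format, of "- z"] by simp
      then show ?thesis using C(1) by blast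
    qed
    ultimately show ?thesis unfolding exp_type_class_def entire_def by simp
  qed
  from exp_type_class_cmult[OF exp_type_class_diff[OF E_exp_type this], of "\<i> / 2"]
  show ?thesis by (simp add: B_eq[abs_def])
qed

lemma S_exp_type: "S \<in> exp_type_class \<tau>"
proof (rule exp_type_class_dominated[OF B_exp_type tau_nonneg holS, of 1])
  fix z assume z: "1 \<le> cmod z"
  have "1 * cmod (S z) \<le> cmod z * cmod (S z)" using z by (intro mult_right_mono) auto
  then show "cmod (S z) \<le> cmod (B z)" by (simp add: B_S norm_mult)
qed

lemma S2_exp_type: "(\<lambda>z. (S z)\<^sup>2) \<in> exp_type_class (2 * \<tau>)"
  using exp_type_class_mult[OF S_exp_type S_exp_type] by (simp add: power2_eq_square)

lemma inverse_E_growth: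
  obtains C where "C > 0" "\<And>z. Im z > 0 \<Longrightarrow> cmod (inverse (E z)) \<le> exp (C * (1 + cmod z)\<^sup>2 / Im z)"
  using bounded_type_growth[OF bounded_type_inverse[OF btE]] E_nz by (metis less_imp_le)

text \<open>On a vertical strip the asymptotics of \<open>E\<close> give |E|^2 >= exp((2 \<tau> -
  o(1)) y), which offsets the type \<open>2 * \<tau>\<close> of \<open>F\<close>; the bound near the
  real axis comes from the bounded type of 1/E.\<close>

lemma tame_exp_type:
  assumes F: "F \<in> exp_type_class (2 * \<tau>)"
  shows "tame F"
  unfolding tame_def
proof (intro conjI allI impI)
  show "F holomorphic_on UNIV" using exp_type_class_entire[OF F] .
  obtain D where D: "D > 0" "\<And>z. Im z > 0 \<Longrightarrow> cmod (inverse (E z)) \<le> exp (D * (1 + cmod z)\<^sup>2 / Im z)"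
    using inverse_E_growth by blast
  obtain C where C: "C > 0" "\<And>z. cmod (F z) \<le> C * exp ((2 * \<tau> + 1) * cmod z)"
    using F zero_less_one unfolding exp_type_class_def by blast
  show "\<exists>C>0. \<forall>z. Im z > 0 \<longrightarrow> cmod (F z / (E z)\<^sup>2) \<le> exp (C * (1 + cmod z)\<^sup>2 / Im z)"
  proof (intro exI[of _ "\<bar>ln C\<bar> + (2 * \<tau> + 1) + 2 * D"] conjI allI impI)
    show "\<bar>ln C\<bar> + (2 * \<tau> + 1) + 2 * D > 0" using D tau_nonneg by simp
    fix z assume z: "Im z > 0"
    define X where "X = (1 + cmod z)\<^sup>2 / Im z"
    have "Im z * (1 + cmod z) \<le> (1 + cmod z) * (1 + cmod z)" using abs_Im_le_cmod[of z] z by (intro mult_right_mono) auto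
    then have X: "X \<ge> 1 + cmod z" using z by (simp add: X_def power2_eq_square field_simps)
    have "cmod (F z / (E z)\<^sup>2) = cmod (F z) * (cmod (inverse (E z)))\<^sup>2"
      by (simp add: divide_inverse norm_mult norm_power norm_inverse power_inverse)
    also have "\<dots> \<le> (C * exp ((2 * \<tau> + 1) * cmod z)) * (exp (D * X))\<^sup>2"
      using C(2)[of z] D(2)[OF z] C(1) unfolding X_def by (intro mult_mono power_mono) auto
    also have "\<dots> = exp (ln C + (2 * \<tau> + 1) * cmod z + 2 * (D * X))"
      using C(1) by (simp add: exp_add power2_eq_square flip: exp_add)
        (simp add: exp_add)
    also have "\<dots> \<le> exp (\<bar>ln C\<bar> * X + (2 * \<tau> + 1) * X + 2 * D * X)"
    proof -
      have "ln C \<le> \<bar>ln C\<bar> * 1" by simp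
      also have "\<dots> \<le> \<bar>ln C\<bar> * X" using X norm_ge_zero[of z] by (intro mult_left_mono) linarith+
      finally have 1: "ln C \<le> \<bar>ln C\<bar> * X" .
      have "(2 * \<tau> + 1) * cmod z \<le> (2 * \<tau> + 1) * X" using X tau_nonneg by (intro mult_left_mono) auto
      then show ?thesis using 1 by simp
    qed
    also have "\<bar>ln C\<bar> * X + (2 * \<tau> + 1) * X + 2 * D * X = (\<bar>ln C\<bar> + (2 * \<tau> + 1) + 2 * D) * (1 + cmod z)\<^sup>2 / Im z"
      by (simp add: X_def algebra_simps add_divide_distrib)
    finally show "cmod (F z / (E z)\<^sup>2) \<le> exp ((\<bar>ln C\<bar> + (2 * \<tau> + 1) + 2 * D) * (1 + cmod z)\<^sup>2 / Im z)" .
  qed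
  fix e :: real assume e: "e > 0"
  \<comment> \<open>The exponent becomes ln C + 2 \<tau> + d + 5 d y, and the choice of
    \<open>Y\<close> makes the constant terms at most 5 d y.\<close>
  define d where "d = e / 10"
  have d: "d > 0" "e = 10 * d" using e by (auto simp: d_def)
  obtain C where C: "C > 0" "\<And>z. cmod (F z) \<le> C * exp ((2 * \<tau> + d) * cmod z)"
    using F d(1) unfolding exp_type_class_def by blast
  obtain R where R: "R > 0" "\<And>z. Im z > 0 \<Longrightarrow> R \<le> cmod z \<Longrightarrow>
      exp (\<tau> * Im z - d * (cmod z)\<^sup>2 / Im z) \<le> cmod (E z) \<and>
      cmod (E z) \<le> exp (\<tau> * Im z + d * (cmod z)\<^sup>2 / Im z)"
    using zero_free_mean_type_asymp[OF btE _ mtE d(1)] E_nz by (metis less_imp_le)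
  define Y where "Y = max (max 1 R) ((ln C + 2 * \<tau> + d) / (5 * d))"
  show "\<exists>Y. \<forall>y\<ge>Y. \<forall>t\<in>{0..1}. cmod (F (of_real t + \<i> * of_real y) / (E (of_real t + \<i> * of_real y))\<^sup>2) \<le> exp (e * y)"
  proof (intro exI[of _ Y] allI impI ballI)
    fix y t :: real assume y: "y \<ge> Y" and t: "t \<in> {0..1}"
    have y1: "y \<ge> 1" "y \<ge> R" "ln C + 2 * \<tau> + d \<le> 5 * d * y" using y d by (auto simp: Y_def field_simps)
    define z where "z = of_real t + \<i> * of_real y"
    have Imz: "Im z = y" by (simp add: z_def)
    have z1: "cmod z \<le> 1 + y" using cmod_le[of z] t y1 by (simp add: z_def)
    have z2: "(cmod z)\<^sup>2 / y \<le> 2 * y" unfolding z_def using t y1(1) by (rule strip_cmod_square_le)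
    have "R \<le> cmod z" using y1 abs_Im_le_cmod[of z] Imz by simp
    then have "exp (\<tau> * y - d * (cmod z)\<^sup>2 / y) \<le> cmod (E z)" using R(2)[of z] Imz y1 by simp
    moreover have "exp (\<tau> * y - d * (2 * y)) \<le> exp (\<tau> * y - d * (cmod z)\<^sup>2 / y)"
      using mult_left_mono[OF z2, of d] d by simp
    ultimately have E1: "exp (\<tau> * y - d * (2 * y)) \<le> cmod (E z)" by linarith
    have "cmod (F z) \<le> C * exp ((2 * \<tau> + d) * (1 + y))"
      using C(2)[of z] z1 C(1) d tau_nonneg by (smt (verit) exp_le_cancel_iff mult_left_mono)
    then have "cmod (F z / (E z)\<^sup>2) \<le> C * exp ((2 * \<tau> + d) * (1 + y)) / (exp (\<tau> * y - d * (2 * y)))\<^sup>2"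
      unfolding norm_divide norm_power using E1 C(1) by (intro frac_le power_mono) auto
    also have "\<dots> = exp (ln C + (2 * \<tau> + d) * (1 + y) - 2 * (\<tau> * y - d * (2 * y)))"
      by (simp only: exp_diff exp_add exp_double exp_ln[OF C(1)])
    also have "\<dots> \<le> exp (e * y)"
      unfolding exp_le_cancel_iff using y1(3) by (simp add: d(2) algebra_simps)
    finally show "cmod (F (of_real t + \<i> * of_real y) / (E (of_real t + \<i> * of_real y))\<^sup>2) \<le> exp (e * y)"
      by (simp add: z_def)
  qed
qed

text \<open>Membership in H(E) gives G/E and G~/E nonpositive mean type, so their product is
  exp(o(y)) on the strip. On the real line G G~ is |G|^2, which links the norm of an element to its
  value at 0.\<close>

lemma tame_mult_star:
  assumes G: "G \<in> de_Branges E"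
  shows "tame (\<lambda>z. G z * star G z)"
  unfolding tame_def
proof (intro conjI allI impI)
  have holG: "G holomorphic_on UNIV" using G by (simp add: de_Branges_def entire_def)
  show "(\<lambda>z. G z * star G z) holomorphic_on UNIV" by (intro holomorphic_intros holG holomorphic_star)
  have bt: "bounded_type (\<lambda>z. G z / E z)" "bounded_type (\<lambda>z. star G z / E z)"
    and mt: "mean_type (\<lambda>z. G z / E z) \<le> ereal 0" "mean_type (\<lambda>z. star G z / E z) \<le> ereal 0"
    using G by (auto simp: de_Branges_def zero_ereal_def)
  have eq: "cmod (G z * star G z / (E z)\<^sup>2) = cmod (G z / E z) * cmod (star G z / E z)" for z
    by (simp add: norm_divide norm_mult power2_eq_square)
  obtain C D where C: "C > 0" "\<And>z. Im z > 0 \<Longrightarrow> cmod (G z / E z) \<le> exp (C * (1 + cmod z)\<^sup>2 / Im z)"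
    and D: "D > 0" "\<And>z. Im z > 0 \<Longrightarrow> cmod (star G z / E z) \<le> exp (D * (1 + cmod z)\<^sup>2 / Im z)"
    using bounded_type_growth[OF bt(1)] bounded_type_growth[OF bt(2)] by metis
  show "\<exists>C>0. \<forall>z. Im z > 0 \<longrightarrow> cmod (G z * star G z / (E z)\<^sup>2) \<le> exp (C * (1 + cmod z)\<^sup>2 / Im z)"
  proof (intro exI[of _ "C + D"] conjI allI impI)
    fix z assume z: "Im z > 0"
    have "cmod (G z * star G z / (E z)\<^sup>2) \<le> exp (C * (1 + cmod z)\<^sup>2 / Im z) * exp (D * (1 + cmod z)\<^sup>2 / Im z)"
      unfolding eq using C(2)[OF z] D(2)[OF z] by (intro mult_mono) auto
    then show "cmod (G z * star G z / (E z)\<^sup>2) \<le> exp ((C + D) * (1 + cmod z)\<^sup>2 / Im z)"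
      by (simp add: exp_add[symmetric] distrib_right add_divide_distrib)
  qed (use C D in auto)
  fix e :: real assume e: "e > 0"
  then have e4: "e / 4 > 0" by simp
  obtain R1 R2 where R1: "\<And>z. Im z > 0 \<Longrightarrow> R1 \<le> cmod z \<Longrightarrow> cmod (G z / E z) \<le> exp (0 * Im z + e / 4 * (cmod z)\<^sup>2 / Im z)"
    and R2: "\<And>z. Im z > 0 \<Longrightarrow> R2 \<le> cmod z \<Longrightarrow> cmod (star G z / E z) \<le> exp (0 * Im z + e / 4 * (cmod z)\<^sup>2 / Im z)"
    using mean_type_le_imp_bound[OF bt(1) mt(1) e4] mean_type_le_imp_bound[OF bt(2) mt(2) e4] by metis
  show "\<exists>Y. \<forall>y\<ge>Y. \<forall>t\<in>{0..1}. cmod (G (of_real t + \<i> * of_real y) * star G (of_real t + \<i> * of_real y) /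
      (E (of_real t + \<i> * of_real y))\<^sup>2) \<le> exp (e * y)"
  proof (intro exI[of _ "max 1 (max R1 R2)"] allI impI ballI)
    fix y t :: real assume y: "y \<ge> max 1 (max R1 R2)" and t: "t \<in> {0..1}"
    define z where "z = of_real t + \<i> * of_real y"
    have Imz: "Im z = y" by (simp add: z_def)
    have y1: "y \<ge> 1" using y by simp
    have z2: "(cmod z)\<^sup>2 / y \<le> 2 * y" unfolding z_def using t y1 by (rule strip_cmod_square_le)
    have cz: "y \<le> cmod z" using abs_Im_le_cmod[of z] Imz by simp
    have "cmod (G z * star G z / (E z)\<^sup>2) \<le> exp (e / 4 * (cmod z)\<^sup>2 / y) * exp (e / 4 * (cmod z)\<^sup>2 / y)"
      unfolding eq using R1[of z] R2[of z] Imz y cz by (intro mult_mono) auto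
    also have "\<dots> = exp (e / 2 * ((cmod z)\<^sup>2 / y))" by (simp flip: exp_add)
    also have "\<dots> \<le> exp (e / 2 * (2 * y))" unfolding exp_le_cancel_iff using z2 e by (intro mult_left_mono) auto
    finally show "cmod (G (of_real t + \<i> * of_real y) * star G (of_real t + \<i> * of_real y) /
      (E (of_real t + \<i> * of_real y))\<^sup>2) \<le> exp (e * y)" by (simp add: z_def)
  qed
qed

section \<open>Evaluation at the origin as a limit of integrals\<close>

lemma rescaled_limit:
  assumes "F holomorphic_on UNIV" "\<And>x. F (of_real x) = of_real (f x)"
  shows "(\<lambda>n. f (inverse (real (Suc n)) * w) / ((Re (E (of_real (inverse (real (Suc n)) * w))))\<^sup>2
      + w\<^sup>2 * (Re (S (of_real (inverse (real (Suc n)) * w))))\<^sup>2)) \<longlonglongrightarrow> f 0 * (1 / (e0\<^sup>2 + b1\<^sup>2 * w\<^sup>2))"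
proof -
  have s: "(\<lambda>n. inverse (real (Suc n)) * w) \<longlonglongrightarrow> 0 * w"
    by (intro tendsto_mult LIMSEQ_inverse_real_of_nat tendsto_const)
  have c: "(\<lambda>n. G (of_real (inverse (real (Suc n)) * w))) \<longlonglongrightarrow> G 0" if "continuous_on UNIV G" for G :: "complex \<Rightarrow> complex"
  proof -
    have "continuous_on UNIV (\<lambda>x::real. G (of_real x))"
      by (rule continuous_on_compose2[OF that]) (auto intro!: continuous_intros)
    then have "isCont (\<lambda>x::real. G (of_real x)) 0" by (simp add: continuous_on_eq_continuous_at)
    from isCont_tendsto_compose[OF this, of "\<lambda>n. inverse (real (Suc n)) * w"] s show ?thesis by simp
  qed
  have f: "(\<lambda>n. Re (F (of_real (inverse (real (Suc n)) * w)))) \<longlonglongrightarrow> Re (F 0)"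
    by (intro tendsto_Re c holomorphic_on_imp_continuous_on assms(1))
  have F0: "Re (F 0) = f 0" using assms(2)[of 0] by simp
  have "e0\<^sup>2 + w\<^sup>2 * b1\<^sup>2 \<noteq> 0" using E_0(2) by (auto simp: add_nonneg_eq_0_iff)
  then have "(\<lambda>n. Re (F (of_real (inverse (real (Suc n)) * w))) / ((Re (E (of_real (inverse (real (Suc n)) * w))))\<^sup>2
      + w\<^sup>2 * (Re (S (of_real (inverse (real (Suc n)) * w))))\<^sup>2)) \<longlonglongrightarrow> Re (F 0) / ((Re (E 0))\<^sup>2 + w\<^sup>2 * (Re (S 0))\<^sup>2)"
    by (intro tendsto_divide tendsto_add tendsto_mult tendsto_power tendsto_Re tendsto_const f c contE contS)
      (auto simp: e0_def b1_def)
  then show ?thesis unfolding assms(2) F0 by (simp add: e0_def b1_def mult.commute)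
qed

lemma integral_inverse_limit:
  "integrable lborel (\<lambda>w::real. 1 / (e0\<^sup>2 + b1\<^sup>2 * w\<^sup>2))"
  "(LINT w|lborel. 1 / (e0\<^sup>2 + b1\<^sup>2 * w\<^sup>2)) = pi / (e0 * b1)"
proof -
  have "\<bar>e0\<bar> > 0" "\<bar>b1\<bar> > 0" "\<bar>e0\<bar> * \<bar>b1\<bar> = e0 * b1" using e0_b1_pos by (auto simp flip: abs_mult)
  then show "integrable lborel (\<lambda>w::real. 1 / (e0\<^sup>2 + b1\<^sup>2 * w\<^sup>2))"
    "(LINT w|lborel. 1 / (e0\<^sup>2 + b1\<^sup>2 * w\<^sup>2)) = pi / (e0 * b1)"
    using integrable_inverse_quadratic[of "\<bar>e0\<bar>" "\<bar>b1\<bar>"] by auto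
qed

text \<open>All rescaled integrals have the same value, while their integrands converge to f(0)
  times a Lorentz profile of mass pi / (e0 b1). Fatou's lemma may lose the mass sitting at the other
  zeros of \<open>B\<close>, hence only an inequality.\<close>

lemma value_at_0_le:
  assumes F: "tame F" and real: "\<And>x. F (of_real x) = of_real (f x)" and nonneg: "\<And>x. f x \<ge> 0"
    and int: "integrable lborel (\<lambda>x. f x / (cmod (E (of_real x)))\<^sup>2)"
  shows "f 0 * pi / (e0 * b1) \<le> (LINT x|lborel. f x / (cmod (E (of_real x)))\<^sup>2)"
proof -
  define I where "I = (LINT x|lborel. f x / (cmod (E (of_real x)))\<^sup>2)"
  define g where "g = (\<lambda>n w. f (inverse (real (Suc n)) * w) / ((Re (E (of_real (inverse (real (Suc n)) * w))))\<^sup>2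
      + w\<^sup>2 * (Re (S (of_real (inverse (real (Suc n)) * w))))\<^sup>2))"
  have g: "integrable lborel (g n)" "(LINT w|lborel. g n w) = I" for n
    using rescaled_integral[OF F real int, of "inverse (real (Suc n))"]
    unfolding g_def I_def by (auto simp: inverse_le_1_iff)
  have g0: "g n w \<ge> 0" for n w unfolding g_def using nonneg by (intro divide_nonneg_nonneg) auto
  have hol: "F holomorphic_on UNIV" using F by (simp add: tame_def)
  have I0: "I \<ge> 0" unfolding I_def using nonneg by (intro integral_nonneg_AE) auto
  have "ennreal (f 0 * (pi / (e0 * b1))) = (\<integral>\<^sup>+ w. ennreal (f 0 * (1 / (e0\<^sup>2 + b1\<^sup>2 * w\<^sup>2))) \<partial>lborel)"
  proof -
    have "f 0 * (1 / (e0\<^sup>2 + b1\<^sup>2 * w\<^sup>2)) \<ge> 0" for w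
      using nonneg[of 0] by (intro mult_nonneg_nonneg divide_nonneg_nonneg) auto
    then show ?thesis
      by (subst nn_integral_eq_integral[OF integrable_mult_right[OF integral_inverse_limit(1)]])
        (simp_all only: integral_mult_right_zero integral_inverse_limit(2) AE_I2)
  qed
  also have "\<dots> = (\<integral>\<^sup>+ w. liminf (\<lambda>n. ennreal (g n w)) \<partial>lborel)"
  proof (rule nn_integral_cong)
    fix w
    have "(\<lambda>n. ennreal (g n w)) \<longlonglongrightarrow> ennreal (f 0 * (1 / (e0\<^sup>2 + b1\<^sup>2 * w\<^sup>2)))"
      using rescaled_limit[OF hol real] unfolding g_def by (rule tendsto_ennrealI)
    then show "ennreal (f 0 * (1 / (e0\<^sup>2 + b1\<^sup>2 * w\<^sup>2))) = liminf (\<lambda>n. ennreal (g n w))"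
      by (intro lim_imp_Liminf[symmetric]) auto
  qed
  also have "\<dots> \<le> liminf (\<lambda>n. \<integral>\<^sup>+ w. ennreal (g n w) \<partial>lborel)"
    by (rule nn_integral_liminf) (use g(1) in measurable)
  also have "(\<lambda>n. \<integral>\<^sup>+ w. ennreal (g n w) \<partial>lborel) = (\<lambda>n. ennreal I)"
    using g g0 by (auto simp: nn_integral_eq_integral fun_eq_iff)
  also have "liminf (\<lambda>n::nat. ennreal I) = ennreal I" by (rule Liminf_const) auto
  finally show ?thesis using I0 by (simp add: I_def)
qed

definition s :: "real \<Rightarrow> real" where "s x = Re (S (of_real x))"

lemma S_of_real: "S (of_real x) = of_real (s x)"
  using S_real[of x] by (simp add: s_def)

text \<open>For |x| > 1 this follows from x^2 s(x)^2 <= |E(x)|^2, on [-1, 1] from compactness. The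
  second bound serves the rescaled integrands for |w| <= 1.\<close>

lemma s_bound:
  "\<exists>M>0. (\<forall>x. (s x)\<^sup>2 / (cmod (E (of_real x)))\<^sup>2 \<le> M / (1 + x\<^sup>2)) \<and>
    (\<forall>x. \<bar>x\<bar> \<le> 1 \<longrightarrow> (s x)\<^sup>2 / (cmod (E (of_real x)))\<^sup>2 \<le> M)"
proof -
  have "continuous_on {-1..1} (\<lambda>x::real. (s x)\<^sup>2 / (cmod (E (of_real x)))\<^sup>2)"
    unfolding s_def using E_real_nz
    by (intro continuous_intros continuous_on_compose2[OF contE[of UNIV]] continuous_on_compose2[OF contS[of UNIV]]) auto
  then have "bounded ((\<lambda>x::real. (s x)\<^sup>2 / (cmod (E (of_real x)))\<^sup>2) ` {-1..1})"
    by (intro compact_imp_bounded compact_continuous_image) auto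
  then obtain b where b: "b > 0" "\<And>x. x \<in> {-1..1} \<Longrightarrow> \<bar>(s x)\<^sup>2 / (cmod (E (of_real x)))\<^sup>2\<bar> \<le> b" unfolding bounded_pos by auto
  define M where "M = 2 * (b + 1)"
  have 1: "(s x)\<^sup>2 / (cmod (E (of_real x)))\<^sup>2 \<le> M" if "\<bar>x\<bar> \<le> 1" for x
  proof -
    have "x \<in> {-1..1}" using that by (auto simp: abs_le_iff)
    have "(s x)\<^sup>2 / (cmod (E (of_real x)))\<^sup>2 \<le> b" using b(2)[OF \<open>x \<in> {-1..1}\<close>] by (rule abs_le_D1)
    also have "b \<le> M" using b(1) by (simp add: M_def)
    finally show ?thesis .
  qed
  have 2: "(s x)\<^sup>2 / (cmod (E (of_real x)))\<^sup>2 \<le> M / (1 + x\<^sup>2)" for x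
  proof (cases "\<bar>x\<bar> \<le> 1")
    case True
    have "1 + x\<^sup>2 \<le> 2" using True by (simp add: abs_square_le_1)
    then have "b * (1 + x\<^sup>2) \<le> b * 2" using b(1) by (intro mult_left_mono) auto
    also have "\<dots> \<le> M" by (simp add: M_def)
    finally have "b \<le> M / (1 + x\<^sup>2)" by (subst pos_le_divide_eq) (auto simp: add_pos_nonneg)
    then show ?thesis using b(2)[of x] True by (simp add: abs_le_iff)
  next
    case False
    have x2: "x\<^sup>2 \<ge> 1" using False abs_le_square_iff[of 1 x] by simp
    have "x\<^sup>2 * (s x)\<^sup>2 \<le> (cmod (E (of_real x)))\<^sup>2" by (simp add: cmod_E_real s_def)
    moreover have "(1 + x\<^sup>2) * (s x)\<^sup>2 \<le> (2 * x\<^sup>2) * (s x)\<^sup>2" using x2 by (intro mult_right_mono) auto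
    ultimately have "(1 + x\<^sup>2) * (s x)\<^sup>2 \<le> 2 * (cmod (E (of_real x)))\<^sup>2" by linarith
    also have "\<dots> \<le> M * (cmod (E (of_real x)))\<^sup>2" using b by (intro mult_right_mono) (auto simp: M_def)
    finally show ?thesis using E_real_nz[of x] by (simp add: divide_simps add_pos_nonneg mult.commute)
  qed
  have "M > 0" using b by (simp add: M_def)
  then show ?thesis using 1 2 by blast
qed

lemma integrable_inverse_1_plus_square': "integrable lborel (\<lambda>w::real. M / (1 + w\<^sup>2))"
  using integrable_mult_right[OF integrable_inverse_quadratic(1)[of 1 1], of M] by simp

lemma s_cont: "continuous_on A s"
  unfolding s_def by (intro continuous_intros continuous_on_compose2[OF contS[of UNIV]]) auto

lemma E_real_cont: "continuous_on A (\<lambda>x::real. E (of_real x))"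
  by (intro continuous_on_compose2[OF contE[of UNIV]] continuous_intros) auto

lemma s_integrable: "integrable lborel (\<lambda>x. (s x)\<^sup>2 / (cmod (E (of_real x)))\<^sup>2)"
proof -
  obtain M where M: "M > 0" "\<forall>x. (s x)\<^sup>2 / (cmod (E (of_real x)))\<^sup>2 \<le> M / (1 + x\<^sup>2)"
    "\<forall>x. \<bar>x\<bar> \<le> 1 \<longrightarrow> (s x)\<^sup>2 / (cmod (E (of_real x)))\<^sup>2 \<le> M" using s_bound by blast
  show ?thesis
  proof (rule Bochner_Integration.integrable_bound[OF integrable_inverse_1_plus_square'[of M]])
    have "continuous_on UNIV (\<lambda>x. (s x)\<^sup>2 / (cmod (E (of_real x)))\<^sup>2)"
      using E_real_nz by (intro continuous_intros s_cont E_real_cont) auto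
    then show "(\<lambda>x. (s x)\<^sup>2 / (cmod (E (of_real x)))\<^sup>2) \<in> borel_measurable lborel"
      by (simp add: borel_measurable_continuous_onI)
    have "norm ((s x)\<^sup>2 / (cmod (E (of_real x)))\<^sup>2) \<le> norm (M / (1 + x\<^sup>2))" for x
      using order_trans[OF M(2)[rule_format, of x] abs_ge_self] by simp
    then show "AE x in lborel. norm ((s x)\<^sup>2 / (cmod (E (of_real x)))\<^sup>2) \<le> norm (M / (1 + x\<^sup>2))" by simp
  qed
qed

text \<open>\<open>S\<close> vanishes at the nonzero zeros of \<open>B\<close>, so no mass escapes
  in the limit and the evaluation at 0 is an equality for S^2.\<close>

lemma s_integral: "(LINT x|lborel. (s x)\<^sup>2 / (cmod (E (of_real x)))\<^sup>2) = pi * b1 / e0"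
proof -
  define I where "I = (LINT x|lborel. (s x)\<^sup>2 / (cmod (E (of_real x)))\<^sup>2)"
  define g where "g = (\<lambda>n w. (s (inverse (real (Suc n)) * w))\<^sup>2 / ((Re (E (of_real (inverse (real (Suc n)) * w))))\<^sup>2
      + w\<^sup>2 * (Re (S (of_real (inverse (real (Suc n)) * w))))\<^sup>2))"
  have real: "(S (of_real x))\<^sup>2 = of_real ((s x)\<^sup>2)" for x by (simp add: S_of_real)
  have hol: "(\<lambda>z. (S z)\<^sup>2) holomorphic_on UNIV" by (intro holomorphic_intros holS)
  have g: "integrable lborel (g n)" "(LINT w|lborel. g n w) = I" for n
    using rescaled_integral[OF tame_exp_type[OF S2_exp_type] real s_integrable, of "inverse (real (Suc n))"]
    unfolding g_def I_def by (auto simp: inverse_le_1_iff)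
  obtain M where M: "M > 0" "\<forall>x. (s x)\<^sup>2 / (cmod (E (of_real x)))\<^sup>2 \<le> M / (1 + x\<^sup>2)"
    "\<forall>x. \<bar>x\<bar> \<le> 1 \<longrightarrow> (s x)\<^sup>2 / (cmod (E (of_real x)))\<^sup>2 \<le> M" using s_bound by blast
  have "(\<lambda>n. LINT w|lborel. g n w) \<longlonglongrightarrow> (LINT w|lborel. (s 0)\<^sup>2 * (1 / (e0\<^sup>2 + b1\<^sup>2 * w\<^sup>2)))"
  proof (rule integral_dominated_convergence)
    show "(\<lambda>w. (s 0)\<^sup>2 * (1 / (e0\<^sup>2 + b1\<^sup>2 * w\<^sup>2))) \<in> borel_measurable lborel" by measurable
    show "g n \<in> borel_measurable lborel" for n using g(1) by (rule borel_measurable_integrable)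
    \<comment> \<open>For |w| <= 1 the integrand is at most s(x)^2 / |E(x)|^2 <= M, where |x| <=
      |w|; for |w| > 1 dropping (Re E)^2 from the denominator leaves 1/w^2.\<close>
    show "integrable lborel (\<lambda>w. (2 + 2 * M) / (1 + w\<^sup>2))" by (rule integrable_inverse_1_plus_square')
    show "AE w in lborel. (\<lambda>n. g n w) \<longlonglongrightarrow> (s 0)\<^sup>2 * (1 / (e0\<^sup>2 + b1\<^sup>2 * w\<^sup>2))"
      using rescaled_limit[OF hol real] by (simp add: g_def)
    have "\<bar>g n w\<bar> \<le> (2 + 2 * M) / (1 + w\<^sup>2)" for n w
    proof -
      define x where "x = inverse (real (Suc n)) * w"
      define a where "a = (Re (E (of_real x)))\<^sup>2"
      define c where "c = (s x)\<^sup>2"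
      have ac: "a \<ge> 0" "c \<ge> 0" by (auto simp: a_def c_def)
      have gx: "g n w = c / (a + w\<^sup>2 * c)" by (simp only: g_def x_def a_def c_def s_def)
      have g0: "g n w \<ge> 0" unfolding gx using ac by auto
      have xw: "\<bar>x\<bar> \<le> \<bar>w\<bar>" unfolding x_def abs_mult
        by (rule mult_left_le_one_le) (auto simp: inverse_le_1_iff)
      show ?thesis
      proof (cases "\<bar>w\<bar> \<le> 1")
        case True
        have E2: "(cmod (E (of_real x)))\<^sup>2 = a + x\<^sup>2 * c" by (simp add: cmod_E_real a_def c_def s_def)
        have pos: "a + x\<^sup>2 * c > 0" using E_real_nz[of x] unfolding E2[symmetric] by simp
        have "x\<^sup>2 * c \<le> w\<^sup>2 * c" using xw ac by (intro mult_right_mono) (auto simp: abs_le_square_iff)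
        then have "c / (a + w\<^sup>2 * c) \<le> c / (a + x\<^sup>2 * c)" using ac pos by (intro divide_left_mono mult_pos_pos) auto
        also have "\<dots> \<le> M" using M(3)[rule_format, of x] xw True unfolding E2 c_def[symmetric] by simp
        finally have "g n w \<le> M" unfolding gx .
        moreover have "M \<le> (2 + 2 * M) / (1 + w\<^sup>2)"
        proof -
          have "M * (1 + w\<^sup>2) \<le> M * 2" using True M by (intro mult_left_mono) (auto simp: abs_square_le_1)
          then show ?thesis by (subst pos_le_divide_eq) (auto simp: add_pos_nonneg)
        qed
        ultimately show ?thesis using g0 by simp
      next
        case False
        then have w2: "w\<^sup>2 \<ge> 1" using abs_le_square_iff[of 1 w] by simp
        have "c / (a + w\<^sup>2 * c) \<le> 1 / w\<^sup>2"
        proof (cases "c = 0")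
          case False
          then have "c > 0" using ac by simp
          moreover have "w\<^sup>2 * c > 0" using w2 \<open>c > 0\<close> by (intro mult_pos_pos) linarith+
          ultimately have "c / (a + w\<^sup>2 * c) \<le> c / (w\<^sup>2 * c)" using ac by (intro divide_left_mono mult_pos_pos) auto
          then show ?thesis using False by simp
        qed auto
        also have "\<dots> = 2 / (2 * w\<^sup>2)" by simp
        also have "\<dots> \<le> 2 / (1 + w\<^sup>2)" using w2 by (intro divide_left_mono mult_pos_pos add_pos_nonneg) auto
        also have "\<dots> \<le> (2 + 2 * M) / (1 + w\<^sup>2)" using M by (intro divide_right_mono) auto
        finally show ?thesis using g0 unfolding gx[symmetric] by simp
      qed
    qed
    then show "AE w in lborel. norm (g n w) \<le> (2 + 2 * M) / (1 + w\<^sup>2)" for n by simp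
  qed
  then have "(\<lambda>n. I) \<longlonglongrightarrow> (s 0)\<^sup>2 * (LINT w|lborel. 1 / (e0\<^sup>2 + b1\<^sup>2 * w\<^sup>2))" by (simp only: g(2) integral_mult_right_zero)
  then have "I = (s 0)\<^sup>2 * (LINT w|lborel. 1 / (e0\<^sup>2 + b1\<^sup>2 * w\<^sup>2))" by (simp add: LIMSEQ_const_iff)
  also have "\<dots> = b1\<^sup>2 * (pi / (e0 * b1))" 
  proof -
    have "s 0 = b1" by (simp add: s_def b1_def)
    then show ?thesis by (simp only: integral_inverse_limit(2))
  qed
  also have "\<dots> = pi * b1 / e0" using e0_b1_pos by (simp add: power2_eq_square)
  finally show ?thesis by (simp add: I_def)
qed

section \<open>The value of the reproducing kernel at the origin\<close>

definition k0 :: real where "k0 = e0 * b1 / pi"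

lemma k0_pos: "k0 > 0" using e0_b1_pos by (simp add: k0_def)

text \<open>The closed form of K(0,z): B(0) = 0 and A(0) = E(0) leave E(0) B(z) / (pi z).\<close>

definition kernel_0 :: "complex \<Rightarrow> complex" where "kernel_0 z = of_real (e0 / pi) * S z"

lemma kernel_0_real: "kernel_0 (of_real x) = of_real (e0 / pi * s x)"
  by (simp add: kernel_0_def S_of_real)

lemma kernel_0_norm:
  "integrable lborel (\<lambda>x. (cmod (kernel_0 (of_real x) / E (of_real x)))\<^sup>2)"
  "(LINT x|lborel. (cmod (kernel_0 (of_real x) / E (of_real x)))\<^sup>2) = k0"
proof -
  have eq: "(cmod (kernel_0 (of_real x) / E (of_real x)))\<^sup>2 = (e0 / pi)\<^sup>2 * ((s x)\<^sup>2 / (cmod (E (of_real x)))\<^sup>2)" for x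
    unfolding kernel_0_real norm_divide norm_of_real by (simp add: power_divide power_mult_distrib)
  show "integrable lborel (\<lambda>x. (cmod (kernel_0 (of_real x) / E (of_real x)))\<^sup>2)"
    unfolding eq by (intro integrable_mult_right s_integrable)
  show "(LINT x|lborel. (cmod (kernel_0 (of_real x) / E (of_real x)))\<^sup>2) = k0"
    unfolding eq integral_mult_right_zero s_integral using E_0(2) by (simp add: k0_def power2_eq_square)
qed

lemma bounded_type_bounded:
  assumes "f holomorphic_on upper_half_plane" "\<And>z. Im z > 0 \<Longrightarrow> cmod (f z) \<le> M"
  shows "bounded_type f" "mean_type f \<le> 0"
proof -
  have "bounded ((\<lambda>z. 1 :: complex) ` upper_half_plane)" by (auto intro!: boundedI[of _ 1])
  moreover have "bounded (f ` upper_half_plane)" using assms(2) by (auto intro!: boundedI)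
  moreover have "\<exists>z\<in>upper_half_plane. (1 :: complex) \<noteq> 0" by (intro bexI[of _ \<i>]) auto
  moreover have "(\<lambda>z. 1 :: complex) holomorphic_on upper_half_plane" by simp
  moreover have "\<forall>z\<in>upper_half_plane. (1 :: complex) \<noteq> 0 \<longrightarrow> f z = f z / 1" by simp
  ultimately show "bounded_type f" unfolding bounded_type_def using assms(1) by blast
  define m where "m = max M 1"
  have "((\<lambda>y. ereal (ln m / y)) \<longlongrightarrow> ereal 0) at_top" unfolding lim_ereal by real_asymp
  then have "Limsup at_top (\<lambda>y. ereal (ln m / y)) = ereal 0" by (intro lim_imp_Limsup) auto
  moreover have "mean_type f \<le> Limsup at_top (\<lambda>y. ereal (ln m / y))" unfolding mean_type_def
  proof (rule Limsup_mono)
    show "\<forall>\<^sub>F y in at_top. ereal (1 / y) * log_abs (f (\<i> * of_real y)) \<le> ereal (ln m / y)"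
      using eventually_gt_at_top[of 0]
    proof eventually_elim
      fix y :: real assume y: "y > 0"
      show "ereal (1 / y) * log_abs (f (\<i> * of_real y)) \<le> ereal (ln m / y)"
      proof (cases "f (\<i> * of_real y) = 0")
        case False
        have "cmod (f (\<i> * of_real y)) \<le> m" using assms(2)[of "\<i> * of_real y"] y by (simp add: m_def)
        moreover have "m > 0" by (simp add: m_def)
        ultimately have "ln (cmod (f (\<i> * of_real y))) \<le> ln m" using False by (subst ln_le_cancel_iff) auto
        then show ?thesis using False y by (simp add: log_abs_def divide_right_mono)
      qed (use y in \<open>simp add: log_abs_def\<close>)
    qed
  qed
  ultimately show "mean_type f \<le> 0" by (simp add: zero_ereal_def)
qed

text \<open>|B| <= |E| in the upper half-plane makes \<open>kernel_0 / E\<close> bounded there, and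
  \<open>kernel_0\<close> equals its own \<open>star\<close>; both growth conditions follow.\<close>

lemma kernel_0_de_Branges: "kernel_0 \<in> de_Branges E"
proof -
  have star: "star kernel_0 = kernel_0"
    by (simp add: fun_eq_iff star_def kernel_0_def S_cnj)
  have hol: "kernel_0 holomorphic_on A" for A unfolding kernel_0_def by (intro holomorphic_intros holS)
  have "bounded ((\<lambda>z. kernel_0 z / E z) ` ({z. 0 \<le> Im z} \<inter> cball 0 1))"
    using E_nz by (intro compact_imp_bounded compact_continuous_image continuous_intros contE
        holomorphic_on_imp_continuous_on[OF hol] closed_Int_compact closed_halfspace_Im_ge) auto
  then obtain b where b: "b > 0" "\<And>z. 0 \<le> Im z \<Longrightarrow> cmod z \<le> 1 \<Longrightarrow> cmod (kernel_0 z / E z) \<le> b" by (auto simp: bounded_pos)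
  have bd: "cmod (kernel_0 z / E z) \<le> b + \<bar>e0 / pi\<bar>" if z: "Im z > 0" for z
  proof (cases "cmod z \<le> 1")
    case True
    then have "cmod (kernel_0 z / E z) \<le> b" using b(2)[of z] z by simp
    then show ?thesis by (rule order_trans) simp
  next
    case False
    have "cmod (E z - E (- z)) \<le> 2 * cmod (E z)"
      using norm_triangle_ineq4[of "E z" "E (- z)"] E_uminus_less[OF z] by simp
    then have "cmod (B z) \<le> cmod (E z)" unfolding B_eq by (simp add: norm_mult)
    then have "cmod z * cmod (S z) \<le> cmod (E z)" by (simp add: B_S norm_mult)
    moreover have "1 * cmod (S z) \<le> cmod z * cmod (S z)" using False by (intro mult_right_mono) auto
    ultimately have "cmod (S z) / cmod (E z) \<le> 1" using E_nz[of z] z by simp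
    then have "\<bar>e0 / pi\<bar> * (cmod (S z) / cmod (E z)) \<le> \<bar>e0 / pi\<bar>" by (intro mult_left_le) auto
    then show ?thesis using b(1) by (simp add: kernel_0_def norm_mult norm_divide)
  qed
  have holq: "(\<lambda>z. kernel_0 z / E z) holomorphic_on upper_half_plane"
    using E_nz by (intro holomorphic_intros hol holE) auto
  show ?thesis unfolding de_Branges_def
    using bounded_type_bounded[OF holq bd] kernel_0_norm(1) hol by (simp add: entire_def star)
qed

text \<open>Let G = K(0, .) and N = G(0) = ||G||^2. Since \<open>k0\<close> is both the value at 0
  and the squared norm of \<open>kernel_0\<close>, k0 = <kernel_0, G> <= (k0 + N)/2 gives k0 <= N.
  Conversely \<open>value_at_0_le\<close> for G G~ gives N^2 / k0 <= N.\<close>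

lemma kernel_value:
  assumes "reproducing_kernel E K"
  shows "K 0 0 = of_real k0"
proof -
  define G where "G = K 0"
  have G: "G \<in> de_Branges E" and rep: "\<And>F. F \<in> de_Branges E \<Longrightarrow> F 0 = dB_inner E F G"
    using assms by (auto simp: reproducing_kernel_def G_def)
  define n where "n = (\<lambda>x::real. (cmod (G (of_real x) / E (of_real x)))\<^sup>2)"
  have intn: "integrable lborel n" using G by (simp add: de_Branges_def n_def)
  define N where "N = (LINT x|lborel. n x)"
  have starG: "star G (of_real x) = cnj (G (of_real x))" for x by (simp add: star_def)
  have n_eq: "G (of_real x) * star G (of_real x) / of_real ((cmod (E (of_real x)))\<^sup>2) = of_real (n x)" for x
    unfolding starG n_def complex_norm_square[symmetric] by (simp add: norm_divide power_divide)
  have G0: "G 0 = of_real N"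
    using rep[OF G] unfolding dB_inner_def n_eq N_def by (simp add: integral_complex_of_real)
  have N0: "N \<ge> 0" unfolding N_def n_def by (intro integral_nonneg_AE) auto
  have "k0 \<le> N"
  proof -
    define m where "m = (\<lambda>x::real. (cmod (kernel_0 (of_real x) / E (of_real x)))\<^sup>2)"
    have m: "integrable lborel m" "(LINT x|lborel. m x) = k0" using kernel_0_norm by (auto simp: m_def)
    have "kernel_0 0 = of_real k0" by (simp add: kernel_0_def S_0 k0_def)
    then have "k0 = cmod (kernel_0 0)" using k0_pos by simp
    also have "\<dots> \<le> (LINT x|lborel. norm (kernel_0 (of_real x) * star G (of_real x) / of_real ((cmod (E (of_real x)))\<^sup>2)))"
      unfolding rep[OF kernel_0_de_Branges] dB_inner_def by (rule integral_norm_bound)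
    also have "\<dots> \<le> (LINT x|lborel. (m x + n x) / 2)"
    proof (rule integral_mono')
      show "integrable lborel (\<lambda>x. (m x + n x) / 2)" using m intn by simp
      fix x :: real
      define u where "u = cmod (kernel_0 (of_real x) / E (of_real x))"
      define v where "v = cmod (G (of_real x) / E (of_real x))"
      have "norm (kernel_0 (of_real x) * star G (of_real x) / of_real ((cmod (E (of_real x)))\<^sup>2)) = u * v"
        by (simp add: u_def v_def starG norm_mult norm_divide power2_eq_square)
      also have "\<dots> \<le> (u\<^sup>2 + v\<^sup>2) / 2" using sum_squares_bound[of u v] by simp
      finally show "norm (kernel_0 (of_real x) * star G (of_real x) / of_real ((cmod (E (of_real x)))\<^sup>2)) \<le> (m x + n x) / 2"
        by (simp add: m_def n_def u_def v_def)
    qed (auto simp: m_def n_def)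
    also have "\<dots> = (k0 + N) / 2" using m intn by (simp add: N_def)
    finally show ?thesis by simp
  qed
  moreover have "N \<le> k0"
  proof -
    have real: "G (of_real x) * star G (of_real x) = of_real ((cmod (G (of_real x)))\<^sup>2)" for x
      by (simp only: starG complex_norm_square)
    have n': "(cmod (G (of_real x)))\<^sup>2 / (cmod (E (of_real x)))\<^sup>2 = n x" for x by (simp add: n_def norm_divide power_divide)
    have "(cmod (G (of_real 0)))\<^sup>2 * pi / (e0 * b1) \<le> (LINT x|lborel. (cmod (G (of_real x)))\<^sup>2 / (cmod (E (of_real x)))\<^sup>2)"
      by (rule value_at_0_le[OF tame_mult_star[OF G] real]) (use intn in \<open>simp_all add: n'\<close>)
    then have "N\<^sup>2 / k0 \<le> N" using G0 unfolding n' N_def[symmetric] by (simp add: k0_def mult.commute)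
    then have "N * N \<le> N * k0" using k0_pos by (simp add: divide_le_eq power2_eq_square)
    moreover have "N > 0" using \<open>k0 \<le> N\<close> k0_pos by simp
    ultimately show ?thesis by simp
  qed
  ultimately show ?thesis using G0 by (simp add: G_def)
qed

end

section \<open>Zeros of even functions of exponential type\<close>

lemma even_zero_factor:
  fixes f :: "complex \<Rightarrow> complex"
  assumes holf: "f holomorphic_on UNIV" and even: "\<And>z. f (- z) = f z" and \<xi>: "f \<xi> = 0" "\<xi> \<noteq> 0"
  obtains g where "g holomorphic_on UNIV" "\<And>z. g (- z) = g z" "\<And>z. f z = g z * (1 - z\<^sup>2 / \<xi>\<^sup>2)"
proof -
  define f1 where "f1 = (\<lambda>z. if z = \<xi> then deriv f \<xi> else (f z - f \<xi>) / (z - \<xi>))"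
  have hol1: "f1 holomorphic_on UNIV" unfolding f1_def by (rule pole_lemma[OF holf]) auto
  have f1: "f z = (z - \<xi>) * f1 z" for z using \<xi> by (simp add: f1_def)
  have f1z: "f1 (- \<xi>) = 0" using f1[of "- \<xi>"] even[of \<xi>] \<xi> by auto
  define f2 where "f2 = (\<lambda>z. if z = - \<xi> then deriv f1 (- \<xi>) else (f1 z - f1 (- \<xi>)) / (z - (- \<xi>)))"
  have hol2: "f2 holomorphic_on UNIV" unfolding f2_def by (rule pole_lemma[OF hol1]) auto
  have f2: "f1 z = (z + \<xi>) * f2 z" for z
    by (cases "z = - \<xi>") (auto simp: f2_def f1z add_eq_0_iff2)
  have f12: "f z = - \<xi>\<^sup>2 * f2 z * (1 - z\<^sup>2 / \<xi>\<^sup>2)" for z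
    using \<xi>(2) unfolding f1 f2 by (simp add: field_simps power2_eq_square)
  \<comment> \<open>Averaging over z and -z makes the quotient even outright, while the even
    function \<open>f\<close> is unchanged by the average.\<close>
  define g where "g = (\<lambda>z. - \<xi>\<^sup>2 * (f2 z + f2 (- z)) / 2)"
  show thesis
  proof (rule that[of g])
    show "g holomorphic_on UNIV" unfolding g_def
      by (intro holomorphic_intros hol2 holomorphic_on_compose_gen[OF _ hol2, unfolded o_def]) auto
    show "g (- z) = g z" for z by (simp add: g_def add.commute)
    have "f z = (f z + f (- z)) / 2" for z by (simp add: even)
    also have "(f z + f (- z)) / 2 = g z * (1 - z\<^sup>2 / \<xi>\<^sup>2)" for z
      unfolding f12[of z] f12[of "- z"] g_def by (simp add: algebra_simps add_divide_distrib diff_divide_distrib)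
    finally show "f z = g z * (1 - z\<^sup>2 / \<xi>\<^sup>2)" for z .
  qed
qed

text \<open>Dividing out zeros \<open>\<plusminus>\<xi>\<close> with \<open>\<bar>\<xi>\<bar> \<le> R\<close> one pair at a time terminates: on \<open>\<bar>z\<bar> = 2 R\<close> every factor
  has modulus at least 3, so after \<open>n\<close> steps \<open>\<bar>f 0\<bar> \<le> B / 3\<^sup>n\<close> by the maximum principle.\<close>

lemma even_zeros_factorization:
  fixes f :: "complex \<Rightarrow> complex"
  assumes holf: "f holomorphic_on UNIV" and even: "\<And>z. f (- z) = f z" and f0: "f 0 \<noteq> 0" and R: "R > 0"
    and B: "\<And>z. cmod z = 2 * R \<Longrightarrow> cmod (f z) \<le> B"
  obtains g xs where "g holomorphic_on UNIV" "\<And>z. g (- z) = g z"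
    "\<And>z. f z = g z * (\<Prod>\<xi>\<leftarrow>xs. 1 - z\<^sup>2 / \<xi>\<^sup>2)" "\<And>\<xi>. \<xi> \<in> set xs \<Longrightarrow> f \<xi> = 0 \<and> \<xi> \<noteq> 0"
    "\<And>z. cmod z \<le> R \<Longrightarrow> g z \<noteq> 0" "\<And>z. cmod z \<le> 2 * R \<Longrightarrow> cmod (g z) \<le> B"
proof -
  define P where "P = (\<lambda>n. \<exists>g xs. length xs = n \<and> g holomorphic_on UNIV \<and> (\<forall>z. g (- z) = g z) \<and>
    (\<forall>z. f z = g z * (\<Prod>\<xi>\<leftarrow>xs. 1 - z\<^sup>2 / \<xi>\<^sup>2)) \<and> (\<forall>\<xi>\<in>set xs. f \<xi> = 0 \<and> \<xi> \<noteq> 0 \<and> cmod \<xi> \<le> R))"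
  have prod0: "(\<Prod>\<xi>\<leftarrow>xs. 1 - 0\<^sup>2 / \<xi>\<^sup>2) = (1::complex)" for xs by (induction xs) auto
  have prod_ge: "cmod (\<Prod>\<xi>\<leftarrow>xs. 1 - z\<^sup>2 / \<xi>\<^sup>2) \<ge> 3 ^ length xs"
    if "cmod z = 2 * R" "\<forall>\<xi>\<in>set xs. \<xi> \<noteq> 0 \<and> cmod \<xi> \<le> R" for z and xs :: "complex list"
    using that(2)
  proof (induction xs)
    case (Cons \<xi> xs)
    have "cmod \<xi> > 0" "cmod \<xi> \<le> R" using Cons.prems by auto
    then have "2 * 2 \<le> (cmod z / cmod \<xi>) * (cmod z / cmod \<xi>)"
      using R that(1) by (intro mult_mono) (auto simp: field_simps)
    then have "cmod (z\<^sup>2 / \<xi>\<^sup>2) \<ge> 4" by (simp add: norm_divide norm_mult power2_eq_square)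
    then have "cmod (1 - z\<^sup>2 / \<xi>\<^sup>2) \<ge> 3"
      using norm_triangle_ineq2[of "z\<^sup>2 / \<xi>\<^sup>2" 1] by (simp add: norm_minus_commute)
    then have "3 * 3 ^ length xs \<le> cmod (1 - z\<^sup>2 / \<xi>\<^sup>2) * cmod (\<Prod>\<xi>\<leftarrow>xs. 1 - z\<^sup>2 / \<xi>\<^sup>2)"
      using Cons by (intro mult_mono) auto
    then show ?case by (simp add: norm_mult)
  qed simp
  have B0: "B \<ge> 0" using B[of "of_real (2 * R)"] R by (smt (verit) norm_ge_zero norm_of_real)
  have g_le: "cmod (g z) \<le> B / 3 ^ length xs"
    if g: "g holomorphic_on UNIV" "\<And>z. f z = g z * (\<Prod>\<xi>\<leftarrow>xs. 1 - z\<^sup>2 / \<xi>\<^sup>2)"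
      "\<forall>\<xi>\<in>set xs. f \<xi> = 0 \<and> \<xi> \<noteq> 0 \<and> cmod \<xi> \<le> R" and z: "cmod z \<le> 2 * R" for g xs z
  proof -
    have sph: "cmod (g w) \<le> B / 3 ^ length xs" if w: "cmod w = 2 * R" for w
    proof -
      have "3 ^ length xs \<le> cmod (\<Prod>\<xi>\<leftarrow>xs. 1 - w\<^sup>2 / \<xi>\<^sup>2)" using prod_ge[OF w] g(3) by auto
      then have "cmod (g w) * 3 ^ length xs \<le> cmod (f w)" unfolding g(2)[of w] norm_mult by (intro mult_left_mono) auto
      then show ?thesis using B[OF w] by (simp add: field_simps)
    qed
    have "cmod (g z) \<le> B / 3 ^ length xs"
    proof (rule maximum_modulus_frontier[where S = "cball 0 (2 * R)" and f = g])
      show "continuous_on (closure (cball 0 (2 * R))) g"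
        using g(1) holomorphic_on_imp_continuous_on continuous_on_subset by blast
      show "g holomorphic_on interior (cball 0 (2 * R))" using g(1) holomorphic_on_subset by blast
    qed (use sph z R in auto)
    then show ?thesis .
  qed
  have bound: "\<forall>n. P n \<longrightarrow> n \<le> nat \<lceil>B / cmod (f 0)\<rceil>"
  proof (intro allI impI)
    fix n assume "P n"
    then obtain g xs where g: "length xs = n" "g holomorphic_on UNIV" "\<And>z. f z = g z * (\<Prod>\<xi>\<leftarrow>xs. 1 - z\<^sup>2 / \<xi>\<^sup>2)"
      "\<forall>\<xi>\<in>set xs. f \<xi> = 0 \<and> \<xi> \<noteq> 0 \<and> cmod \<xi> \<le> R" unfolding P_def by blast
    have "f 0 = g 0" using g(3)[of 0] by (simp only: prod0 mult_1_right)
    then have "cmod (f 0) \<le> B / 3 ^ n" using g_le[OF g(2,3,4), of 0] R g(1) by simp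
    then have "3 ^ n \<le> B / cmod (f 0)" using f0 by (simp add: field_simps)
    moreover have "real n \<le> 3 ^ n" using of_nat_less_two_power[of n, where 'a = real] power_mono[of "2::real" 3 n] by linarith
    ultimately have "real n \<le> B / cmod (f 0)" by linarith
    then show "n \<le> nat \<lceil>B / cmod (f 0)\<rceil>" by linarith
  qed
  have "P 0" unfolding P_def using holf even by (intro exI[of _ f] exI[of _ "[]"]) auto
  \<comment> \<open>A factorization of maximal length is taken; a zero of \<open>g\<close> in the
    disc could be split off and would contradict maximality.\<close>
  then have "\<exists>n. P n \<and> (\<forall>m. P m \<longrightarrow> m \<le> n)"
    by (rule ex_has_greatest_nat[of P 0 "\<lambda>n. n" "Suc (nat \<lceil>B / cmod (f 0)\<rceil>)"])
      (use bound in \<open>simp add: less_Suc_eq_le\<close>)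
  then obtain n where n: "P n" "\<forall>m. P m \<longrightarrow> m \<le> n" by blast
  then obtain g xs where g: "length xs = n" "g holomorphic_on UNIV" "\<And>z. g (- z) = g z"
    "\<And>z. f z = g z * (\<Prod>\<xi>\<leftarrow>xs. 1 - z\<^sup>2 / \<xi>\<^sup>2)"
    "\<forall>\<xi>\<in>set xs. f \<xi> = 0 \<and> \<xi> \<noteq> 0 \<and> cmod \<xi> \<le> R" unfolding P_def by blast
  show thesis
  proof (rule that[OF g(2,3,4)])
    show "f \<xi> = 0 \<and> \<xi> \<noteq> 0" if "\<xi> \<in> set xs" for \<xi> using g(5) that by blast
    show "cmod (g z) \<le> B" if "cmod z \<le> 2 * R" for z
    proof -
      have "B / 3 ^ length xs \<le> B" using B0 by (simp add: divide_le_eq mult_le_cancel_left1 one_le_power)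
      then show ?thesis using g_le[OF g(2,4,5) that] by linarith
    qed
    show "g \<xi> \<noteq> 0" if \<xi>: "cmod \<xi> \<le> R" for \<xi>
    proof
      assume g\<xi>: "g \<xi> = 0"
      have "f 0 = g 0" using g(4)[of 0] by (simp only: prod0 mult_1_right)
      then have \<xi>0: "\<xi> \<noteq> 0" using g\<xi> f0 by auto
      obtain h where h: "h holomorphic_on UNIV" "\<And>z. h (- z) = h z" "\<And>z. g z = h z * (1 - z\<^sup>2 / \<xi>\<^sup>2)"
        using even_zero_factor[OF g(2,3) g\<xi> \<xi>0] by blast
      have "P (Suc n)" unfolding P_def
      proof (intro exI[of _ h] exI[of _ "\<xi> # xs"] conjI)
        show "\<forall>z. f z = h z * (\<Prod>\<xi>\<leftarrow>\<xi> # xs. 1 - z\<^sup>2 / \<xi>\<^sup>2)" using g(4) h(3) by (simp add: mult.assoc)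
        show "\<forall>\<zeta>\<in>set (\<xi> # xs). f \<zeta> = 0 \<and> \<zeta> \<noteq> 0 \<and> cmod \<zeta> \<le> R" using g(4)[of \<xi>] g(5) g\<xi> \<xi> \<xi>0 by auto
      qed (use g h in auto)
      then show False using n(2) by fastforce
    qed
  qed
qed

text \<open>A Borel-Caratheodory estimate: the logarithm of an even zero-free function vanishes to second
  order at 0, which allows to apply the Schwarz lemma twice.\<close>

lemma even_zero_free_bound:
  fixes g :: "complex \<Rightarrow> complex"
  assumes holg: "g holomorphic_on UNIV" and even: "\<And>z. g (- z) = g z" and R: "R > 0"
    and nz: "\<And>z. cmod z \<le> R \<Longrightarrow> g z \<noteq> 0" and B: "\<And>z. cmod z \<le> R \<Longrightarrow> cmod (g z) \<le> B"
    and z: "2 * (cmod z)\<^sup>2 \<le> R\<^sup>2"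
  shows "\<bar>ln (cmod (g z) / cmod (g 0))\<bar> \<le> 4 * (ln (B / cmod (g 0)) + 1) * (cmod z)\<^sup>2 / R\<^sup>2"
proof -
  \<comment> \<open>The summand 1 keeps \<open>M\<close> away from 0 when \<open>B\<close> equals
    |g(0)|.\<close>
  define M where "M = ln (B / cmod (g 0)) + 1"
  have g0: "cmod (g 0) > 0" using nz[of 0] R by simp
  have "B / cmod (g 0) \<ge> 1" using B[of 0] g0 R by simp
  then have M: "M \<ge> 1" by (simp add: M_def)
  have "g holomorphic_on ball 0 R" using holg holomorphic_on_subset by blast
  then obtain L where L: "L holomorphic_on ball 0 R" "\<And>z. z \<in> ball 0 R \<Longrightarrow> g z = exp (L z)"
    using contractible_imp_holomorphic_log[of g "ball 0 R"] nz convex_imp_contractible[of "ball (0::complex) R"] by auto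
  \<comment> \<open>Logarithm of g(R w) / g(0), symmetrized to be exactly even; its real part is
    unaffected because \<open>g\<close> is even.\<close>
  define l where "l = (\<lambda>w. (L (of_real R * w) + L (- (of_real R * w))) / 2 - L 0)"
  have inR: "of_real R * w \<in> ball 0 R" "- (of_real R * w) \<in> ball 0 R" if "cmod w < 1" for w
    using that R by (auto simp: norm_mult)
  have holl: "l holomorphic_on ball 0 1"
    unfolding l_def using inR
    by (intro holomorphic_intros holomorphic_on_compose_gen[OF _ L(1), unfolded o_def]) auto
  have l_even: "l (- w) = l w" for w by (simp add: l_def add.commute)
  have l_0: "l 0 = 0" by (simp add: l_def)
  have g_l: "cmod (g (of_real R * w)) / cmod (g 0) = exp (Re (l w))" if w: "cmod w < 1" for w
  proof -
    have 1: "cmod (g (of_real R * w)) = exp (Re (L (of_real R * w)))" using L(2)[OF inR(1)[OF w]] by simp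
    have "cmod (g (of_real R * w)) = cmod (g (- (of_real R * w)))" by (simp only: even)
    also have "\<dots> = exp (Re (L (- (of_real R * w))))" using L(2)[OF inR(2)[OF w]] by simp
    finally have "Re (L (of_real R * w)) = Re (L (- (of_real R * w)))" unfolding 1 by simp
    moreover have "cmod (g 0) = exp (Re (L 0))" using L(2)[of 0] R by simp
    ultimately show ?thesis unfolding 1 by (simp add: l_def exp_diff)
  qed
  have Rel: "Re (l w) \<le> M" if w: "cmod w < 1" for w
  proof -
    have "cmod (g (of_real R * w)) \<le> B" using inR(1)[OF w] by (intro B) auto
    then have "exp (Re (l w)) \<le> B / cmod (g 0)" unfolding g_l[OF w, symmetric] using g0 by (simp add: divide_right_mono)
    then have "Re (l w) \<le> ln (B / cmod (g 0))" by (metis exp_gt_zero exp_le_cancel_iff exp_ln less_le_trans)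
    then show ?thesis by (simp add: M_def)
  qed
  \<comment> \<open>Moebius map taking the half-plane Re l <= M into the closed unit disc and fixing
    0.\<close>
  define m where "m = (\<lambda>w. l w / (of_real (2 * M) - l w))"
  have den: "of_real (2 * M) - l w \<noteq> 0" if "cmod w < 1" for w
  proof
    assume "of_real (2 * M) - l w = 0"
    then have "Re (l w) = 2 * M" by (simp add: complex_eq_iff)
    then show False using Rel[OF that] M by simp
  qed
  have holm: "m holomorphic_on ball 0 1" unfolding m_def using den by (intro holomorphic_intros holl) auto
  have m0: "m 0 = 0" by (simp add: m_def l_0)
  have m_even: "m (- w) = m w" for w by (simp add: m_def l_even)
  have m1: "cmod (m w) \<le> 1" if w: "cmod w < 1" for w
  proof -
    have "(cmod (l w))\<^sup>2 \<le> (cmod (of_real (2 * M) - l w))\<^sup>2"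
      unfolding cmod_power2 using mult_left_mono[OF Rel[OF w], of "4 * M"] M by (simp add: power2_eq_square algebra_simps)
    then have "cmod (l w) \<le> cmod (of_real (2 * M) - l w)" by (rule power2_le_imp_le) simp
    then show ?thesis using den[OF w] by (simp add: m_def norm_divide)
  qed
  have m_le: "cmod (m w) \<le> cmod w" if "cmod w < 1" for w
    by (rule Schwarz_Lemma_le[OF holm m0 m1 that])
  define m2 where "m2 = (\<lambda>w. if w = 0 then deriv m 0 else (m w - m 0) / (w - 0))"
  have holm2: "m2 holomorphic_on ball 0 1" unfolding m2_def by (rule pole_lemma[OF holm]) auto
  have d0: "deriv m 0 = 0"
  proof -
    have d: "(m has_field_derivative deriv m 0) (at 0)" by (rule holomorphic_derivI[OF holm]) auto
    have "((\<lambda>w. m (- w)) has_field_derivative deriv m 0 * (- 1)) (at 0)"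
      by (rule DERIV_chain'[where g = m and f = uminus]) (use d in \<open>auto intro!: derivative_eq_intros\<close>)
    then have "(m has_field_derivative - deriv m 0) (at 0)" by (simp add: m_even)
    then have "deriv m 0 = - deriv m 0" using d DERIV_unique by blast
    then show ?thesis by simp
  qed
  have m2_le: "cmod (m2 w) \<le> 1" if w: "cmod w < 1" for w
    using m_le[OF w] by (auto simp: m2_def d0 m0 norm_divide divide_le_eq)
  have msq: "cmod (m w) \<le> (cmod w)\<^sup>2" if w: "cmod w < 1" for w
  proof -
    have "cmod (m2 w) \<le> cmod w" by (rule Schwarz_Lemma_le[OF holm2 _ m2_le w]) (simp add: m2_def d0)
    moreover have "m w = m2 w * w" by (simp add: m2_def m0)
    ultimately show ?thesis by (simp add: norm_mult power2_eq_square mult_right_mono)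
  qed
  define w where "w = z / of_real R"
  have zw: "of_real R * w = z" using R by (simp add: w_def)
  have cw: "(cmod w)\<^sup>2 = (cmod z)\<^sup>2 / R\<^sup>2" using R by (simp add: w_def norm_divide power_divide)
  have w2: "(cmod w)\<^sup>2 \<le> 1 / 2" using z R unfolding cw by (simp add: field_simps)
  have w1: "cmod w < 1"
  proof (rule power2_less_imp_less)
    show "(cmod w)\<^sup>2 < 1\<^sup>2" using w2 by simp
  qed simp
  have mh: "cmod (m w) \<le> (cmod w)\<^sup>2" "cmod (m w) \<le> 1 / 2" using msq[OF w1] w2 by auto
  \<comment> \<open>Solved for \<open>l\<close> this is l = 2 M m / (1 + m), where |1 + m| >= 1/2
    because |m| <= |w|^2 <= 1/2.\<close>
  have "l w * (1 + m w) = of_real (2 * M) * m w" using den[OF w1] by (simp add: m_def field_simps)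
  then have "cmod (l w) * cmod (1 + m w) = 2 * M * cmod (m w)" using M by (simp flip: norm_mult) (simp add: norm_mult)
  moreover have "cmod (1 + m w) \<ge> 1 / 2" using norm_triangle_ineq2[of 1 "- m w"] mh(2) by simp
  then have "cmod (l w) * (1 / 2) \<le> cmod (l w) * cmod (1 + m w)" by (intro mult_left_mono) auto
  ultimately have "cmod (l w) \<le> 4 * M * cmod (m w)" by simp
  also have "\<dots> \<le> 4 * M * (cmod w)\<^sup>2" using mh M by (intro mult_left_mono) auto
  finally have "\<bar>Re (l w)\<bar> \<le> 4 * M * (cmod z)\<^sup>2 / R\<^sup>2" using abs_Re_le_cmod[of "l w"] by (simp add: cw)
  moreover have "ln (cmod (g z) / cmod (g 0)) = Re (l w)" using g_l[OF w1] by (simp add: zw)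
  ultimately show ?thesis by (simp add: M_def)
qed

text \<open>\<open>x \<le> 1 - t + t * a\<close> is a chord bound starting from the value 1 at t =
  0. It survives multiplication because the chord of the product exceeds the product of the chords
  by t (1 - t) (1 - a) (1 - b).\<close>

lemma star_convex_mult:
  fixes a b x y t :: real
  assumes "0 \<le> x" "0 \<le> y" "x \<le> 1 - t + t * a" "y \<le> 1 - t + t * b" "a \<le> 1" "b \<le> 1" "0 \<le> t" "t \<le> 1"
  shows "x * y \<le> 1 - t + t * (a * b)"
proof -
  have "x * y \<le> (1 - t + t * a) * (1 - t + t * b)" using assms by (intro mult_mono) auto
  moreover have "0 \<le> (t * (1 - t)) * ((1 - a) * (1 - b))" using assms by (intro mult_nonneg_nonneg) auto
  ultimately show ?thesis by (simp add: algebra_simps)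
qed

text \<open>The reciprocal of \<Prod>(1 - z^2 / x^2) at z = i y; with \<open>xs\<close> the zeros in
  a disc, a partial Hadamard product of 1/S on the imaginary axis, up to the constant S(0).\<close>

definition recip_prod :: "real list \<Rightarrow> real \<Rightarrow> real" where
  "recip_prod xs y = (\<Prod>x\<leftarrow>xs. 1 / (1 + y\<^sup>2 / x\<^sup>2))"

lemma recip_prod_pos: "recip_prod xs y > 0"
  unfolding recip_prod_def by (induction xs) (auto intro!: mult_pos_pos divide_pos_pos add_pos_nonneg)

lemma recip_prod_le_1: "recip_prod xs y \<le> 1"
proof (induction xs)
  case (Cons x xs)
  have "1 / (1 + y\<^sup>2 / x\<^sup>2) \<le> 1" by (simp add: divide_le_eq add_pos_nonneg)
  then have "1 / (1 + y\<^sup>2 / x\<^sup>2) * recip_prod xs y \<le> 1 * 1"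
    using Cons recip_prod_pos[of xs y] by (intro mult_mono) auto
  then show ?case by (simp add: recip_prod_def)
qed (simp add: recip_prod_def)

lemma recip_prod_antimono:
  assumes "0 \<le> u" "u \<le> v"
  shows "recip_prod xs v \<le> recip_prod xs u"
proof (induction xs)
  case (Cons x xs)
  have "u\<^sup>2 / x\<^sup>2 \<le> v\<^sup>2 / x\<^sup>2" using assms by (intro divide_right_mono power_mono) auto
  then have "1 / (1 + v\<^sup>2 / x\<^sup>2) \<le> 1 / (1 + u\<^sup>2 / x\<^sup>2)" by (intro divide_left_mono mult_pos_pos add_pos_nonneg) auto
  then have "1 / (1 + v\<^sup>2 / x\<^sup>2) * recip_prod xs v \<le> 1 / (1 + u\<^sup>2 / x\<^sup>2) * recip_prod xs u"
    using Cons recip_prod_pos[of xs v] by (intro mult_mono) (auto intro: add_nonneg_nonneg)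
  then show ?case by (simp add: recip_prod_def)
qed (simp add: recip_prod_def)

text \<open>Each factor 1/(1 + q) is convex in q = y^2 / x^2 and equals 1 at q = 0, so it obeys the
  chord bound, which \<open>star_convex_mult\<close> passes on to the product.\<close>

lemma recip_prod_star_convex:
  assumes "0 \<le> t" "t \<le> 1" "u\<^sup>2 = t * v\<^sup>2"
  shows "recip_prod xs u \<le> 1 - t + t * recip_prod xs v"
proof (induction xs)
  case (Cons x xs)
  define q where "q = v\<^sup>2 / x\<^sup>2"
  have q: "q \<ge> 0" by (simp add: q_def)
  have uq: "u\<^sup>2 / x\<^sup>2 = t * q" by (simp add: q_def assms(3))
  have pos: "1 + t * q > 0" "1 + q > 0" using q assms by (auto intro: add_pos_nonneg)
  have "t * q / (1 + q) \<le> t * q / (1 + t * q)"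
    using q assms pos mult_right_mono[of t 1 q] by (intro divide_left_mono) auto
  moreover have "1 / (1 + t * q) = 1 - t * q / (1 + t * q)" using pos by (simp add: field_simps)
  moreover have "1 - t + t * (1 / (1 + q)) = 1 - t * q / (1 + q)" using pos by (simp add: field_simps)
  ultimately have "1 / (1 + u\<^sup>2 / x\<^sup>2) \<le> 1 - t + t * (1 / (1 + v\<^sup>2 / x\<^sup>2))"
    unfolding uq q_def[symmetric] by linarith
  then have "1 / (1 + u\<^sup>2 / x\<^sup>2) * recip_prod xs u \<le> 1 - t + t * (1 / (1 + v\<^sup>2 / x\<^sup>2) * recip_prod xs v)"
    using recip_prod_pos[of xs u] assms recip_prod_le_1[of xs v] Cons
    by (intro star_convex_mult) (auto simp: divide_le_eq add_pos_nonneg intro: add_nonneg_nonneg)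
  then show ?case by (simp add: recip_prod_def)
qed (use assms in \<open>simp add: recip_prod_def\<close>)

section \<open>Monotonicity and chord bounds of S(iy)^-2\<close>

context symmetric_hermite_biehler
begin

lemma S_imag_nz: "S (\<i> * of_real y) \<noteq> 0"
proof (cases "y = 0")
  case True
  then show ?thesis using e0_b1_pos by (auto simp: S_0)
next
  case False
  then show ?thesis using B_nz[of "\<i> * of_real y"] by (auto simp: B_S)
qed

definition \<beta> :: "real \<Rightarrow> real" where "\<beta> y = 1 / (Re (S (\<i> * of_real y)))\<^sup>2"

lemma \<beta>_eq: "(S (\<i> * of_real y))\<^sup>2 = of_real (1 / \<beta> y)"
  by (subst S_imag) (simp add: \<beta>_def)

lemma \<beta>_pos: "\<beta> y > 0"
  using S_imag_nz[of y] S_imag[of y] by (auto simp: \<beta>_def)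

lemma \<beta>_cmod: "\<beta> y = 1 / (cmod (S (\<i> * of_real y)))\<^sup>2"
  using \<beta>_eq[of y] \<beta>_pos[of y] by (metis (no_types, lifting) abs_of_pos divide_divide_eq_right mult_1 div_by_1 norm_of_real norm_power zero_less_divide_1_iff)

text \<open>The Hadamard product of the even function \<open>S\<close> of order 1, restricted to the imaginary axis.\<close>

lemma \<beta>_limit:
  obtains xs where "\<And>y. (\<lambda>n. (recip_prod (xs n) y)\<^sup>2) \<longlonglongrightarrow> \<beta> y / \<beta> 0"
proof -
  obtain C where C: "C > 0" "\<And>z. cmod (S z) \<le> C * exp ((\<tau> + 1) * cmod z)"
    using S_exp_type zero_less_one unfolding exp_type_class_def by blast
  define R where "R = (\<lambda>n. real (Suc n))"
  define Bd where "Bd = (\<lambda>n. C * exp ((\<tau> + 1) * (2 * R n)))"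
  have S0: "S 0 \<noteq> 0" using S_imag_nz[of 0] by simp
  have "\<exists>g xs. g holomorphic_on UNIV \<and> (\<forall>z. g (- z) = g z) \<and> (\<forall>z. S z = g z * (\<Prod>\<xi>\<leftarrow>xs. 1 - z\<^sup>2 / \<xi>\<^sup>2)) \<and>
    (\<forall>\<xi>\<in>set xs. S \<xi> = 0 \<and> \<xi> \<noteq> 0) \<and> (\<forall>z. cmod z \<le> R n \<longrightarrow> g z \<noteq> 0) \<and> (\<forall>z. cmod z \<le> 2 * R n \<longrightarrow> cmod (g z) \<le> Bd n)" for n
  proof -
    have R0: "R n > 0" by (simp add: R_def)
    have "cmod (S z) \<le> Bd n" if "cmod z = 2 * R n" for z using C(2)[of z] that by (simp add: Bd_def)
    from even_zeros_factorization[OF holS S_uminus S0 R0 this] obtain g xs where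
      "g holomorphic_on UNIV" "\<And>z. g (- z) = g z" "\<And>z. S z = g z * (\<Prod>\<xi>\<leftarrow>xs. 1 - z\<^sup>2 / \<xi>\<^sup>2)"
      "\<And>\<xi>. \<xi> \<in> set xs \<Longrightarrow> S \<xi> = 0 \<and> \<xi> \<noteq> 0" "\<And>z. cmod z \<le> R n \<Longrightarrow> g z \<noteq> 0"
      "\<And>z. cmod z \<le> 2 * R n \<Longrightarrow> cmod (g z) \<le> Bd n" by blast
    then show ?thesis by (intro exI[of _ g] exI[of _ xs]) blast
  qed
  then obtain g xs where g: "\<And>n. g n holomorphic_on UNIV" "\<And>n z. g n (- z) = g n z"
    "\<And>n z. S z = g n z * (\<Prod>\<xi>\<leftarrow>xs n. 1 - z\<^sup>2 / \<xi>\<^sup>2)" "\<And>n \<xi>. \<xi> \<in> set (xs n) \<Longrightarrow> S \<xi> = 0 \<and> \<xi> \<noteq> 0"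
    "\<And>n z. cmod z \<le> R n \<Longrightarrow> g n z \<noteq> 0" "\<And>n z. cmod z \<le> 2 * R n \<Longrightarrow> cmod (g n z) \<le> Bd n" by metis
  have prod0: "(\<Prod>\<xi>\<leftarrow>ys. 1 - 0\<^sup>2 / \<xi>\<^sup>2) = (1::complex)" for ys by (induction ys) auto
  have g0: "g n 0 = S 0" for n using g(3)[of 0 n] by (simp only: prod0 mult_1_right)
  have prodI: "(\<Prod>\<xi>\<leftarrow>ys. 1 - (\<i> * of_real y)\<^sup>2 / \<xi>\<^sup>2) = of_real (1 / recip_prod (map Re ys) y)"
    if "\<forall>\<xi>\<in>set ys. S \<xi> = 0" for ys y
    using that
  proof (induction ys)
    case (Cons \<xi> ys)
    \<comment> \<open>Zeros of \<open>S\<close> are zeros of \<open>B\<close>, hence real; this is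
      why the factors on the imaginary axis have the form 1 + y^2 / x^2.\<close>
    have "Im \<xi> = 0"
    proof (rule ccontr)
      assume "Im \<xi> \<noteq> 0"
      then have "B \<xi> \<noteq> 0" by (rule B_nz)
      then show False using Cons.prems by (simp add: B_S)
    qed
    then have \<xi>: "\<xi> = of_real (Re \<xi>)" by (simp add: complex_eq_iff)
    have "1 - (\<i> * of_real y)\<^sup>2 / \<xi>\<^sup>2 = of_real (1 + y\<^sup>2 / (Re \<xi>)\<^sup>2)"
      by (subst \<xi>) (simp add: power_mult_distrib)
    then show ?case using Cons by (simp add: recip_prod_def)
  qed (simp add: recip_prod_def)
  have "(\<lambda>n. (recip_prod (map Re (xs n)) y)\<^sup>2) \<longlonglongrightarrow> \<beta> y / \<beta> 0" for y
  proof -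
    define t where "t = (\<lambda>n. ln (cmod (g n (\<i> * of_real y)) / cmod (g n 0)))"
    define c where "c = \<bar>ln (C / cmod (S 0))\<bar> + 1"
    \<comment> \<open>The logarithm of the bound for the zero-free factor is O(R), while the
      vanishing to second order at 0 gains 1/R^2. So this factor tends to a constant and only the
      zeros remain.\<close>
    have "(\<lambda>n. 4 * ((\<tau> + 1) * (2 * R n) + c) * y\<^sup>2 / (R n)\<^sup>2) \<longlonglongrightarrow> 0"
      unfolding R_def by real_asymp
    moreover have "\<forall>\<^sub>F n in sequentially. norm (t n) \<le> 4 * ((\<tau> + 1) * (2 * R n) + c) * y\<^sup>2 / (R n)\<^sup>2"
    proof -
      have "filterlim (\<lambda>n. (R n)\<^sup>2) at_top sequentially" unfolding R_def by real_asymp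
      then have "\<forall>\<^sub>F n in sequentially. (R n)\<^sup>2 \<ge> 2 * y\<^sup>2" by (simp add: filterlim_at_top)
      then show ?thesis
      proof eventually_elim
        fix n assume Rn: "(R n)\<^sup>2 \<ge> 2 * y\<^sup>2"
        have R0: "R n > 0" by (simp add: R_def)
        have "\<bar>t n\<bar> \<le> 4 * (ln (Bd n / cmod (g n 0)) + 1) * (cmod (\<i> * of_real y))\<^sup>2 / (R n)\<^sup>2"
          unfolding t_def by (rule even_zero_free_bound[OF g(1) g(2) R0 g(5) g(6)]) (use Rn R0 in \<open>auto simp: norm_mult\<close>)
        also have "\<dots> = 4 * (ln (Bd n / cmod (g n 0)) + 1) * y\<^sup>2 / (R n)\<^sup>2" by (simp add: norm_mult)
        also have "\<dots> \<le> 4 * ((\<tau> + 1) * (2 * R n) + c) * y\<^sup>2 / (R n)\<^sup>2"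
        proof (intro divide_right_mono mult_right_mono mult_left_mono)
          have "Bd n / cmod (g n 0) = (C / cmod (S 0)) * exp ((\<tau> + 1) * (2 * R n))" by (simp add: Bd_def g0)
          moreover have "C / cmod (S 0) > 0" using C(1) S0 by simp
          ultimately have "ln (Bd n / cmod (g n 0)) = ln (C / cmod (S 0)) + (\<tau> + 1) * (2 * R n)"
            using ln_mult_pos[OF _ exp_gt_zero] by (simp only: ln_exp)
          then show "ln (Bd n / cmod (g n 0)) + 1 \<le> (\<tau> + 1) * (2 * R n) + c" by (simp add: c_def)
        qed auto
        finally show "norm (t n) \<le> 4 * ((\<tau> + 1) * (2 * R n) + c) * y\<^sup>2 / (R n)\<^sup>2" by simp
      qed
    qed
    ultimately have t0: "t \<longlonglongrightarrow> 0" by (rule Lim_null_comparison[rotated])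
    have "(\<lambda>n. \<beta> y / \<beta> 0 * (exp (t n))\<^sup>2) \<longlonglongrightarrow> \<beta> y / \<beta> 0 * (exp 0)\<^sup>2" by (intro tendsto_intros t0)
    moreover have "\<beta> y / \<beta> 0 * (exp (t n))\<^sup>2 = (recip_prod (map Re (xs n)) y)\<^sup>2" for n
    proof -
      define r where "r = recip_prod (map Re (xs n)) y"
      have r: "r > 0" unfolding r_def by (rule recip_prod_pos)
      have "S (\<i> * of_real y) = g n (\<i> * of_real y) * of_real (1 / r)"
        unfolding g(3)[of "\<i> * of_real y" n] r_def using g(4) by (subst prodI) auto
      then have Sg: "cmod (S (\<i> * of_real y)) = cmod (g n (\<i> * of_real y)) / r" using r by (simp add: norm_mult norm_divide)
      have gp: "cmod (g n (\<i> * of_real y)) > 0" using Sg S_imag_nz[of y] by auto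
      have et: "exp (t n) = cmod (g n (\<i> * of_real y)) / cmod (S 0)" using gp S0 by (simp add: t_def g0)
      have "\<beta> 0 = 1 / (cmod (S 0))\<^sup>2" using \<beta>_cmod[of 0] by simp
      then show ?thesis using gp S0 r unfolding et \<beta>_cmod[of y] Sg r_def[symmetric] by (simp add: field_simps)
    qed
    ultimately show ?thesis by simp
  qed
  then show thesis by (rule that)
qed

lemma \<beta>_antimono:
  assumes "0 \<le> u" "u \<le> v"
  shows "\<beta> v \<le> \<beta> u"
proof -
  obtain xs where xs: "\<And>y. (\<lambda>n. (recip_prod (xs n) y)\<^sup>2) \<longlonglongrightarrow> \<beta> y / \<beta> 0" using \<beta>_limit by blast
  have "\<beta> v / \<beta> 0 \<le> \<beta> u / \<beta> 0"
    by (rule LIMSEQ_le[OF xs xs]) (auto intro!: power_mono recip_prod_antimono assms less_imp_le[OF recip_prod_pos])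
  then show ?thesis using \<beta>_pos[of 0] by (simp add: divide_le_cancel)
qed

text \<open>The chord bound holds for the partial products and for their squares, hence for their
  limit \<beta> / \<beta>(0). Its parameter is t = u^2 / v^2, and the denominators are
  cleared.\<close>

lemma \<beta>_star_convex:
  assumes "0 \<le> u" "u \<le> v" "0 < v"
  shows "v\<^sup>2 * \<beta> u \<le> (v\<^sup>2 - u\<^sup>2) * \<beta> 0 + u\<^sup>2 * \<beta> v"
proof -
  obtain xs where xs: "\<And>y. (\<lambda>n. (recip_prod (xs n) y)\<^sup>2) \<longlonglongrightarrow> \<beta> y / \<beta> 0" using \<beta>_limit by blast
  define t where "t = u\<^sup>2 / v\<^sup>2"
  have t: "0 \<le> t" "t \<le> 1" "u\<^sup>2 = t * v\<^sup>2" using assms by (auto simp: t_def divide_le_eq power_mono)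
  have "\<beta> u / \<beta> 0 \<le> 1 - t + t * (\<beta> v / \<beta> 0)"
  proof (rule LIMSEQ_le[OF xs])
    show "(\<lambda>n. 1 - t + t * (recip_prod (xs n) v)\<^sup>2) \<longlonglongrightarrow> 1 - t + t * (\<beta> v / \<beta> 0)"
      by (intro tendsto_intros xs)
    have "(recip_prod (xs n) u)\<^sup>2 \<le> 1 - t + t * (recip_prod (xs n) v)\<^sup>2" for n
      unfolding power2_eq_square using recip_prod_pos recip_prod_le_1 recip_prod_star_convex[OF t] t(1,2)
      by (intro star_convex_mult) (auto intro: less_imp_le)
    then show "\<exists>N. \<forall>n\<ge>N. (recip_prod (xs n) u)\<^sup>2 \<le> 1 - t + t * (recip_prod (xs n) v)\<^sup>2" by blast
  qed
  then have "\<beta> u \<le> (1 - t) * \<beta> 0 + t * \<beta> v" using \<beta>_pos[of 0] by (simp add: field_simps)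
  then have "v\<^sup>2 * \<beta> u \<le> v\<^sup>2 * ((1 - t) * \<beta> 0 + t * \<beta> v)" by (intro mult_left_mono) auto
  also have "\<dots> = (v\<^sup>2 - u\<^sup>2) * \<beta> 0 + u\<^sup>2 * \<beta> v" unfolding t(3) by (simp add: algebra_simps)
  finally show ?thesis .
qed

end

section \<open>The extremal functions\<close>

text \<open>Dominated convergence for difference quotients: on |z| <= |z0| + 1 Cauchy's estimate
  with radius 1 bounds the derivatives by the same majorant that bounds the values on |z| <= |z0| +
  2.\<close>

lemma holomorphic_on_dominated_integral:
  fixes G :: "real \<Rightarrow> complex \<Rightarrow> complex"
  assumes hol: "\<And>y. G y holomorphic_on UNIV"
    and meas: "\<And>z. (\<lambda>y. G y z) \<in> borel_measurable lborel"
    and dom: "\<And>r. \<exists>w. integrable lborel w \<and> (\<forall>y z. cmod z \<le> r \<longrightarrow> cmod (G y z) \<le> w y)"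
  shows "(\<lambda>z. LINT y|lborel. G y z) holomorphic_on UNIV"
  unfolding holomorphic_on_def
proof
  fix z0 :: complex
  obtain w where w: "integrable lborel w" "\<And>y z. cmod z \<le> cmod z0 + 2 \<Longrightarrow> cmod (G y z) \<le> w y"
    using dom[of "cmod z0 + 2"] by blast
  have int: "integrable lborel (\<lambda>y. G y z)" if "cmod z \<le> cmod z0 + 2" for z
  proof (rule Bochner_Integration.integrable_bound[OF w(1) meas])
    have "cmod (G y z) \<le> norm (w y)" for y using order_trans[OF w(2)[OF that, of y] abs_ge_self] by simp
    then show "AE y in lborel. cmod (G y z) \<le> norm (w y)" by simp
  qed
  have deriv_le: "cmod (deriv (G y) z) \<le> w y" if z: "cmod z \<le> cmod z0 + 1" for y z
  proof -
    have b: "cmod (G y x) \<le> w y" if "cmod (z - x) = 1" for x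
    proof (rule w(2))
      show "cmod x \<le> cmod z0 + 2" using norm_triangle_ineq3[of x z] that z by (simp add: norm_minus_commute)
    qed
    have "cmod ((deriv ^^ 1) (G y) z) \<le> fact 1 * w y / 1 ^ 1"
      by (rule Cauchy_inequality) (use b hol[of y] in \<open>auto intro: holomorphic_on_subset holomorphic_on_imp_continuous_on\<close>)
    then show ?thesis by simp
  qed
  have dq: "cmod ((G y (z0 + h) - G y z0) / h) \<le> w y" if h: "h \<noteq> 0" "cmod h < 1" for h y
  proof -
    have "cmod (G y (z0 + h) - G y z0) \<le> w y * cmod (z0 + h - z0)"
    proof (rule field_differentiable_bound[where S = "cball z0 1" and f' = "deriv (G y)"])
      show "(G y has_field_derivative deriv (G y) z) (at z within cball z0 1)" for z
        by (rule has_field_derivative_at_within, rule holomorphic_derivI[OF hol[of y]]) auto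
      show "cmod (deriv (G y) z) \<le> w y" if "z \<in> cball z0 1" for z
        using deriv_le[of z y] that norm_triangle_ineq3[of z z0] by (simp add: dist_norm norm_minus_commute)
    qed (use h in \<open>auto simp: dist_norm\<close>)
    then show ?thesis using h by (simp add: norm_divide divide_le_eq)
  qed
  define I where "I = (\<lambda>z. LINT y|lborel. G y z)"
  have "((\<lambda>h. (I (z0 + h) - I z0) / h) \<longlongrightarrow> (LINT y|lborel. deriv (G y) z0)) (at 0)"
    unfolding tendsto_at_iff_sequentially
  proof (intro allI impI)
    fix X :: "nat \<Rightarrow> complex"
    assume X: "\<forall>i. X i \<in> UNIV - {0}" "X \<longlonglongrightarrow> 0"
    have "\<forall>\<^sub>F n in sequentially. cmod (X n) < 1"
      using tendsto_norm[OF X(2)] by (intro order_tendstoD) auto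
    then obtain N where N: "\<And>n. n \<ge> N \<Longrightarrow> cmod (X n) < 1" unfolding eventually_sequentially by blast
    define Y where "Y = (\<lambda>n. X (n + N))"
    have Y: "Y n \<noteq> 0" "cmod (Y n) < 1" for n using X N by (auto simp: Y_def)
    have Y0: "Y \<longlonglongrightarrow> 0" unfolding Y_def using X(2) by (rule LIMSEQ_ignore_initial_segment)
    have lim: "(\<lambda>n. (G y (z0 + Y n) - G y z0) / Y n) \<longlonglongrightarrow> deriv (G y) z0" for y
    proof -
      have "(G y has_field_derivative deriv (G y) z0) (at z0)" by (rule holomorphic_derivI[OF hol]) auto
      then have "((\<lambda>h. (G y (z0 + h) - G y z0) / h) \<longlongrightarrow> deriv (G y) z0) (at 0)" by (simp add: DERIV_def)
      then show ?thesis unfolding tendsto_at_iff_sequentially using Y Y0 by (auto simp: o_def)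
    qed
    have m: "(\<lambda>y. (G y (z0 + Y n) - G y z0) / Y n) \<in> borel_measurable lborel" for n
      by (intro borel_measurable_divide borel_measurable_diff meas borel_measurable_const)
    have "(\<lambda>n. LINT y|lborel. (G y (z0 + Y n) - G y z0) / Y n) \<longlonglongrightarrow> (LINT y|lborel. deriv (G y) z0)"
    proof (rule integral_dominated_convergence[OF _ m w(1)])
      show "(\<lambda>y. deriv (G y) z0) \<in> borel_measurable lborel" by (rule borel_measurable_LIMSEQ_metric[OF m lim])
    qed (use lim dq Y in auto)
    moreover have "(LINT y|lborel. (G y (z0 + Y n) - G y z0) / Y n) = (I (z0 + Y n) - I z0) / Y n" for n
    proof -
      have "cmod (z0 + Y n) \<le> cmod z0 + 2" using norm_triangle_ineq[of z0 "Y n"] Y(2)[of n] by linarith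
      then show ?thesis using int[of "z0 + Y n"] int[of z0] by (simp add: I_def)
    qed
    ultimately have "(\<lambda>n. (I (z0 + X (n + N)) - I z0) / X (n + N)) \<longlonglongrightarrow> (LINT y|lborel. deriv (G y) z0)"
      by (simp only: Y_def)
    then show "((\<lambda>h. (I (z0 + h) - I z0) / h) \<circ> X) \<longlonglongrightarrow> (LINT y|lborel. deriv (G y) z0)"
      unfolding o_def by (rule LIMSEQ_offset)
  qed
  then have "(I has_field_derivative (LINT y|lborel. deriv (G y) z0)) (at z0)" by (simp add: DERIV_def)
  then show "(\<lambda>z. LINT y|lborel. G y z) field_differentiable at z0 within UNIV"
    unfolding I_def field_differentiable_def by auto
qed

lemma half_line_integral:
  assumes x: "x \<noteq> 0"
  shows "integrable lborel (\<lambda>y::real. indicator {0<..} y * (1 / (x\<^sup>2 + y\<^sup>2)))"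
    "(LINT y|lborel. indicator {0<..} y * (1 / (x\<^sup>2 + y\<^sup>2))) = pi / (2 * \<bar>x\<bar>)"
proof -
  define f where "f = (\<lambda>y::real. 1 / (x\<^sup>2 + y\<^sup>2))"
  have f: "integrable lborel f" "(LINT y|lborel. f y) = pi / \<bar>x\<bar>"
    using integrable_inverse_quadratic[of "\<bar>x\<bar>" 1] x by (auto simp: f_def)
  have i1: "integrable lborel (\<lambda>y. indicator {0<..} y * f y)"
    using integrable_real_mult_indicator[OF _ f(1), of "{0<..}"] by (simp add: mult.commute)
  have i2: "integrable lborel (\<lambda>y. indicator {..<0} y * f y)"
    using integrable_real_mult_indicator[OF _ f(1), of "{..<0}"] by (simp add: mult.commute)
  have "(LINT y|lborel. indicator {0<..} y * f y) = (LINT y|lborel. indicator {0<..} (0 + (-1) * y) * f (0 + (-1) * y))"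
    using lborel_integral_real_affine[of "-1" "\<lambda>y. indicator {0<..} y * f y" 0] by simp
  also have "\<dots> = (LINT y|lborel. indicator {..<0} y * f y)"
    by (rule Bochner_Integration.integral_cong) (auto simp: f_def indicator_def)
  finally have sym: "(LINT y|lborel. indicator {0<..} y * f y) = (LINT y|lborel. indicator {..<0} y * f y)" .
  have "(LINT y|lborel. f y) = (LINT y|lborel. indicator {0<..} y * f y + indicator {..<0} y * f y)"
  proof (rule integral_cong_AE)
    show "AE y in lborel. f y = indicator {0<..} y * f y + indicator {..<0} y * f y"
      using AE_lborel_singleton[of "0::real"] by eventually_elim (auto simp: indicator_def)
  qed (use f i1 i2 in auto)
  then have "pi / \<bar>x\<bar> = 2 * (LINT y|lborel. indicator {0<..} y * f y)" using f(2) sym i1 i2 by simp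
  then show "integrable lborel (\<lambda>y::real. indicator {0<..} y * (1 / (x\<^sup>2 + y\<^sup>2)))"
    "(LINT y|lborel. indicator {0<..} y * (1 / (x\<^sup>2 + y\<^sup>2))) = pi / (2 * \<bar>x\<bar>)"
    using i1 by (auto simp: f_def)
qed

section \<open>The density V and the continued Cauchy integral\<close>

locale truncation_problem = symmetric_hermite_biehler +
  fixes a :: real
  assumes a_pos: "a > 0"
begin

text \<open>The entire function S^2 V. The numerator vanishes at \<plusminus>i a because \<beta>(a)
  S(ia)^2 = 1, and the product form of the characterization avoids specifying values at these
  removable singularities.\<close>

definition U :: "complex \<Rightarrow> complex" where
  "U = (SOME g. g holomorphic_on UNIV \<and> (\<forall>z. g (- z) = g z) \<and>
     (\<forall>z. g z * (z\<^sup>2 + (of_real a)\<^sup>2) = 1 - of_real (\<beta> a) * (S z)\<^sup>2))"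

lemma U: "U holomorphic_on UNIV" "U (- z) = U z" "U z * (z\<^sup>2 + (of_real a)\<^sup>2) = 1 - of_real (\<beta> a) * (S z)\<^sup>2"
proof -
  define N where "N = (\<lambda>z. 1 - of_real (\<beta> a) * (S z)\<^sup>2)"
  have "N holomorphic_on UNIV" unfolding N_def by (intro holomorphic_intros holS)
  moreover have "N (- z) = N z" for z by (simp add: N_def S_uminus)
  moreover have "N (\<i> * of_real a) = 0" unfolding N_def \<beta>_eq using \<beta>_pos[of a] by (simp flip: of_real_mult)
  moreover have "\<i> * complex_of_real a \<noteq> 0" using a_pos by simp
  ultimately obtain g where g: "g holomorphic_on UNIV" "\<And>z. g (- z) = g z" "\<And>z. N z = g z * (1 - z\<^sup>2 / (\<i> * of_real a)\<^sup>2)"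
    using even_zero_factor[of N "\<i> * of_real a"] by metis
  have "\<exists>g. g holomorphic_on UNIV \<and> (\<forall>z. g (- z) = g z) \<and>
     (\<forall>z. g z * (z\<^sup>2 + (of_real a)\<^sup>2) = 1 - of_real (\<beta> a) * (S z)\<^sup>2)"
  proof (intro exI[of _ "\<lambda>z. g z / (of_real a)\<^sup>2"] conjI allI)
    show "g z / (of_real a)\<^sup>2 * (z\<^sup>2 + (of_real a)\<^sup>2) = 1 - of_real (\<beta> a) * (S z)\<^sup>2" for z
      using g(3)[of z] a_pos unfolding N_def by (simp add: power_mult_distrib field_simps)
  qed (use g a_pos in \<open>auto intro!: holomorphic_intros\<close>)
  from someI_ex[OF this] show "U holomorphic_on UNIV" "U (- z) = U z"
    "U z * (z\<^sup>2 + (of_real a)\<^sup>2) = 1 - of_real (\<beta> a) * (S z)\<^sup>2" unfolding U_def by auto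
qed

text \<open>The values on the imaginary axis of \<open>(1 / S(z)\<^sup>2 - 1 / S(i a)\<^sup>2) / (z\<^sup>2 + a\<^sup>2)\<close>, with junk value 0 at the
  removable singularity \<open>y = a\<close>, a null set.\<close>

definition V :: "real \<Rightarrow> real" where
  "V y = (if y = a then 0 else (\<beta> y - \<beta> a) / (a\<^sup>2 - y\<^sup>2))"

lemma V_0: "V 0 = (\<beta> 0 - \<beta> a) / a\<^sup>2"
  using a_pos by (simp add: V_def)

lemma V_0_nonneg: "V 0 \<ge> 0"
  unfolding V_0 using \<beta>_antimono[of 0 a] a_pos by simp

text \<open>For y \<noteq> a, \<open>V y\<close> is minus the slope of \<beta>, as a function of
  y^2, between y and a, and \<open>V 0\<close> is the one between 0 and a. Monotonicity gives the
  sign, the chord bound from 0 the comparison.\<close>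

lemma V_bounds:
  assumes "y \<ge> 0"
  shows "0 \<le> V y" "V y \<le> V 0"
proof -
  consider "y = a" | "y < a" | "y > a" by linarith
  then have "0 \<le> V y \<and> V y \<le> V 0"
  proof cases
    case 1
    then show ?thesis using V_0_nonneg by (simp add: V_def)
  next
    case 2
    have d: "a\<^sup>2 - y\<^sup>2 > 0" using 2 assms by (simp add: power_strict_mono)
    have "(\<beta> y - \<beta> a) * a\<^sup>2 \<le> (\<beta> 0 - \<beta> a) * (a\<^sup>2 - y\<^sup>2)"
      using \<beta>_star_convex[OF assms, of a] 2 a_pos by (simp add: algebra_simps)
    then have "(\<beta> y - \<beta> a) / (a\<^sup>2 - y\<^sup>2) \<le> (\<beta> 0 - \<beta> a) / a\<^sup>2" using d a_pos by (simp add: field_simps)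
    then show ?thesis using 2 d \<beta>_antimono[OF assms, of a] unfolding V_0 by (simp add: V_def)
  next
    case 3
    have d: "y\<^sup>2 - a\<^sup>2 > 0" using 3 a_pos by (simp add: power_strict_mono)
    have e: "(\<beta> y - \<beta> a) / (a\<^sup>2 - y\<^sup>2) = (\<beta> a - \<beta> y) / (y\<^sup>2 - a\<^sup>2)"
      by (metis minus_diff_eq minus_divide_divide)
    have "(\<beta> a - \<beta> y) * a\<^sup>2 \<le> (\<beta> 0 - \<beta> a) * (y\<^sup>2 - a\<^sup>2)"
      using \<beta>_star_convex[of a y] 3 a_pos by (simp add: algebra_simps)
    then have "(\<beta> a - \<beta> y) / (y\<^sup>2 - a\<^sup>2) \<le> (\<beta> 0 - \<beta> a) / a\<^sup>2" using d a_pos by (simp add: field_simps)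
    then show ?thesis using 3 d \<beta>_antimono[of a y] a_pos unfolding V_0 by (simp add: V_def e)
  qed
  then show "0 \<le> V y" "V y \<le> V 0" by auto
qed

lemma V_measurable: "V \<in> borel_measurable borel"
proof -
  have "continuous_on UNIV (\<lambda>y. 1 / (cmod (S (\<i> * of_real y)))\<^sup>2)"
    using S_imag_nz by (intro continuous_intros continuous_on_compose2[OF contS[of UNIV]]) auto
  then have [measurable]: "\<beta> \<in> borel_measurable borel"
    unfolding \<beta>_cmod[abs_def] by (rule borel_measurable_continuous_onI)
  show ?thesis unfolding V_def[abs_def] by measurable
qed

text \<open>For y > 0 other than a, \<open>U\<close> takes the value S(iy)^2 V(y) at \<plusminus>i
  y, so \<open>N y\<close> vanishes there and N / (z^2 + y^2) has no poles. Subtracting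
  \<open>U\<close> thus performs the continuation of the Cauchy integral across the imaginary
  axis.\<close>

definition N :: "real \<Rightarrow> complex \<Rightarrow> complex" where
  "N y z = (S z)\<^sup>2 * of_real (V y) - U z"

text \<open>The value 0 for y <= 0 turns integrals over the line into integrals over the half-line;
  y = a is excluded because \<open>V a\<close> is a default value.\<close>

definition G :: "real \<Rightarrow> complex \<Rightarrow> complex" where
  "G y = (if 0 < y \<and> y \<noteq> a then SOME g. g holomorphic_on UNIV \<and> (\<forall>z. g z * (z\<^sup>2 + (of_real y)\<^sup>2) = N y z) else (\<lambda>_. 0))"

lemma holN: "N y holomorphic_on UNIV"
  unfolding N_def by (intro holomorphic_intros holS U)

lemma G_pos:
  assumes y: "0 < y" "y \<noteq> a"
  shows "G y holomorphic_on UNIV" "G y z * (z\<^sup>2 + (of_real y)\<^sup>2) = N y z"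
proof -
  have d: "a\<^sup>2 - y\<^sup>2 \<noteq> 0" using y a_pos by (simp add: power2_eq_iff)
  have "U (\<i> * of_real y) * of_real (a\<^sup>2 - y\<^sup>2) = of_real (1 - \<beta> a * (1 / \<beta> y))"
    using U(3)[of "\<i> * of_real y"] unfolding \<beta>_eq by (simp add: power_mult_distrib algebra_simps)
  moreover have "1 - \<beta> a * (1 / \<beta> y) = 1 / \<beta> y * V y * (a\<^sup>2 - y\<^sup>2)"
    using y d \<beta>_pos[of y] by (simp add: V_def field_simps)
  ultimately have "U (\<i> * of_real y) * of_real (a\<^sup>2 - y\<^sup>2) = of_real (1 / \<beta> y * V y) * of_real (a\<^sup>2 - y\<^sup>2)"
    by (simp only: of_real_mult)
  then have "U (\<i> * of_real y) = of_real (1 / \<beta> y * V y)"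
    using d by (metis mult_right_cancel of_real_eq_0_iff)
  then have "N y (\<i> * of_real y) = 0" unfolding N_def \<beta>_eq by simp
  moreover have "N y (- z) = N y z" for z by (simp add: N_def S_uminus U(2))
  moreover have "\<i> * complex_of_real y \<noteq> 0" using y by simp
  ultimately obtain g where g: "g holomorphic_on UNIV" "\<And>z. N y z = g z * (1 - z\<^sup>2 / (\<i> * of_real y)\<^sup>2)"
    using even_zero_factor[OF holN[of y]] by metis
  have "\<exists>g. g holomorphic_on UNIV \<and> (\<forall>z. g z * (z\<^sup>2 + (of_real y)\<^sup>2) = N y z)"
  proof (intro exI[of _ "\<lambda>z. g z / (of_real y)\<^sup>2"] conjI allI)
    show "g z / (of_real y)\<^sup>2 * (z\<^sup>2 + (of_real y)\<^sup>2) = N y z" for z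
      using y unfolding g(2)[of z] by (simp add: power_mult_distrib field_simps)
  qed (use g y in \<open>auto intro!: holomorphic_intros\<close>)
  from someI_ex[OF this] show "G y holomorphic_on UNIV" "G y z * (z\<^sup>2 + (of_real y)\<^sup>2) = N y z"
    using y unfolding G_def by auto
qed

lemma G_zero: "\<not> (0 < y \<and> y \<noteq> a) \<Longrightarrow> G y z = 0"
  unfolding G_def by (simp only: if_False)

lemma holG: "G y holomorphic_on UNIV"
  using G_pos(1)[of y] by (cases "0 < y \<and> y \<noteq> a") (auto simp: G_def)

text \<open>Away from y = |z| the denominator is nonzero for y > 0. The two exceptional points form
  a null set, so this formula suffices for measurability and integration.\<close>

lemma G_eq:
  assumes "y \<noteq> a" "y \<noteq> cmod z"
  shows "G y z = indicator {0<..} y *\<^sub>R (N y z / (z\<^sup>2 + (of_real y)\<^sup>2))"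
proof (cases "0 < y")
  case True
  have "z\<^sup>2 + (of_real y)\<^sup>2 \<noteq> 0"
  proof
    assume "z\<^sup>2 + (of_real y)\<^sup>2 = 0"
    then have "z\<^sup>2 = - ((of_real y)\<^sup>2)" by (simp add: add_eq_0_iff2)
    then have "cmod (z\<^sup>2) = y\<^sup>2" by (simp add: norm_power)
    then show False using True assms(2) by (simp add: norm_power power2_eq_iff_nonneg)
  qed
  then show ?thesis using G_pos(2)[OF True assms(1), of z] True by (simp add: field_simps)
qed (simp add: G_zero)

lemma G_measurable: "(\<lambda>y. G y z) \<in> borel_measurable lborel"
proof (rule measurable_discrete_difference)
  show "(\<lambda>y. indicator {0<..} y *\<^sub>R (N y z / (z\<^sup>2 + (of_real y)\<^sup>2))) \<in> borel_measurable lborel"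
    unfolding N_def using V_measurable by measurable
  show "countable {a, cmod z}" by simp
  show "indicator {0<..} y *\<^sub>R (N y z / (z\<^sup>2 + (of_real y)\<^sup>2)) = G y z" if "y \<in> space lborel" "y \<notin> {a, cmod z}" for y
    using that by (subst G_eq) auto
qed simp_all

text \<open>A majorant whose integral is linear in \<open>r\<close>: a plateau covering the y at
  which z^2 + y^2 may vanish with |z| <= r, and a tail for y beyond r + 1/2. Linear growth leaves
  the exponential type of the integral unchanged.\<close>

definition dominator :: "real \<Rightarrow> real \<Rightarrow> real" where
  "dominator r y = 2 * indicator {0..r + 1/2} y + 5 / (1 + (y - r)\<^sup>2)"

lemma dominator_integral:
  assumes "r \<ge> 0"
  shows "integrable lborel (dominator r)" "(LINT y|lborel. dominator r y) = 2 * r + 1 + 5 * pi"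
proof -
  have 1: "integrable lborel (\<lambda>y::real. 5 * (1 / (1\<^sup>2 + 1\<^sup>2 * y\<^sup>2)))"
    by (intro integrable_mult_right integrable_inverse_quadratic) auto
  have 2: "(LINT y|lborel. 5 * (1 / (1\<^sup>2 + 1\<^sup>2 * y\<^sup>2))) = 5 * pi"
    unfolding integral_mult_right_zero by (subst integrable_inverse_quadratic(2)) auto
  have i1: "integrable lborel (\<lambda>y. 5 / (1 + (y - r)\<^sup>2))"
    using lborel_integrable_real_affine[OF 1, of 1 "- r"] by simp
  have i2: "(LINT y|lborel. 5 / (1 + (y - r)\<^sup>2)) = 5 * pi"
    using lborel_integral_real_affine[of 1 "\<lambda>y. 5 * (1 / (1\<^sup>2 + 1\<^sup>2 * y\<^sup>2))" "- r"] unfolding 2 by simp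
  have j: "integrable lborel (\<lambda>y. 2 * indicator {0..r + 1/2} y :: real)" 
    by (intro integrable_mult_right integrable_real_indicator) (auto simp: emeasure_lborel_Icc_eq)
  show "integrable lborel (dominator r)" unfolding dominator_def[abs_def] by (intro Bochner_Integration.integrable_add i1 j)
  have "(LINT y|lborel. 2 * indicator {0..r + 1/2} y :: real) = 2 * r + 1" using assms by simp
  then show "(LINT y|lborel. dominator r y) = 2 * r + 1 + 5 * pi"
    unfolding dominator_def using i1 i2 j by (subst Bochner_Integration.integral_add) auto
qed

lemma dominator_nonneg: "dominator r y \<ge> 0"
  by (simp add: dominator_def add_nonneg_nonneg)

text \<open>For y <= r + 1/2 the maximum principle moves the estimate to |w| = r + 1, where |w^2 +
  y^2| >= 3/4; the plateau 2 exceeds 4/3. For larger y, with u = y - r > 1/2, |z^2 + y^2| >= u^2 and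
  1/u^2 <= 5/(1 + u^2).\<close>

lemma G_bound:
  assumes z: "cmod z \<le> r" and M: "\<And>w. cmod w \<le> r + 1 \<Longrightarrow> (cmod (S w))\<^sup>2 * V 0 + cmod (U w) \<le> M"
  shows "cmod (G y z) \<le> M * dominator r y"
proof (cases "0 < y \<and> y \<noteq> a")
  case False
  have "M \<ge> 0" using M[of z] z V_0_nonneg by (smt (verit) mult_nonneg_nonneg norm_ge_zero zero_le_power2)
  then show ?thesis using False dominator_nonneg[of r y] by (simp add: G_zero)
next
  case True
  have r: "r \<ge> 0" using z norm_ge_zero[of z] by linarith
  have M0: "M \<ge> 0" using M[of z] z V_0_nonneg by (smt (verit) mult_nonneg_nonneg norm_ge_zero zero_le_power2)
  have NM: "cmod (N y w) \<le> M" if "cmod w \<le> r + 1" for w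
  proof -
    have "cmod (N y w) \<le> cmod ((S w)\<^sup>2 * of_real (V y)) + cmod (U w)" unfolding N_def by (rule norm_triangle_ineq4)
    also have "cmod ((S w)\<^sup>2 * of_real (V y)) = (cmod (S w))\<^sup>2 * V y" using V_bounds(1)[of y] True by (simp add: norm_mult norm_power)
    also have "\<dots> \<le> (cmod (S w))\<^sup>2 * V 0" using V_bounds(2)[of y] True by (intro mult_left_mono) auto
    finally show ?thesis using M[OF that] by linarith
  qed
  have quot: "cmod (G y w) \<le> M / d" if "cmod w \<le> r + 1" "d > 0" "cmod (w\<^sup>2 + (of_real y)\<^sup>2) \<ge> d" for w d
  proof -
    have "cmod (G y w) * d \<le> cmod (G y w) * cmod (w\<^sup>2 + (of_real y)\<^sup>2)" using that by (intro mult_left_mono) auto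
    also have "\<dots> = cmod (N y w)" using G_pos(2)[of y w] True by (simp flip: norm_mult)
    also have "\<dots> \<le> M" by (rule NM[OF that(1)])
    finally show ?thesis using that(2) by (simp add: field_simps)
  qed
  show ?thesis
  proof (cases "y \<le> r + 1/2")
    case y: True
    have "cmod (G y z) \<le> M / (3/4)"
    proof (rule maximum_modulus_frontier[where S = "cball 0 (r + 1)" and f = "G y"])
      show "G y holomorphic_on interior (cball 0 (r + 1))" using holG holomorphic_on_subset by blast
      show "continuous_on (closure (cball 0 (r + 1))) (G y)"
        using holG holomorphic_on_imp_continuous_on continuous_on_subset by blast
      show "cmod (G y w) \<le> M / (3/4)" if "w \<in> frontier (cball 0 (r + 1))" for w
      proof (rule quot)
        have w: "cmod w = r + 1" using that r by simp
        have "y\<^sup>2 \<le> (r + 1/2)\<^sup>2" using y True by (intro power_mono) auto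
        moreover have "(r + 1)\<^sup>2 - (r + 1/2)\<^sup>2 \<ge> 3/4" using r by (simp add: power2_eq_square algebra_simps)
        ultimately show "cmod (w\<^sup>2 + (of_real y)\<^sup>2) \<ge> 3/4"
          using norm_diff_ineq[of "w\<^sup>2" "(of_real y)\<^sup>2"] by (simp add: norm_power w)
        show "cmod w \<le> r + 1" using w by simp
      qed simp
    qed (use z in auto)
    also have "\<dots> \<le> M * 2" using M0 by simp
    also have "\<dots> \<le> M * dominator r y" using M0 y True by (intro mult_left_mono) (auto simp: dominator_def)
    finally show ?thesis .
  next
    case y: False
    define u where "u = y - r"
    have u: "u > 1/2" using y by (simp add: u_def)
    have "cmod (G y z) \<le> M / u\<^sup>2"
    proof (rule quot)
      have "(cmod z)\<^sup>2 \<le> r\<^sup>2" using z by (intro power_mono) auto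
      moreover have "u\<^sup>2 \<le> y\<^sup>2 - r\<^sup>2" using u r by (simp add: u_def power2_eq_square algebra_simps mult_left_mono)
      ultimately show "u\<^sup>2 \<le> cmod (z\<^sup>2 + (of_real y)\<^sup>2)"
        using norm_diff_ineq[of "(of_real y)\<^sup>2" "z\<^sup>2"] by (simp add: norm_power add.commute)
    qed (use z u in auto)
    also have "\<dots> = M * (1 / u\<^sup>2)" by simp
    also have "\<dots> \<le> M * (5 / (1 + u\<^sup>2))"
    proof (rule mult_left_mono[OF _ M0])
      have "u\<^sup>2 \<ge> (1/2)\<^sup>2" using u by (intro power_mono) auto
      then have "1 + u\<^sup>2 \<le> 5 * u\<^sup>2" by (simp add: power2_eq_square)
      moreover have "1 + u\<^sup>2 > 0" "u\<^sup>2 > 0" using u by (auto intro: add_pos_nonneg)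
      ultimately show "1 / u\<^sup>2 \<le> 5 / (1 + u\<^sup>2)" by (simp add: divide_simps)
    qed
    also have "\<dots> \<le> M * dominator r y" using M0 by (intro mult_left_mono) (auto simp: dominator_def u_def)
    finally show ?thesis .
  qed
qed

definition GI :: "complex \<Rightarrow> complex" where "GI z = (LINT y|lborel. G y z)"

lemma bound_exists: "\<exists>M. \<forall>w. cmod w \<le> r \<longrightarrow> (cmod (S w))\<^sup>2 * V 0 + cmod (U w) \<le> M"
proof -
  have "bounded ((\<lambda>w. (cmod (S w))\<^sup>2 * V 0 + cmod (U w)) ` cball 0 r)"
    by (intro compact_imp_bounded compact_continuous_image continuous_intros contS
        continuous_on_subset[OF holomorphic_on_imp_continuous_on[OF U(1)]]) auto
  then obtain M where "\<forall>w\<in>cball 0 r. \<bar>(cmod (S w))\<^sup>2 * V 0 + cmod (U w)\<bar> \<le> M" by (auto simp: bounded_iff)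
  then show ?thesis by (intro exI[of _ M]) (auto simp: abs_le_iff)
qed

lemma holGI: "GI holomorphic_on UNIV"
  unfolding GI_def[abs_def]
proof (rule holomorphic_on_dominated_integral[OF holG G_measurable])
  fix r :: real
  obtain M where M: "\<And>w. cmod w \<le> max r 0 + 1 \<Longrightarrow> (cmod (S w))\<^sup>2 * V 0 + cmod (U w) \<le> M" using bound_exists by blast
  show "\<exists>w. integrable lborel w \<and> (\<forall>y z. cmod z \<le> r \<longrightarrow> cmod (G y z) \<le> w y)"
    using G_bound[OF _ M] dominator_integral(1)[of "max r 0"]
    by (intro exI[of _ "\<lambda>y. M * dominator (max r 0) y"]) auto
qed

lemma U_exp_type: "U \<in> exp_type_class (2 * \<tau>)"
proof (rule exp_type_class_dominated[where R = "a + 1"])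
  show "(\<lambda>z. 1 - of_real (\<beta> a) * (S z)\<^sup>2) \<in> exp_type_class (2 * \<tau>)"
    by (intro exp_type_class_diff exp_type_class_const exp_type_class_cmult S2_exp_type) (use tau_nonneg in auto)
  fix z assume z: "a + 1 \<le> cmod z"
  have "(a + 1)\<^sup>2 \<le> (cmod z)\<^sup>2" using z a_pos by (intro power_mono) auto
  then have "1 \<le> (cmod z)\<^sup>2 - a\<^sup>2" using a_pos by (simp add: power2_eq_square algebra_simps)
  also have "\<dots> \<le> cmod (z\<^sup>2 + (of_real a)\<^sup>2)" using norm_diff_ineq[of "z\<^sup>2" "(of_real a)\<^sup>2"] by (simp add: norm_power)
  finally have "cmod (U z) * 1 \<le> cmod (U z) * cmod (z\<^sup>2 + (of_real a)\<^sup>2)" by (intro mult_left_mono) auto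
  then show "cmod (U z) \<le> cmod (1 - of_real (\<beta> a) * (S z)\<^sup>2)" unfolding U(3)[symmetric] norm_mult by simp
qed (use tau_nonneg U(1) in auto)

lemma GI_exp_type: "GI \<in> exp_type_class (2 * \<tau>)"
proof -
  have "\<exists>C>0. \<forall>z. cmod (GI z) \<le> C * exp ((2 * \<tau> + \<epsilon>) * cmod z)" if \<epsilon>: "\<epsilon> > 0" for \<epsilon>
  proof -
    \<comment> \<open>One half of \<epsilon> pays for \<open>S\<close> and \<open>U\<close>, the
      other for the factor linear in |z| from the majorant; passing from radius r to r + 1 costs a
      constant only.\<close>
    define d where "d = \<epsilon> / 2"
    have d: "d > 0" using \<epsilon> by (simp add: d_def)
    obtain C1 where C1: "C1 > 0" "\<And>z. cmod ((S z)\<^sup>2) \<le> C1 * exp ((2 * \<tau> + d) * cmod z)"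
      using S2_exp_type d unfolding exp_type_class_def by blast
    obtain C2 where C2: "C2 > 0" "\<And>z. cmod (U z) \<le> C2 * exp ((2 * \<tau> + d) * cmod z)"
      using U_exp_type d unfolding exp_type_class_def by blast
    define C where "C = C1 * V 0 + C2"
    have C: "C > 0" using C1 C2 V_0_nonneg by (simp add: C_def add_nonneg_pos)
    define P where "P = 2 / d + (1 + 5 * pi)"
    have P: "P > 0" using d by (simp add: P_def add_pos_pos)
    have "cmod (GI z) \<le> C * exp (2 * \<tau> + d) * P * exp ((2 * \<tau> + \<epsilon>) * cmod z)" for z
    proof -
      define r where "r = cmod z"
      define M where "M = C * exp ((2 * \<tau> + d) * (r + 1))"
      have r: "r \<ge> 0" by (simp add: r_def)
      have M: "(cmod (S w))\<^sup>2 * V 0 + cmod (U w) \<le> M" if w: "cmod w \<le> r + 1" for w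
      proof -
        have "(cmod (S w))\<^sup>2 * V 0 \<le> C1 * exp ((2 * \<tau> + d) * cmod w) * V 0"
          using C1(2)[of w] V_0_nonneg by (intro mult_right_mono) (auto simp: norm_power)
        then have "(cmod (S w))\<^sup>2 * V 0 + cmod (U w) \<le> C * exp ((2 * \<tau> + d) * cmod w)"
          using C2(2)[of w] by (simp add: C_def algebra_simps)
        also have "\<dots> \<le> M" unfolding M_def using C w d tau_nonneg by (intro mult_left_mono) auto
        finally show ?thesis .
      qed
      have "cmod (GI z) \<le> (LINT y|lborel. cmod (G y z))" unfolding GI_def by (rule integral_norm_bound)
      also have "\<dots> \<le> (LINT y|lborel. M * dominator r y)"
      proof (rule integral_mono')
        show "integrable lborel (\<lambda>y. M * dominator r y)" using dominator_integral(1)[OF r] by simp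
        show "cmod (G y z) \<le> M * dominator r y" for y by (rule G_bound[OF _ M]) (auto simp: r_def)
        show "0 \<le> M * dominator r y" for y using dominator_nonneg C by (auto simp: M_def)
      qed
      also have "\<dots> = M * (2 * r + 1 + 5 * pi)" using dominator_integral(2)[OF r] by simp
      also have "\<dots> \<le> M * (P * exp (d * r))"
      proof (rule mult_left_mono)
        have "2 * r = 2 / d * (d * r)" using d by simp
        also have "\<dots> \<le> P * (d * r)" using r d by (intro mult_right_mono) (auto simp: P_def)
        finally have "2 * r \<le> P * (d * r)" .
        moreover have "2 / d \<ge> 0" using d by simp
        ultimately have "2 * r + 1 + 5 * pi \<le> P * (d * r) + P" unfolding P_def by linarith
        also have "\<dots> = P * (1 + d * r)" by (simp add: algebra_simps)
        also have "\<dots> \<le> P * exp (d * r)" using P exp_ge_add_one_self[of "d * r"] by (intro mult_left_mono) auto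
        finally show "2 * r + 1 + 5 * pi \<le> P * exp (d * r)" .
      qed (use C in \<open>simp add: M_def\<close>)
      also have "\<dots> = C * P * exp ((2 * \<tau> + d) * (r + 1) + d * r)" by (simp add: M_def exp_add)
      also have "(2 * \<tau> + d) * (r + 1) + d * r = (2 * \<tau> + d) + (2 * \<tau> + \<epsilon>) * r" by (simp add: d_def field_simps)
      also have "C * P * exp ((2 * \<tau> + d) + (2 * \<tau> + \<epsilon>) * r) = C * exp (2 * \<tau> + d) * P * exp ((2 * \<tau> + \<epsilon>) * cmod z)"
        unfolding exp_add by (simp add: r_def)
      finally show ?thesis .
    qed
    moreover have "C * exp (2 * \<tau> + d) * P > 0" using C P by simp
    ultimately show ?thesis by blast
  qed
  then show ?thesis using holGI by (simp add: exp_type_class_def entire_def)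
qed

lemma ident_exp_type: "(\<lambda>z. z) \<in> exp_type_class 0"
proof -
  have "\<exists>C>0. \<forall>z. cmod z \<le> C * exp ((0 + \<epsilon>) * cmod z)" if \<epsilon>: "\<epsilon> > 0" for \<epsilon>
  proof (intro exI[of _ "1 / \<epsilon>"] conjI allI)
    fix z
    have "\<epsilon> * cmod z \<le> exp (\<epsilon> * cmod z)" using exp_ge_add_one_self[of "\<epsilon> * cmod z"] by linarith
    then show "cmod z \<le> 1 / \<epsilon> * exp ((0 + \<epsilon>) * cmod z)" using \<epsilon> by (simp add: field_simps)
  qed (use \<epsilon> in auto)
  then show ?thesis by (auto simp: exp_type_class_def entire_def intro!: holomorphic_intros)
qed

text \<open>\<open>T0\<close> is \<open>S\<^sup>2\<close> times the continued Cauchy integral of \<open>V\<close>: for \<open>Re z \<noteq> 0\<close> the part of \<open>GI z\<close> containing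
  \<open>U z\<close> integrates to \<open>- sgn (Re z) * pi * U z / (2 * z)\<close>. The functions \<open>Tm\<close> and \<open>Tp\<close> agree with \<open>trunc a\<close> to second
  order at the nonzero zeros of \<open>B\<close>.\<close>

definition T0 :: "complex \<Rightarrow> complex" where "T0 z = U z / 2 - z / of_real pi * GI z"
definition Tm :: "complex \<Rightarrow> complex" where "Tm z = T0 z - of_real (V 0 / 2) * (S z)\<^sup>2"
definition Tp :: "complex \<Rightarrow> complex" where "Tp z = Tm z + of_real (\<beta> 0 / a\<^sup>2) * (S z)\<^sup>2"

section \<open>Exponential type and one-sided bounds of the extremal functions\<close>

lemma T0_exp_type: "T0 \<in> exp_type_class (2 * \<tau>)"
proof -
  have "(\<lambda>z. 1 / 2 * U z - 1 / of_real pi * (z * GI z)) \<in> exp_type_class (2 * \<tau>)"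
    using exp_type_class_mult[OF ident_exp_type GI_exp_type]
    by (intro exp_type_class_diff exp_type_class_cmult U_exp_type) simp
  then show ?thesis by (simp add: T0_def[abs_def])
qed

lemma Tm_exp_type: "Tm \<in> exp_type_class (2 * \<tau>)"
  unfolding Tm_def[abs_def] by (intro exp_type_class_diff exp_type_class_cmult T0_exp_type S2_exp_type)

lemma Tp_exp_type: "Tp \<in> exp_type_class (2 * \<tau>)"
  unfolding Tp_def[abs_def] by (intro exp_type_class_add exp_type_class_cmult Tm_exp_type S2_exp_type)

lemma U_real: "U (of_real x) = of_real ((1 - \<beta> a * (s x)\<^sup>2) / (x\<^sup>2 + a\<^sup>2))"
proof -
  have nz: "x\<^sup>2 + a\<^sup>2 \<noteq> 0" using a_pos by (auto simp: add_nonneg_eq_0_iff)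
  have "U (of_real x) * of_real (x\<^sup>2 + a\<^sup>2) = of_real (1 - \<beta> a * (s x)\<^sup>2)"
    using U(3)[of "of_real x"] by (simp add: S_of_real)
  then have "U (of_real x) = of_real (1 - \<beta> a * (s x)\<^sup>2) / of_real (x\<^sup>2 + a\<^sup>2)"
    using nz by (metis nonzero_mult_div_cancel_right of_real_eq_0_iff)
  then show ?thesis by (simp only: of_real_divide)
qed

text \<open>Half the Poisson integral, at distance |x|, of the even extension of \<open>V\<close> to
  the whole imaginary axis, whence the bound by V(0)/2.\<close>

definition cauchy_V :: "real \<Rightarrow> real" where
  "cauchy_V x = \<bar>x\<bar> / pi * (LINT y|lborel. indicator {0<..} y * (V y / (x\<^sup>2 + y\<^sup>2)))"

lemma cauchy_V:
  assumes x: "x \<noteq> 0"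
  shows "0 \<le> cauchy_V x" "cauchy_V x \<le> V 0 / 2"
    "T0 (of_real x) = of_real ((if x > 0 then (1 - \<beta> a * (s x)\<^sup>2) / (x\<^sup>2 + a\<^sup>2) else 0) - sgn x * (s x)\<^sup>2 * cauchy_V x)"
proof -
  define c where "c = (LINT y|lborel. indicator {0<..} y * (V y / (x\<^sup>2 + y\<^sup>2)))"
  define u where "u = (1 - \<beta> a * (s x)\<^sup>2) / (x\<^sup>2 + a\<^sup>2)"
  note h = half_line_integral[OF x]
  have le: "indicator {0<..} y * (V y / (x\<^sup>2 + y\<^sup>2)) \<le> V 0 * (indicator {0<..} y * (1 / (x\<^sup>2 + y\<^sup>2)))"
    "0 \<le> indicator {0<..} y * (V y / (x\<^sup>2 + y\<^sup>2))" for y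
    using V_bounds[of y] by (auto simp: indicator_def divide_right_mono)
  have hV: "integrable lborel (\<lambda>y. V 0 * (indicator {0<..} y * (1 / (x\<^sup>2 + y\<^sup>2))))" using h(1) by (rule integrable_mult_right)
  have iV: "integrable lborel (\<lambda>y. indicator {0<..} y * (V y / (x\<^sup>2 + y\<^sup>2)))"
  proof (rule Bochner_Integration.integrable_bound[OF hV])
    show "(\<lambda>y. indicator {0<..} y * (V y / (x\<^sup>2 + y\<^sup>2))) \<in> borel_measurable lborel"
      using V_measurable by measurable
    have "norm (indicator {0<..} y * (V y / (x\<^sup>2 + y\<^sup>2))) \<le> norm (V 0 * (indicator {0<..} y * (1 / (x\<^sup>2 + y\<^sup>2))))" for y
      unfolding real_norm_def using le[of y] by linarith
    then show "AE y in lborel. norm (indicator {0<..} y * (V y / (x\<^sup>2 + y\<^sup>2))) \<le> norm (V 0 * (indicator {0<..} y * (1 / (x\<^sup>2 + y\<^sup>2))))"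
      by simp
  qed
  have c0: "c \<ge> 0" unfolding c_def by (rule Bochner_Integration.integral_nonneg) (use le in auto)
  then show "0 \<le> cauchy_V x" unfolding cauchy_V_def c_def[symmetric] by simp
  have "c \<le> (LINT y|lborel. V 0 * (indicator {0<..} y * (1 / (x\<^sup>2 + y\<^sup>2))))"
    unfolding c_def by (rule integral_mono[OF iV hV]) (rule le)
  also have "\<dots> = V 0 * (pi / (2 * \<bar>x\<bar>))" by (simp only: integral_mult_right_zero h(2))
  finally have "\<bar>x\<bar> / pi * c \<le> \<bar>x\<bar> / pi * (V 0 * (pi / (2 * \<bar>x\<bar>)))" by (intro mult_left_mono) auto
  then show "cauchy_V x \<le> V 0 / 2" unfolding cauchy_V_def c_def[symmetric] using x by simp
  define J where "J = (\<lambda>y. (s x)\<^sup>2 * (indicator {0<..} y * (V y / (x\<^sup>2 + y\<^sup>2))) - u * (indicator {0<..} y * (1 / (x\<^sup>2 + y\<^sup>2))))"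
  have iJ: "integrable lborel J" unfolding J_def by (intro Bochner_Integration.integrable_diff integrable_mult_right iV h(1))
  have "GI (of_real x) = (LINT y|lborel. complex_of_real (J y))"
    unfolding GI_def
  proof (rule integral_cong_AE)
    show "(\<lambda>y. G y (of_real x)) \<in> borel_measurable lborel" by (rule G_measurable)
    show "(\<lambda>y. complex_of_real (J y)) \<in> borel_measurable lborel" using iJ by measurable
    show "AE y in lborel. G y (of_real x) = of_real (J y)"
      using AE_lborel_singleton[of a] AE_lborel_singleton[of "cmod (of_real x)"]
    proof eventually_elim
      case (elim y)
      have "N y (of_real x) / ((of_real x)\<^sup>2 + (of_real y)\<^sup>2) = of_real (((s x)\<^sup>2 * V y - u) / (x\<^sup>2 + y\<^sup>2))"
        unfolding N_def U_real u_def[symmetric] S_of_real by simp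
      then show ?case unfolding G_eq[OF elim] J_def
        by (simp add: indicator_def diff_divide_distrib)
    qed
  qed
  also have "\<dots> = of_real (LINT y|lborel. J y)" by (rule integral_complex_of_real)
  also have "(LINT y|lborel. J y) = (s x)\<^sup>2 * c - u * (pi / (2 * \<bar>x\<bar>))"
    unfolding J_def c_def using iV h by (simp only: Bochner_Integration.integral_diff integrable_mult_right integral_mult_right_zero)
  finally have "T0 (of_real x) = of_real (u / 2 - x / pi * ((s x)\<^sup>2 * c - u * (pi / (2 * \<bar>x\<bar>))))"
    unfolding T0_def U_real u_def[symmetric] by simp
  \<comment> \<open>The integral of 1/(x^2 + y^2) over the half-line is pi / (2 |x|), so the terms
    with \<open>u\<close> add up to u/2 + sgn(x) u/2: this is the truncation.\<close>
  also have "u / 2 - x / pi * ((s x)\<^sup>2 * c - u * (pi / (2 * \<bar>x\<bar>))) = (if x > 0 then u else 0) - sgn x * (s x)\<^sup>2 * cauchy_V x"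
    unfolding cauchy_V_def c_def[symmetric] using x by (cases "x > 0") (auto simp: field_simps sgn_if)
  finally show "T0 (of_real x) = of_real ((if x > 0 then (1 - \<beta> a * (s x)\<^sup>2) / (x\<^sup>2 + a\<^sup>2) else 0) - sgn x * (s x)\<^sup>2 * cauchy_V x)"
    unfolding u_def .
qed

lemma \<beta>_0: "\<beta> 0 * (s 0)\<^sup>2 = 1"
  using \<beta>_eq[of 0] \<beta>_pos[of 0] by (simp add: s_def \<beta>_def)

lemma T0_0: "T0 0 = of_real ((s 0)\<^sup>2 * V 0 / 2)"
proof -
  have "(1 - \<beta> a * (s 0)\<^sup>2) / a\<^sup>2 = (s 0)\<^sup>2 * V 0" using \<beta>_0 a_pos unfolding V_0 by (simp add: field_simps)
  then show ?thesis using U_real[of 0] by (simp add: T0_def)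
qed

lemma real_T0: "T0 (of_real x) \<in> \<real>"
proof (cases "x = 0")
  case True
  then have "T0 (of_real x) = of_real ((s 0)\<^sup>2 * V 0 / 2)" using T0_0 by simp
  then show ?thesis by (simp only: Reals_of_real)
next
  case False
  show ?thesis unfolding cauchy_V(3)[OF False] by (rule Reals_of_real)
qed

text \<open>For x > 0 only nonnegative terms are subtracted from 1/(x^2 + a^2). For x < 0 the term
  s^2 \<open>cauchy_V\<close> has the wrong sign and is offset by the shift s^2 V(0)/2.\<close>

lemma Tm_minorant: "real_minorant Tm (trunc a)"
  unfolding real_minorant_def
proof (intro allI conjI)
  fix x :: real
  show "Tm (of_real x) \<in> \<real>" unfolding Tm_def S_of_real by (intro Reals_diff real_T0 Reals_mult Reals_power Reals_of_real)
  have Re: "Re (Tm (of_real x)) = Re (T0 (of_real x)) - V 0 / 2 * (s x)\<^sup>2" unfolding Tm_def S_of_real by simp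
  show "Re (Tm (of_real x)) \<le> trunc a x"
  proof (cases "x = 0")
    case True
    then show ?thesis unfolding Re by (simp add: T0_0 trunc_def)
  next
    case False
    note c = cauchy_V[OF False]
    have s2: "(s x)\<^sup>2 \<ge> 0" by simp
    show ?thesis
    proof (cases "x > 0")
      case True
      have "0 \<le> \<beta> a * (s x)\<^sup>2 / (x\<^sup>2 + a\<^sup>2)" "0 \<le> (s x)\<^sup>2 * cauchy_V x" "0 \<le> V 0 / 2 * (s x)\<^sup>2"
        using \<beta>_pos[of a] c(1) V_0_nonneg by auto
      then show ?thesis using True unfolding Re c(3) by (simp add: trunc_def diff_divide_distrib)
    next
      case F: False
      have "(s x)\<^sup>2 * cauchy_V x \<le> (s x)\<^sup>2 * (V 0 / 2)" using c(2) by (intro mult_left_mono) auto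
      then show ?thesis using F False unfolding Re c(3) by (simp add: trunc_def mult.commute)
    qed
  qed
qed

lemma Tp_majorant: "real_majorant Tp (trunc a)"
  unfolding real_majorant_def
proof (intro allI conjI)
  fix x :: real
  show "Tp (of_real x) \<in> \<real>" unfolding Tp_def Tm_def S_of_real
    by (intro Reals_add Reals_diff real_T0 Reals_mult Reals_power Reals_of_real)
  \<comment> \<open>The added multiple of S^2 exceeds the shift in \<open>Tm\<close> by V(0)/2,
    which offsets \<open>cauchy_V\<close> for x > 0, and by \<beta>(a)/a^2, which offsets \<beta>(a)
    s^2 / (x^2 + a^2).\<close>
  have "\<beta> 0 / a\<^sup>2 = V 0 + \<beta> a / a\<^sup>2" unfolding V_0 by (simp add: diff_divide_distrib)
  then have Re: "Re (Tp (of_real x)) = Re (T0 (of_real x)) + V 0 / 2 * (s x)\<^sup>2 + \<beta> a / a\<^sup>2 * (s x)\<^sup>2"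
    unfolding Tp_def Tm_def S_of_real by (simp add: algebra_simps)
  show "trunc a x \<le> Re (Tp (of_real x))"
  proof (cases "x = 0")
    case True
    have "V 0 * (s 0)\<^sup>2 + \<beta> a / a\<^sup>2 * (s 0)\<^sup>2 = \<beta> 0 * (s 0)\<^sup>2 / a\<^sup>2" unfolding V_0 by (simp add: left_diff_distrib diff_divide_distrib)
    moreover have "Re (Tp 0) = V 0 * (s 0)\<^sup>2 + \<beta> a / a\<^sup>2 * (s 0)\<^sup>2"
      using Re unfolding True by (simp add: T0_0)
    ultimately show ?thesis using \<beta>_0 by (simp add: True trunc_def)
  next
    case False
    note c = cauchy_V[OF False]
    show ?thesis
    proof (cases "x > 0")
      case True
      have "(s x)\<^sup>2 * cauchy_V x \<le> (s x)\<^sup>2 * (V 0 / 2)" using c(2) by (intro mult_left_mono) auto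
      moreover have "\<beta> a * (s x)\<^sup>2 / (x\<^sup>2 + a\<^sup>2) \<le> \<beta> a * (s x)\<^sup>2 / a\<^sup>2"
        using \<beta>_pos[of a] a_pos by (intro divide_left_mono mult_nonneg_nonneg mult_pos_pos) (auto intro: add_nonneg_pos)
      ultimately show ?thesis using True unfolding Re c(3) by (simp add: trunc_def diff_divide_distrib mult.commute)
    next
      case F: False
      have "0 \<le> (s x)\<^sup>2 * cauchy_V x" "0 \<le> V 0 / 2 * (s x)\<^sup>2" "0 \<le> \<beta> a / a\<^sup>2 * (s x)\<^sup>2"
        using c(1) V_0_nonneg \<beta>_pos[of a] by auto
      then show ?thesis using F False unfolding Re c(3) by (simp add: trunc_def)
    qed
  qed
qed

lemma gap_Tp_Tm: "gap_integral E Tp Tm = ennreal (1 / (a\<^sup>2 * k0))"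
proof -
  have eq: "(Re (Tp (of_real x)) - Re (Tm (of_real x))) / (cmod (E (of_real x)))\<^sup>2 =
      \<beta> 0 / a\<^sup>2 * ((s x)\<^sup>2 / (cmod (E (of_real x)))\<^sup>2)" for x
    unfolding Tp_def S_of_real by simp
  have "gap_integral E Tp Tm = ennreal (LINT x|lborel. \<beta> 0 / a\<^sup>2 * ((s x)\<^sup>2 / (cmod (E (of_real x)))\<^sup>2))"
    unfolding gap_integral_def eq
    by (intro nn_integral_eq_integral integrable_mult_right s_integrable AE_I2 mult_nonneg_nonneg divide_nonneg_nonneg)
      (use \<beta>_pos[of 0] in auto)
  also have "(LINT x|lborel. \<beta> 0 / a\<^sup>2 * ((s x)\<^sup>2 / (cmod (E (of_real x)))\<^sup>2)) = \<beta> 0 / a\<^sup>2 * (pi * b1 / e0)"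
    by (simp only: integral_mult_right_zero s_integral)
  also have "\<dots> = 1 / (a\<^sup>2 * k0)"
  proof -
    \<comment> \<open>\<beta>(0) = 1 / b1^2 makes the product pi / (a^2 e0 b1), which is 1 / (a^2
      k0).\<close>
    have "\<beta> 0 * b1\<^sup>2 = 1" using \<beta>_0 by (simp add: s_def b1_def)
    then have "\<beta> 0 = 1 / b1\<^sup>2" by (simp add: eq_divide_eq)  (metis mult_zero_right zero_neq_one power_zero_numeral)
    then show ?thesis using a_pos e0_b1_pos by (simp add: k0_def field_simps power2_eq_square)
  qed
  finally show ?thesis .
qed

text \<open>An infinite gap is immediate. Otherwise \<open>value_at_0_le\<close> applies to Fp - Fm,
  whose value at 0 is at least the jump of \<open>trunc a\<close>.\<close>

lemma gap_ge:
  assumes Fp: "Fp \<in> exp_type_class (2 * \<tau>)" and Fm: "Fm \<in> exp_type_class (2 * \<tau>)"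
    and minor: "real_minorant Fm (trunc a)" and major: "real_majorant Fp (trunc a)"
  shows "gap_integral E Fp Fm \<ge> ennreal (1 / (a\<^sup>2 * k0))"
proof (cases "gap_integral E Fp Fm = \<infinity>")
  case False
  define f where "f = (\<lambda>x::real. Re (Fp (of_real x)) - Re (Fm (of_real x)))"
  have F: "tame (\<lambda>z. Fp z - Fm z)" by (intro tame_exp_type exp_type_class_diff Fp Fm)
  have real: "Fp (of_real x) - Fm (of_real x) = of_real (f x)" for x
    using minor major unfolding real_minorant_def real_majorant_def f_def
    by (simp add: complex_eq_iff complex_is_Real_iff)
  have f0: "f x \<ge> 0" for x using minor major unfolding real_minorant_def real_majorant_def f_def
    by (smt (verit))
  have cont: "continuous_on UNIV (\<lambda>x::real. Re (F (of_real x)))" if "F \<in> exp_type_class (2 * \<tau>)" for F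
    by (intro continuous_intros continuous_on_compose2[OF holomorphic_on_imp_continuous_on[OF exp_type_class_entire[OF that, of UNIV]]]) auto
  have g0: "f x / (cmod (E (of_real x)))\<^sup>2 \<ge> 0" for x using f0 by simp
  have gap: "gap_integral E Fp Fm = (\<integral>\<^sup>+ x. ennreal (f x / (cmod (E (of_real x)))\<^sup>2) \<partial>lborel)"
    by (simp add: gap_integral_def f_def)
  have int: "integrable lborel (\<lambda>x. f x / (cmod (E (of_real x)))\<^sup>2)"
  proof (rule integrableI_nonneg)
    have "continuous_on UNIV (\<lambda>x. f x / (cmod (E (of_real x)))\<^sup>2)"
      unfolding f_def using E_real_nz by (intro continuous_intros cont Fp Fm E_real_cont) auto
    then show "(\<lambda>x. f x / (cmod (E (of_real x)))\<^sup>2) \<in> borel_measurable lborel" by (simp add: borel_measurable_continuous_onI)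
    show "(\<integral>\<^sup>+ x. ennreal (f x / (cmod (E (of_real x)))\<^sup>2) \<partial>lborel) < \<infinity>"
      using False unfolding gap by (simp add: less_top)
  qed (use g0 in auto)
  \<comment> \<open>\<open>trunc a\<close> jumps at 0 and takes the larger value there; continuity
    of \<open>Fm\<close> from the left yields the left limit 0 as bound.\<close>
  have "Re (Fm 0) \<le> 0"
  proof -
    have "isCont (\<lambda>x::real. Re (Fm (of_real x))) 0" using cont[OF Fm] by (simp add: continuous_on_eq_continuous_at)
    then have "((\<lambda>x::real. Re (Fm (of_real x))) \<longlongrightarrow> Re (Fm (of_real 0))) (at_left 0)"
      unfolding isCont_def by (rule filterlim_mono[OF _ order_refl]) (simp add: at_le)
    moreover have "\<forall>\<^sub>F x in at_left 0. Re (Fm (of_real x)) \<le> 0"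
      using eventually_at_leftI[of "-1" 0 "\<lambda>x. Re (Fm (of_real x)) \<le> 0"] minor
      unfolding real_minorant_def by (auto simp: trunc_def) (smt (verit))
    ultimately show ?thesis by (intro tendsto_upperbound[of _ "Re (Fm 0)" "at_left (0::real)"]) auto
  qed
  moreover have "1 / a\<^sup>2 \<le> Re (Fp 0)"
    using major unfolding real_majorant_def by (auto simp: trunc_def dest: spec[of _ 0])
  ultimately have "1 / a\<^sup>2 \<le> f 0" by (simp add: f_def)
  then have "1 / a\<^sup>2 / k0 \<le> f 0 / k0" using k0_pos by (intro divide_right_mono) auto
  also have "f 0 / k0 = f 0 * pi / (e0 * b1)" by (simp add: k0_def)
  also have "\<dots> \<le> (LINT x|lborel. f x / (cmod (E (of_real x)))\<^sup>2)" by (rule value_at_0_le[OF F real f0 int])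
  finally have "1 / (a\<^sup>2 * k0) \<le> (LINT x|lborel. f x / (cmod (E (of_real x)))\<^sup>2)" by simp
  then show ?thesis unfolding gap using g0 int by (subst nn_integral_eq_integral) (auto intro: ennreal_leI)
qed simp

end

theorem theorem1:
  fixes a \<tau> :: real
    and E :: "complex \<Rightarrow> complex"
    and K :: "complex \<Rightarrow> complex \<Rightarrow> complex"
  assumes "a > 0"
    and "hermite_biehler E"
    and "bounded_type E" and "mean_type E = ereal \<tau>"
    and "\<And>x::real. E (of_real x) \<noteq> 0"
    and "\<And>z. star E z = E (- z)"
    and "companion_B E \<notin> de_Branges E"
    and "reproducing_kernel E K"
  shows "(\<forall>Fp \<in> exp_type_class (2 * \<tau>). \<forall>Fm \<in> exp_type_class (2 * \<tau>).
            real_minorant Fm (trunc a) \<and> real_majorant Fp (trunc a) \<longrightarrow>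
            gap_integral E Fp Fm \<ge> ennreal (1 / (a\<^sup>2 * Re (K 0 0))))
       \<and> (\<exists>Tp \<in> exp_type_class (2 * \<tau>). \<exists>Tm \<in> exp_type_class (2 * \<tau>).
            real_minorant Tm (trunc a) \<and> real_majorant Tp (trunc a) \<and>
            gap_integral E Tp Tm = ennreal (1 / (a\<^sup>2 * Re (K 0 0))))"
proof -
  interpret truncation_problem E \<tau> a by unfold_locales (use assms in auto)
  have K: "Re (K 0 0) = k0" using kernel_value[OF assms(8)] by simp
  show ?thesis unfolding K
    using gap_ge Tp_exp_type Tm_exp_type Tm_minorant Tp_majorant gap_Tp_Tm by blast
qed

end
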